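(* For all $\hat u_h=(u_0,u^\Gamma)\in V_h\times V_h^\Gamma$, with $P_0\hat u_h:=(u_0,0)$ and $P_1\hat u_h:=(0,u^\Gamma)$, the following uniform norm equivalences hold: $$\|\hat u_h\|_b^2\sim\|P_0\hat u_h\|_b^2+\|P_1\hat u_h\|_b^2,\qquad \|\hat u_h\|_a^2\sim\|P_0\hat u_h\|_a^2+\|P_1\hat u_h\|_a^2 .$$ The constants in $\sim$ are independent of $\hat u_h$, of $h$ and of the location of the interface $\Gamma$ in the triangulation.
   Context: Geometry and mesh. $d\in\{2,3\}$, $k\ge 1$; $\Omega\subset\mathbb{R}^d$ is a bounded connected polygonal domain with a non-overlapping partitioning into $\Omega_1,\Omega_2$, and $\Gamma=\overline{\Omega}_1\cap\overline{\Omega}_2$ is the (smooth) interface with unit normal $\mathbf{n}_\Gamma$ pointing from $\Omega_1$ into $\Omega_2$. $\{\mathcal{T}_h\}_{h>0}$ is a family of shape regular (not necessarily quasi-uniform) simplicial triangulations of $\Omega$, not fitted to $\Gamma$; $h_T$ is the diameter of $T\in\mathcal{T}_h$. $V_h$ is the space of continuous piecewise polynomials of degree $\le k$ on $\mathcal{T}_h$ vanishing on $\partial\Omega$. $\mathcal{T}_h^\Gamma$ is the set of simplices cut by $\Gamma$ and $\Omega_h^\Gamma$ is the domain they form; $\Omega_{i,h}^{\rm ex}$ is the domain formed by all simplices with nonzero intersection with $\Omega_i$; $\Omega_{i,h}^-=\bigcup\{T\in\mathcal{T}_h: T\subset\overline{\Omega}_i\}$, so $\Omega_{i,h}^{\rm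 ex}=\Omega_{i,h}^-\cup\Omega_h^\Gamma$. $V_{i,h}=\{(v_h)_{|\Omega_{i,h}^{\rm ex}}: v_h\in V_h\}$. Norms. $\|\cdot\|_\omega$ is the $L^2$ norm on $\omega$ and $(\cdot,\cdot)_\omega$ the $L^2$ scalar product. Scalings with $h$ are element-wise: $\|h^{-1}v\|_{\Omega_h^\Gamma}^2=\sum_{T\in\mathcal{T}_h^\Gamma}h_T^{-2}\|v\|_T^2$, $(h^{-1}u,v)_\Gamma=\sum_{T\in\mathcal{T}_h^\Gamma}h_T^{-1}(u,v)_{T\cap\Gamma}$, $\|h^{-1/2}v\|_\Gamma^2=(h^{-1}v,v)_\Gamma$. $A\sim B$ means $c_1B\le A\le c_2B$ with constants $c_1,c_2>0$ independent of $h$ and of the location of $\Gamma$ in the triangulation (they may depend on shape regularity, $d$, $k$, the smoothness of $\Gamma$, $\alpha_1,\alpha_2$, $\gamma$, $\beta$). Spaces. $\phi_j$, $j\in I_0$, are the nodal basis functions of $V_h$. $I_i\subset I_0$ are the labels of nodes in $\Omega_{i,h}^{\rm ex}$, $I^\Gamma\subset I_0$ those of nodes in $\Omega_h^\Gamma$, $I_i^\Gamma=\{j\in I^\Gamma:\text{node } j\text{ is not in }\Omega_i\}$, $i=1,2$. It is assumed that no nodes lie on $\Gamma$; then $I^\Gamma=I_1^\Gamma\cup I_2^\Gamma$ is a disjoint partition. Cut basis functions: $\phi_j^\Gamma=\phi_j|_{\Omega_h^\Gamma}$, $j\in I^\Gamma$. $V_i^\Gamma=\mathrm{span}\{\phi_j^\Gamma: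 j\in I_i^\Gamma\}$ and $V_h^\Gamma=V_1^\Gamma\oplus V_2^\Gamma$ (also denoted $V^\Gamma$); $Q_i:V_h^\Gamma\to V_i^\Gamma$, $Q_i\big(\sum_{j\in I^\Gamma}\beta_j\phi_j^\Gamma\big)=\sum_{j\in I_i^\Gamma}\beta_j\phi_j^\Gamma$. Functions in $V_i^\Gamma$ are extended by zero to $\Omega_{i,h}^{\rm ex}$. The isomorphism $L:V_h\times V_h^\Gamma\to V_{1,h}\times V_{2,h}$ is $L(u_0,u^\Gamma)=(u_{1,h},u_{2,h})$ with $u_{i,h}={u_0}_{|\Omega_{i,h}^{\rm ex}}+Q_iu^\Gamma$. Bilinear forms. $\alpha_1,\alpha_2>0$ are the diffusion coefficients, $\gamma,\beta>0$ fixed parameters, $[\![\cdot]\!]$ the jump across $\Gamma$ (resp. across a face), $[\![u_h]\!]=(u_{1,h}-u_{2,h})_{|\Gamma}$, $\{\!\!\{\cdot\}\!\!\}$ a weighted averaging operator across $\Gamma$, $\bar\alpha$ a corresponding average of $\alpha_1,\alpha_2$, and $\mathcal{F}_{g,i}$ a suitable subset of faces in $\Omega_h^\Gamma$ with face diameters $h_F$. For $u_h,v_h\in V_{1,h}\times V_{2,h}$: $$A_h(u_h,v_h)=\sum_{i=1}^2(\alpha_i\nabla u_{i,h},\nabla v_{i,h})_{\Omega_i}+N_h^c(u_h,v_h)+N_h^c(v_h,u_h)+\bar\alpha\gamma(h^{-1}[\![u_h]\!],[\![v_h]\!])_\Gamma+G_h(u_h,v_h),$$ $$N_h^c(u_h,v_h)=(\{\!\!\{-\alpha\nabla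 v_h\}\!\!\}\cdot\mathbf{n}_\Gamma,[\![u_h]\!])_\Gamma,\quad G_h(u_h,v_h)=\beta\sum_{i=1}^2\sum_{\ell=1}^k\sum_{F\in\mathcal{F}_{g,i}}h_F^{2\ell-1}([\![\partial_n^\ell u_{i,h}]\!],[\![\partial_n^\ell v_{i,h}]\!])_F .$$ Set $\hat A_h(\hat u_h,\hat v_h)=A_h(L\hat u_h,L\hat v_h)$ on $V_h\times V_h^\Gamma$. The averaging, $\gamma$, $\beta$ and $\mathcal{F}_{g,i}$ are such that the following norm equivalence, known from the CutFEM literature, holds: $\hat A_h(\hat u_h,\hat u_h)\sim\sum_{i=1}^2\|\nabla u_{i,h}\|_{\Omega_{i,h}^{\rm ex}}^2+\|h^{-1/2}(u_{1,h}-u_{2,h})\|_\Gamma^2$ for all $\hat u_h\in V_h\times V_h^\Gamma$. Energy norms on $V_h\times V_h^\Gamma$: $\|\hat u_h\|_a^2:=\hat A_h(\hat u_h,\hat u_h)$ and $$\|\hat u_h\|_b^2:=\sum_{i=1}^2\|\nabla(u_0+Q_iu^\Gamma)\|_{\Omega_{i,h}^{\rm ex}}^2+\|h^{-1/2}(Q_1u^\Gamma-Q_2u^\Gamma)\|_\Gamma^2 .$$ *)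

theory Defs
  imports "HOL-Analysis.Analysis"
begin

section \<open>Surface measure\<close>

text \<open>The \<open>m\<close>-dimensional Hausdorff measure, normalised so that it agrees with Lebesgue measure
  on \<open>m\<close>-dimensional planes. It is used for \<open>m = d - 1 > 0\<close> only, so that sets of diameter \<open>0\<close>
  contribute \<open>0\<close> to the sum. The outer measure is a metric outer measure, hence countably additive
  on the Borel sets, so that \<open>measure_of\<close> does not collapse to the zero measure.\<close>

definition hausdorff_pre :: "nat \<Rightarrow> real \<Rightarrow> 'a::metric_space set \<Rightarrow> ennreal" where
  "hausdorff_pre m \<delta> A =
     (INF U \<in> {U :: nat \<Rightarrow> 'a set. A \<subseteq> (\<Union>n. U n) \<and> (\<forall>n. bounded (U n) \<and> diameter (U n) \<le> \<delta>)}.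
        \<Sum>n. ennreal (unit_ball_vol (real m) * (diameter (U n) / 2) ^ m))"

definition hausdorff_outer :: "nat \<Rightarrow> 'a::metric_space set \<Rightarrow> ennreal" where
  "hausdorff_outer m A = (SUP \<delta> \<in> {0<..}. hausdorff_pre m \<delta> A)"

definition hausdorff_measure :: "nat \<Rightarrow> 'a::metric_space measure" where
  "hausdorff_measure m = measure_of UNIV (sets borel) (hausdorff_outer m)"

abbreviation surf :: "'a::euclidean_space measure" where
  "surf \<equiv> hausdorff_measure (DIM('a) - 1)"


section \<open>Derivatives\<close>

text \<open>Derivatives are taken within a set \<open>T\<close>, which is either \<open>UNIV\<close> or a simplex with nonempty
  interior. For a function that is polynomial on the simplex \<open>T\<close>, \<open>grad T f\<close> is at every point of \<open>T\<close>
  (boundary included) the gradient of that polynomial, whatever \<open>f\<close> is off \<open>T\<close>.\<close>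

definition grad :: "'a::euclidean_space set \<Rightarrow> ('a \<Rightarrow> real) \<Rightarrow> 'a \<Rightarrow> 'a" where
  "grad T f x = (\<Sum>b\<in>Basis. frechet_derivative f (at x within T) b *\<^sub>R b)"

definition dir_deriv :: "'a::euclidean_space set \<Rightarrow> 'a \<Rightarrow> nat \<Rightarrow> ('a \<Rightarrow> real) \<Rightarrow> 'a \<Rightarrow> real" where
  "dir_deriv T n l = (\<lambda>g x. frechet_derivative g (at x within T) n) ^^ l"

primrec C_k_on :: "nat \<Rightarrow> 'a::euclidean_space set \<Rightarrow> ('a \<Rightarrow> real) \<Rightarrow> bool" where
  "C_k_on 0 U f \<longleftrightarrow> continuous_on U f"
| "C_k_on (Suc n) U f \<longleftrightarrow> (\<forall>x\<in>U. f differentiable (at x)) \<and>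
     (\<forall>b\<in>Basis. C_k_on n U (\<lambda>x. frechet_derivative f (at x) b))"

definition C_inf_on :: "'a::euclidean_space set \<Rightarrow> ('a \<Rightarrow> real) \<Rightarrow> bool" where
  "C_inf_on U f \<longleftrightarrow> (\<forall>n. C_k_on n U f)"


section \<open>Domain and interface\<close>

definition polygonal_domain :: "'a::euclidean_space set \<Rightarrow> bool" where
  "polygonal_domain \<Omega> \<longleftrightarrow>
     \<Omega> \<noteq> {} \<and> open \<Omega> \<and> bounded \<Omega> \<and> connected \<Omega> \<and> interior (closure \<Omega>) = \<Omega> \<and>
     (\<exists>P. finite P \<and> (\<forall>p\<in>P. polytope p) \<and> closure \<Omega> = \<Union>P)"

text \<open>The subdomains \<open>\<Omega>\<^sub>1, \<Omega>\<^sub>2\<close> are \<open>D 1\<close> and \<open>D 2\<close>.\<close>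

definition interface :: "(nat \<Rightarrow> 'a::euclidean_space set) \<Rightarrow> 'a set" where
  "interface D = closure (D 1) \<inter> closure (D 2)"

definition partitioning :: "'a::euclidean_space set \<Rightarrow> (nat \<Rightarrow> 'a set) \<Rightarrow> bool" where
  "partitioning \<Omega> D \<longleftrightarrow>
     (\<forall>i\<in>{1,2}. open (D i) \<and> D i \<noteq> {}) \<and> D 1 \<inter> D 2 = {} \<and> D 1 \<union> D 2 = \<Omega> - interface D"

text \<open>Smoothness of the interface, up to \<open>\<partial>\<Omega>\<close> in case the interface reaches it, is expressed by
  local smooth level set functions that are negative in \<open>\<Omega>\<^sub>1\<close> and positive in \<open>\<Omega>\<^sub>2\<close>.\<close>

definition level_set_fun ::
  "'a::euclidean_space set \<Rightarrow> (nat \<Rightarrow> 'a set) \<Rightarrow> 'a \<Rightarrow> 'a set \<Rightarrow> ('a \<Rightarrow> real) \<Rightarrow> bool" where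
  "level_set_fun \<Omega> D x U \<phi> \<longleftrightarrow>
     open U \<and> x \<in> U \<and> C_inf_on U \<phi> \<and> (\<forall>y\<in>U. grad UNIV \<phi> y \<noteq> 0) \<and>
     D 1 \<inter> U = {y \<in> \<Omega> \<inter> U. \<phi> y < 0} \<and> D 2 \<inter> U = {y \<in> \<Omega> \<inter> U. \<phi> y > 0}"

definition smooth_interface :: "'a::euclidean_space set \<Rightarrow> (nat \<Rightarrow> 'a set) \<Rightarrow> bool" where
  "smooth_interface \<Omega> D \<longleftrightarrow> (\<forall>x\<in>interface D. \<exists>U \<phi>. level_set_fun \<Omega> D x U \<phi>)"

text \<open>The unit normal pointing from \<open>\<Omega>\<^sub>1\<close> into \<open>\<Omega>\<^sub>2\<close>; at interface points in \<open>\<Omega>\<close> it does not depend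
  on the choice of the level set function.\<close>

definition interface_normal :: "'a::euclidean_space set \<Rightarrow> (nat \<Rightarrow> 'a set) \<Rightarrow> 'a \<Rightarrow> 'a" where
  "interface_normal \<Omega> D x =
     (SOME n. \<exists>U \<phi>. level_set_fun \<Omega> D x U \<phi> \<and> n = grad UNIV \<phi> x /\<^sub>R norm (grad UNIV \<phi> x))"


section \<open>Triangulations\<close>

definition simplicial_mesh :: "'a::euclidean_space set \<Rightarrow> 'a set set \<Rightarrow> bool" where
  "simplicial_mesh \<Omega> \<T> \<longleftrightarrow>
     triangulation \<T> \<and> (\<forall>T\<in>\<T>. int DIM('a) simplex T) \<and> \<Union>\<T> = closure \<Omega>"

definition shape_regular :: "('h \<Rightarrow> 'a::euclidean_space set set) \<Rightarrow> bool" where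
  "shape_regular \<T> \<longleftrightarrow>
     (\<exists>\<sigma>>0. \<forall>h. \<forall>T\<in>\<T> h. \<exists>x r. 0 < r \<and> cball x r \<subseteq> T \<and> diameter T \<le> \<sigma> * r)"

text \<open>The simplices forming \<open>\<Omega>\<^sub>i\<^sub>,\<^sub>h\<^sup>e\<^sup>x\<close> (with \<open>Di = \<Omega>\<^sub>i\<close>; since \<open>Di\<close> is open, a nonempty intersection has
  positive measure).\<close>

definition ex_mesh :: "'a::euclidean_space set set \<Rightarrow> 'a set \<Rightarrow> 'a set set" where
  "ex_mesh \<T> Di = {T \<in> \<T>. T \<inter> Di \<noteq> {}}"

text \<open>Simplices that the interface only touches at their boundary are not cut, in accordance with
  \<open>\<Omega>\<^sub>i\<^sub>,\<^sub>h\<^sup>e\<^sup>x = \<Omega>\<^sub>i\<^sub>,\<^sub>h\<^sup>- \<union> \<Omega>\<^sub>h\<^sup>\<Gamma>\<close> for both \<open>i\<close>.\<close>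

definition cut_mesh :: "'a::euclidean_space set set \<Rightarrow> (nat \<Rightarrow> 'a set) \<Rightarrow> 'a set set" where
  "cut_mesh \<T> D = {T \<in> \<T>. interior T \<inter> interface D \<noteq> {}}"


section \<open>Finite element spaces\<close>

definition poly_fun :: "nat \<Rightarrow> ('a::euclidean_space \<Rightarrow> real) set" where
  "poly_fun k = {p. \<exists>c. p = (\<lambda>x. \<Sum>m | m \<in> Basis \<rightarrow>\<^sub>E {..k} \<and> (\<Sum>b\<in>Basis. m b) \<le> k.
                                     c m * (\<Prod>b\<in>Basis. (x \<bullet> b) ^ m b))}"

text \<open>Functions on \<open>\<Omega>\<close> and on unions of simplices are represented by their extension by zero.\<close>

definition restr :: "'a set \<Rightarrow> ('a \<Rightarrow> real) \<Rightarrow> 'a \<Rightarrow> real" where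
  "restr S f x = (if x \<in> S then f x else 0)"

definition V_h :: "nat \<Rightarrow> 'a::euclidean_space set \<Rightarrow> 'a set set \<Rightarrow> ('a \<Rightarrow> real) set" where
  "V_h k \<Omega> \<T> = {v. continuous_on (closure \<Omega>) v \<and> (\<forall>x. x \<notin> \<Omega> \<longrightarrow> v x = 0) \<and>
                   (\<forall>T\<in>\<T>. \<exists>p\<in>poly_fun k. \<forall>x\<in>T. v x = p x)}"

text \<open>The principal lattice of order \<open>k\<close> of the simplex \<open>T\<close>.\<close>

definition lattice_nodes :: "nat \<Rightarrow> 'a::euclidean_space set \<Rightarrow> 'a set" where
  "lattice_nodes k T =
     {\<Sum>v | v extreme_point_of T. (real (m v) / real k) *\<^sub>R v | m :: 'a \<Rightarrow> nat.
        (\<Sum>v | v extreme_point_of T. m v) = k}"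

text \<open>The label set \<open>I\<^sub>0\<close> of the basis of \<open>V_h\<close>: a basis function is labelled by its node.\<close>

definition nodes :: "nat \<Rightarrow> 'a::euclidean_space set \<Rightarrow> 'a set set \<Rightarrow> 'a set" where
  "nodes k \<Omega> \<T> = (\<Union>T\<in>\<T>. lattice_nodes k T) \<inter> \<Omega>"

definition nodal_basis :: "nat \<Rightarrow> 'a::euclidean_space set \<Rightarrow> 'a set set \<Rightarrow> 'a \<Rightarrow> 'a \<Rightarrow> real" where
  "nodal_basis k \<Omega> \<T> j =
     (THE v. v \<in> V_h k \<Omega> \<T> \<and> (\<forall>z\<in>nodes k \<Omega> \<T>. v z = (if z = j then 1 else 0)))"

definition cut_nodes ::
  "nat \<Rightarrow> 'a::euclidean_space set \<Rightarrow> (nat \<Rightarrow> 'a set) \<Rightarrow> 'a set set \<Rightarrow> 'a set" where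
  "cut_nodes k \<Omega> D \<T> = nodes k \<Omega> \<T> \<inter> \<Union>(cut_mesh \<T> D)"

definition cut_basis ::
  "nat \<Rightarrow> 'a::euclidean_space set \<Rightarrow> (nat \<Rightarrow> 'a set) \<Rightarrow> 'a set set \<Rightarrow> 'a \<Rightarrow> 'a \<Rightarrow> real" where
  "cut_basis k \<Omega> D \<T> j = restr (\<Union>(cut_mesh \<T> D)) (nodal_basis k \<Omega> \<T> j)"

definition V_cut ::
  "nat \<Rightarrow> 'a::euclidean_space set \<Rightarrow> (nat \<Rightarrow> 'a set) \<Rightarrow> 'a set set \<Rightarrow> ('a \<Rightarrow> real) set" where
  "V_cut k \<Omega> D \<T> = {\<lambda>x. \<Sum>j\<in>cut_nodes k \<Omega> D \<T>. c j * cut_basis k \<Omega> D \<T> j x | c. True}"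

text \<open>The projection \<open>Q\<^sub>i\<close> onto the span of the \<open>\<phi>\<^sub>j\<^sup>\<Gamma>\<close> with node \<open>j\<close> not in \<open>\<Omega>\<^sub>i\<close>; the result is extended
  by zero.\<close>

definition Q ::
  "nat \<Rightarrow> 'a::euclidean_space set \<Rightarrow> (nat \<Rightarrow> 'a set) \<Rightarrow> 'a set set \<Rightarrow> nat \<Rightarrow>
   ('a \<Rightarrow> real) \<Rightarrow> 'a \<Rightarrow> real" where
  "Q k \<Omega> D \<T> i u = (THE w. \<exists>c. u = (\<lambda>x. \<Sum>j\<in>cut_nodes k \<Omega> D \<T>. c j * cut_basis k \<Omega> D \<T> j x) \<and>
                              w = (\<lambda>x. \<Sum>j\<in>cut_nodes k \<Omega> D \<T> - D i. c j * cut_basis k \<Omega> D \<T> j x))"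

type_synonym 'a pair_fun = "('a \<Rightarrow> real) \<times> ('a \<Rightarrow> real)"

definition V_hat ::
  "nat \<Rightarrow> 'a::euclidean_space set \<Rightarrow> (nat \<Rightarrow> 'a set) \<Rightarrow> 'a set set \<Rightarrow> 'a pair_fun set" where
  "V_hat k \<Omega> D \<T> = V_h k \<Omega> \<T> \<times> V_cut k \<Omega> D \<T>"

definition P0 :: "'a pair_fun \<Rightarrow> 'a pair_fun" where
  "P0 u = (fst u, \<lambda>x. 0)"

definition P1 :: "'a pair_fun \<Rightarrow> 'a pair_fun" where
  "P1 u = (\<lambda>x. 0, snd u)"

definition L ::
  "nat \<Rightarrow> 'a::euclidean_space set \<Rightarrow> (nat \<Rightarrow> 'a set) \<Rightarrow> 'a set set \<Rightarrow>
   'a pair_fun \<Rightarrow> nat \<Rightarrow> 'a \<Rightarrow> real" where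
  "L k \<Omega> D \<T> u i = restr (\<Union>(ex_mesh \<T> (D i))) (\<lambda>x. fst u x + Q k \<Omega> D \<T> i (snd u) x)"


section \<open>Norms and bilinear forms\<close>

text \<open>\<open>\<parallel>\<nabla>f\<parallel>\<^sup>2\<close> on the union of the simplices in \<open>S\<close>.\<close>

definition grad_norm_sq :: "'a::euclidean_space set set \<Rightarrow> ('a \<Rightarrow> real) \<Rightarrow> real" where
  "grad_norm_sq S f = (\<Sum>T\<in>S. LINT x:T|lborel. (norm (grad T f x))\<^sup>2)"

text \<open>\<open>(h\<^sup>-\<^sup>1 f, g)\<^sub>\<Gamma>\<close>\<close>

definition h_inner ::
  "(nat \<Rightarrow> 'a::euclidean_space set) \<Rightarrow> 'a set set \<Rightarrow> ('a \<Rightarrow> real) \<Rightarrow> ('a \<Rightarrow> real) \<Rightarrow> real" where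
  "h_inner D \<T> f g =
     (\<Sum>T\<in>cut_mesh \<T> D. inverse (diameter T) * (LINT x:T \<inter> interface D|surf. f x * g x))"

definition b_norm_sq ::
  "nat \<Rightarrow> 'a::euclidean_space set \<Rightarrow> (nat \<Rightarrow> 'a set) \<Rightarrow> 'a set set \<Rightarrow> 'a pair_fun \<Rightarrow> real" where
  "b_norm_sq k \<Omega> D \<T> u =
     (\<Sum>i\<in>{1,2}. grad_norm_sq (ex_mesh \<T> (D i)) (\<lambda>x. fst u x + Q k \<Omega> D \<T> i (snd u) x)) +
     (let w = (\<lambda>x. Q k \<Omega> D \<T> 1 (snd u) x - Q k \<Omega> D \<T> 2 (snd u) x) in h_inner D \<T> w w)"

definition jump :: "(nat \<Rightarrow> 'a \<Rightarrow> real) \<Rightarrow> 'a \<Rightarrow> real" where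
  "jump u x = u 1 x - u 2 x"

text \<open>The right hand side of the norm equivalence known for CutFEM, as a function of
  \<open>(u\<^sub>1\<^sub>,\<^sub>h, u\<^sub>2\<^sub>,\<^sub>h)\<close>.\<close>

definition cut_norm_sq ::
  "(nat \<Rightarrow> 'a::euclidean_space set) \<Rightarrow> 'a set set \<Rightarrow> (nat \<Rightarrow> 'a \<Rightarrow> real) \<Rightarrow> real" where
  "cut_norm_sq D \<T> u =
     (\<Sum>i\<in>{1,2}. grad_norm_sq (ex_mesh \<T> (D i)) (u i)) + h_inner D \<T> (jump u) (jump u)"

text \<open>Nitsche consistency term; \<open>\<kappa> 1\<close> and \<open>\<kappa> 2\<close> are the weights of the averaging operator. As in the
  scaled products, integration over \<open>\<Gamma>\<close> is element-wise, with the trace of \<open>\<nabla>v\<close> taken from the element.\<close>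

definition N_c ::
  "'a::euclidean_space set \<Rightarrow> (nat \<Rightarrow> 'a set) \<Rightarrow> 'a set set \<Rightarrow> (nat \<Rightarrow> real) \<Rightarrow>
   (nat \<Rightarrow> 'a \<Rightarrow> real) \<Rightarrow> (nat \<Rightarrow> 'a \<Rightarrow> real) \<Rightarrow> (nat \<Rightarrow> 'a \<Rightarrow> real) \<Rightarrow> real" where
  "N_c \<Omega> D \<T> \<alpha> \<kappa> u v =
     (\<Sum>T\<in>cut_mesh \<T> D. LINT x:T \<inter> interface D|surf.
        ((\<Sum>i\<in>{1,2}. \<kappa> i x *\<^sub>R (- \<alpha> i *\<^sub>R grad T (v i) x)) \<bullet> interface_normal \<Omega> D x) * jump u x)"

text \<open>The faces in \<open>\<Omega>\<^sub>h\<^sup>\<Gamma>\<close> on which the jump of a function on \<open>\<Omega>\<^sub>i\<^sub>,\<^sub>h\<^sup>e\<^sup>x\<close> is defined.\<close>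

definition cut_faces ::
  "(nat \<Rightarrow> 'a::euclidean_space set) \<Rightarrow> 'a set set \<Rightarrow> nat \<Rightarrow> 'a set set" where
  "cut_faces D \<T> i =
     {T \<inter> T' | T T'. T \<in> cut_mesh \<T> D \<and> T' \<in> ex_mesh \<T> (D i) \<and> T \<noteq> T' \<and>
                   aff_dim (T \<inter> T') = int DIM('a) - 1}"

text \<open>The orientation of the face normal and the order of the two adjacent simplices affect a jump at
  most by a sign, which cancels in \<open>G_h\<close>.\<close>

definition face_normal :: "'a::euclidean_space set \<Rightarrow> 'a" where
  "face_normal F = (SOME n. norm n = 1 \<and> (\<forall>x\<in>F. \<forall>y\<in>F. n \<bullet> (x - y) = 0))"

definition face_sides :: "'a set set \<Rightarrow> 'a set \<Rightarrow> 'a set \<times> 'a set" where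
  "face_sides \<T> F = (SOME (T, T'). T \<in> \<T> \<and> T' \<in> \<T> \<and> T \<noteq> T' \<and> F = T \<inter> T')"

definition face_jump ::
  "'a::euclidean_space set set \<Rightarrow> 'a set \<Rightarrow> nat \<Rightarrow> ('a \<Rightarrow> real) \<Rightarrow> 'a \<Rightarrow> real" where
  "face_jump \<T> F l f x =
     (let (T, T') = face_sides \<T> F; n = face_normal F in dir_deriv T n l f x - dir_deriv T' n l f x)"

definition G_h ::
  "nat \<Rightarrow> 'a::euclidean_space set set \<Rightarrow> real \<Rightarrow> (nat \<Rightarrow> 'a set set) \<Rightarrow>
   (nat \<Rightarrow> 'a \<Rightarrow> real) \<Rightarrow> (nat \<Rightarrow> 'a \<Rightarrow> real) \<Rightarrow> real" where
  "G_h k \<T> \<beta> \<F> u v =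
     \<beta> * (\<Sum>i\<in>{1,2}. \<Sum>l\<in>{1..k}. \<Sum>F\<in>\<F> i. diameter F ^ (2 * l - 1) *
            (LINT x:F|surf. face_jump \<T> F l (u i) x * face_jump \<T> F l (v i) x))"

definition A_h ::
  "nat \<Rightarrow> 'a::euclidean_space set \<Rightarrow> (nat \<Rightarrow> 'a set) \<Rightarrow> 'a set set \<Rightarrow> (nat \<Rightarrow> real) \<Rightarrow>
   real \<Rightarrow> real \<Rightarrow> (nat \<Rightarrow> 'a \<Rightarrow> real) \<Rightarrow> real \<Rightarrow> (nat \<Rightarrow> 'a set set) \<Rightarrow>
   (nat \<Rightarrow> 'a \<Rightarrow> real) \<Rightarrow> (nat \<Rightarrow> 'a \<Rightarrow> real) \<Rightarrow> real" where
  "A_h k \<Omega> D \<T> \<alpha> \<gamma> \<beta> \<kappa> \<alpha>\<^sub>a \<F> u v =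
     (\<Sum>i\<in>{1,2}. \<Sum>T\<in>ex_mesh \<T> (D i).
        LINT x:T \<inter> D i|lborel. \<alpha> i * (grad T (u i) x \<bullet> grad T (v i) x)) +
     N_c \<Omega> D \<T> \<alpha> \<kappa> u v + N_c \<Omega> D \<T> \<alpha> \<kappa> v u +
     \<alpha>\<^sub>a * \<gamma> * h_inner D \<T> (jump u) (jump v) +
     G_h k \<T> \<beta> \<F> u v"

definition A_hat ::
  "nat \<Rightarrow> 'a::euclidean_space set \<Rightarrow> (nat \<Rightarrow> 'a set) \<Rightarrow> 'a set set \<Rightarrow> (nat \<Rightarrow> real) \<Rightarrow>
   real \<Rightarrow> real \<Rightarrow> (nat \<Rightarrow> 'a \<Rightarrow> real) \<Rightarrow> real \<Rightarrow> (nat \<Rightarrow> 'a set set) \<Rightarrow>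
   'a pair_fun \<Rightarrow> 'a pair_fun \<Rightarrow> real" where
  "A_hat k \<Omega> D \<T> \<alpha> \<gamma> \<beta> \<kappa> \<alpha>\<^sub>a \<F> u v = A_h k \<Omega> D \<T> \<alpha> \<gamma> \<beta> \<kappa> \<alpha>\<^sub>a \<F> (L k \<Omega> D \<T> u) (L k \<Omega> D \<T> v)"

definition a_norm_sq ::
  "nat \<Rightarrow> 'a::euclidean_space set \<Rightarrow> (nat \<Rightarrow> 'a set) \<Rightarrow> 'a set set \<Rightarrow> (nat \<Rightarrow> real) \<Rightarrow>
   real \<Rightarrow> real \<Rightarrow> (nat \<Rightarrow> 'a \<Rightarrow> real) \<Rightarrow> real \<Rightarrow> (nat \<Rightarrow> 'a set set) \<Rightarrow> 'a pair_fun \<Rightarrow> real" where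
  "a_norm_sq k \<Omega> D \<T> \<alpha> \<gamma> \<beta> \<kappa> \<alpha>\<^sub>a \<F> u = A_hat k \<Omega> D \<T> \<alpha> \<gamma> \<beta> \<kappa> \<alpha>\<^sub>a \<F> u u"


section \<open>Admissible discretisation data and uniform equivalence\<close>

definition averaging_weights :: "(nat \<Rightarrow> 'a::euclidean_space set) \<Rightarrow> (nat \<Rightarrow> 'a \<Rightarrow> real) \<Rightarrow> bool" where
  "averaging_weights D \<kappa> \<longleftrightarrow>
     (\<forall>i\<in>{1,2}. \<kappa> i \<in> borel_measurable borel \<and> (\<forall>x\<in>interface D. 0 \<le> \<kappa> i x)) \<and>
     (\<forall>x\<in>interface D. \<kappa> 1 x + \<kappa> 2 x = 1)"

text \<open>\<open>A \<sim> B\<close> on the spaces \<open>X h\<close>, with constants independent of the index \<open>h\<close> and of the function.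
  The index type is arbitrary: a single family may contain meshes of any size and in any position
  relative to the interface, so uniformity in \<open>h\<close> includes independence of that position.\<close>

definition unif_equiv ::
  "('h \<Rightarrow> 'u set) \<Rightarrow> ('h \<Rightarrow> 'u \<Rightarrow> real) \<Rightarrow> ('h \<Rightarrow> 'u \<Rightarrow> real) \<Rightarrow> bool" where
  "unif_equiv X A B \<longleftrightarrow>
     (\<exists>c\<^sub>1>0. \<exists>c\<^sub>2>0. \<forall>h. \<forall>u\<in>X h. c\<^sub>1 * B h u \<le> A h u \<and> A h u \<le> c\<^sub>2 * B h u)"

end

theory Submission
  imports Defs "HOL-Library.Function_Algebras"
begin

text \<open>Let \<open>W = Q\<^sub>1 u\<^sup>\<Gamma> - Q\<^sub>2 u\<^sup>\<Gamma>\<close>. At every node one of \<open>Q\<^sub>1 u\<^sup>\<Gamma>, Q\<^sub>2 u\<^sup>\<Gamma>\<close> vanishes, hence both are bounded by \<open>W\<close>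
  there, and by the inverse inequality \<open>\<parallel>\<nabla>Q\<^sub>i u\<^sup>\<Gamma>\<parallel>\<^sup>2\<close> on a cut element \<open>T\<close> is at most a multiple of
  \<open>h\<^sub>T\<^bsup>d-2\<^esup> max\<^bsub>T\<^esub> W\<^sup>2\<close>. The sum of these terms is controlled by \<open>\<parallel>\<nabla>W\<parallel>\<^sup>2 + \<parallel>h\<^bsup>-1/2\<^esup>W\<parallel>\<^sub>\<Gamma>\<^sup>2\<close> on the cut
  elements: if \<open>T\<close> touches the boundary of the domain, \<open>W\<close> has a zero in \<open>T\<close>; otherwise some cut element
  \<open>T'\<close> with a common vertex satisfies \<open>|T' \<inter> \<Gamma>| \<ge> c h\<^sub>T\<^bsup>d-1\<^esup>\<close>, although \<open>|T \<inter> \<Gamma>|\<close> itself may be tiny. On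
  the cut elements \<open>W\<close> is the difference of \<open>u\<^sub>0 + Q\<^sub>1 u\<^sup>\<Gamma>\<close> and \<open>u\<^sub>0 + Q\<^sub>2 u\<^sup>\<Gamma>\<close>, so \<open>\<parallel>P\<^sub>1 u\<parallel>\<^sub>b\<close> is
  bounded by \<open>\<parallel>u\<parallel>\<^sub>b\<close>, and \<open>\<parallel>P\<^sub>0 u\<parallel>\<^sub>b\<close> then by the triangle inequality. No mesh size is assumed to be small:
  the only coarse-mesh effect, \<open>h\<^sub>T\<close> exceeding the length scale of the interface, is absorbed by the
  diameter of the domain.\<close>

section \<open>The surface measure\<close>

text \<open>All constants may depend only on \<open>\<sigma>\<close>, \<open>k\<close>, the
  dimension, the domain and the interface, although elements may be cut arbitrarily thin and their
  sizes may vary. In place of a reference element, the inverse estimates use the inscribed ball: a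
  barycentric coordinate stays between 0 and 1 on it, which bounds its slope. Neighbouring elements
  are compared in size by walking around a common vertex through elements with a common edge. The
  walk relies on small spheres around an interior vertex lying in the domain, which is why elements
  reaching the boundary are treated separately, by a zero of the jump. Likewise the surface measure
  is bounded below only in balls inside the domain, since the interface may end at the boundary. The
  values of \<open>surf\<close> become accessible once the Borel sets are shown to be measurable in
  the sense of Caratheodory, and integrals over the interface can be compared because its measure is
  finite. The statement for the a-norm is inherited from the b-norm: the right-hand side of the
  given norm equivalence is the b-norm itself.\<close>

lemma hausdorff_pre_mono: "A \<subseteq> B \<Longrightarrow> hausdorff_pre m \<delta> A \<le> hausdorff_pre m \<delta> B"
  unfolding hausdorff_pre_def by (rule INF_superset_mono) auto

lemma hausdorff_outer_mono: "A \<subseteq> B \<Longrightarrow> hausdorff_outer m A \<le> hausdorff_outer m B"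
  unfolding hausdorff_outer_def by (rule SUP_mono') (rule hausdorff_pre_mono)

lemma hausdorff_pre_le_outer: "\<delta> > 0 \<Longrightarrow> hausdorff_pre m \<delta> A \<le> hausdorff_outer m A"
  unfolding hausdorff_outer_def by (rule SUP_upper) auto

lemma hausdorff_pre_antimono: "\<delta> \<le> \<delta>' \<Longrightarrow> hausdorff_pre m \<delta>' A \<le> hausdorff_pre m \<delta> A"
  unfolding hausdorff_pre_def by (rule INF_superset_mono) (auto intro: order_trans)

text \<open>Near-optimal covers of the \<open>A n\<close>, with an excess of
  \<open>e * (1/2)^Suc n\<close> each, are merged into a single one.\<close>

lemma hausdorff_pre_countable_subadditive:
  "hausdorff_pre m \<delta> (\<Union>i. A i) \<le> (\<Sum>i. hausdorff_pre m \<delta> (A i))"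
proof (rule ennreal_le_epsilon)
  fix e :: real
  assume e: "0 < e" and "(\<Sum>n. hausdorff_pre m \<delta> (A n)) < top"
  define t where "t U = ennreal (unit_ball_vol (real m) * (diameter U / 2) ^ m)" for U :: "'a set"
  have lt: "hausdorff_pre m \<delta> (A n) < hausdorff_pre m \<delta> (A n) + e * (1/2)^Suc n" for n
    using \<open>(\<Sum>n. hausdorff_pre m \<delta> (A n)) < top\<close> e
    by (auto simp add: less_top dest!: ennreal_suminf_lessD)
  have "\<exists>B. A n \<subseteq> (\<Union>i. B i) \<and> (\<forall>i. bounded (B i) \<and> diameter (B i) \<le> \<delta>) \<and>
         (\<Sum>i. t (B i)) \<le> hausdorff_pre m \<delta> (A n) + e * (1/2)^Suc n" for n
    using lt[of n]
    unfolding hausdorff_pre_def[of m \<delta> "A n"] INF_less_iff t_def by (auto intro: less_imp_le)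
  then obtain B where B: "\<And>n. A n \<subseteq> (\<Union>i. B n i)"
      "\<And>n i. bounded (B n i) \<and> diameter (B n i) \<le> \<delta>"
      "\<And>n. (\<Sum>i. t (B n i)) \<le> hausdorff_pre m \<delta> (A n) + e * (1/2)^Suc n"
    by metis
  \<comment> \<open>The pairing bijection lists the double family as one sequence, the only form of
    cover that \<open>hausdorff_pre\<close> admits.\<close>
  define C where "C = case_prod B o prod_decode"
  have "(\<Union>i. A i) \<subseteq> (\<Union>i. C i)"
    using B(1) by (auto simp add: C_def subset_eq) (metis prod.case prod_encode_inverse)
  then have "hausdorff_pre m \<delta> (\<Union>i. A i) \<le> (\<Sum>i. t (C i))"
    unfolding hausdorff_pre_def t_def using B(2)
    by (intro INF_lower) (auto simp: C_def split: prod.split)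
  also have "\<dots> = (\<Sum>n. \<Sum>i. t (B n i))"
    unfolding C_def comp_def by (intro suminf_ennreal_2dimen[where f = "\<lambda>x. t (case_prod B x)"]) auto
  also have "\<dots> \<le> (\<Sum>n. hausdorff_pre m \<delta> (A n) + e * (1/2) ^ Suc n)"
    by (intro suminf_le allI B) auto
  also have "\<dots> = (\<Sum>n. hausdorff_pre m \<delta> (A n)) + (\<Sum>n. ennreal e * ennreal ((1/2) ^ Suc n))"
    using e by (subst suminf_add[symmetric])
      (auto simp del: ennreal_suminf_cmult simp add: ennreal_mult[symmetric])
  also have "\<dots> = (\<Sum>n. hausdorff_pre m \<delta> (A n)) + e"
    unfolding ennreal_suminf_cmult
    by (subst suminf_ennreal_eq[OF zero_le_power power_half_series]) auto
  finally show "hausdorff_pre m \<delta> (\<Union>i. A i) \<le> (\<Sum>n. hausdorff_pre m \<delta> (A n)) + e" .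
qed

lemma hausdorff_outer_countable_subadditive:
  "hausdorff_outer m (\<Union>i. A i) \<le> (\<Sum>i. hausdorff_outer m (A i))"
proof -
  have "hausdorff_pre m \<delta> (\<Union>i. A i) \<le> (\<Sum>i. hausdorff_outer m (A i))" if "\<delta> > 0" for \<delta>
    using hausdorff_pre_countable_subadditive[of m \<delta> A]
    by (rule order_trans) (intro suminf_le allI hausdorff_pre_le_outer that; simp)
  then show ?thesis
    by (subst hausdorff_outer_def) (auto intro: SUP_least)
qed

lemma hausdorff_pre_finite_cover:
  assumes "m > 0" "finite I" "A \<subseteq> (\<Union>i\<in>I. U i)" "\<delta> \<ge> 0"
    and U: "\<And>i. i \<in> I \<Longrightarrow> bounded (U i) \<and> diameter (U i) \<le> \<delta>"
  shows "hausdorff_pre m \<delta> A \<le> (\<Sum>i\<in>I. ennreal (unit_ball_vol (real m) * (diameter (U i) / 2) ^ m))"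
proof -
  obtain f :: "nat \<Rightarrow> _" where f: "bij_betw f {..<card I} I"
    using ex_bij_betw_nat_finite[OF \<open>finite I\<close>] by (auto simp: atLeast0LessThan)
  define V where "V n = (if n < card I then U (f n) else {})" for n
  have "A \<subseteq> (\<Union>n. V n)"
  proof
    fix x assume "x \<in> A"
    then obtain i where "i \<in> I" "x \<in> U i" using assms(3) by auto
    then obtain n where "n < card I" "f n = i"
      using f by (metis bij_betw_iff_bijections lessThan_iff)
    then show "x \<in> (\<Union>n. V n)" using \<open>x \<in> U i\<close> by (auto simp: V_def intro!: exI[of _ n])
  qed
  moreover have "bounded (V n) \<and> diameter (V n) \<le> \<delta>" for n
    using U \<open>\<delta> \<ge> 0\<close> f unfolding bij_betw_def by (auto simp: V_def)
  ultimately have "hausdorff_pre m \<delta> A \<le> (\<Sum>n. ennreal (unit_ball_vol (real m) * (diameter (V n) / 2) ^ m))"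
    unfolding hausdorff_pre_def by (intro INF_lower) auto
  also have "\<dots> = (\<Sum>n<card I. ennreal (unit_ball_vol (real m) * (diameter (V n) / 2) ^ m))"
    using \<open>m > 0\<close> by (intro suminf_finite) (auto simp: V_def)
  also have "\<dots> = (\<Sum>n<card I. ennreal (unit_ball_vol (real m) * (diameter (U (f n)) / 2) ^ m))"
    by (rule sum.cong) (auto simp: V_def)
  also have "\<dots> = (\<Sum>i\<in>I. ennreal (unit_ball_vol (real m) * (diameter (U i) / 2) ^ m))"
    by (rule sum.reindex_bij_betw[OF f])
  finally show ?thesis .
qed

lemma hausdorff_outer_empty:
  assumes "m > 0" shows "hausdorff_outer m {} = 0"
proof -
  have "hausdorff_pre m \<delta> {} \<le> 0" if "\<delta> > 0" for \<delta>
    using hausdorff_pre_finite_cover[where m = m and I = "{}" and A = "{}" and \<delta> = \<delta>] assms that by simp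
  then have "hausdorff_outer m {} \<le> 0"
    unfolding hausdorff_outer_def by (intro SUP_least) simp
  then show ?thesis by simp
qed

lemma hausdorff_outer_Un_le:
  assumes "m > 0"
  shows "hausdorff_outer m (A \<union> B) \<le> hausdorff_outer m A + hausdorff_outer m B"
proof -
  have "hausdorff_outer m (\<Union>i. binaryset A B i) \<le> (\<Sum>i. hausdorff_outer m (binaryset A B i))"
    by (rule hausdorff_outer_countable_subadditive)
  also have "\<dots> = hausdorff_outer m A + hausdorff_outer m B"
    by (rule suminf_binaryset_eq) (rule hausdorff_outer_empty[OF assms])
  finally show ?thesis by (simp add: UN_binaryset_eq)
qed

lemma hausdorff_outer_UN_le:
  assumes "m > 0" "finite I"
  shows "hausdorff_outer m (\<Union>i\<in>I. A i) \<le> (\<Sum>i\<in>I. hausdorff_outer m (A i))"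
  using assms(2)
proof induction
  case empty then show ?case by (simp add: hausdorff_outer_empty assms)
next
  case (insert i I)
  have "hausdorff_outer m (\<Union>i\<in>insert i I. A i) \<le> hausdorff_outer m (A i) + hausdorff_outer m (\<Union>i\<in>I. A i)"
    using hausdorff_outer_Un_le[OF assms(1)] by simp
  also have "\<dots> \<le> hausdorff_outer m (A i) + (\<Sum>i\<in>I. hausdorff_outer m (A i))"
    by (intro add_left_mono insert)
  finally show ?case using insert by simp
qed

text \<open>The defining property of a metric outer measure: a covering set of diameter below
  \<open>\<eta>\<close> cannot meet both sets, so every fine cover splits into a cover of
  \<open>A\<close> and one of \<open>B\<close>.\<close>

lemma hausdorff_outer_Un_separated:
  assumes "m > 0" "\<eta> > 0" and sep: "\<And>x y. x \<in> A \<Longrightarrow> y \<in> B \<Longrightarrow> \<eta> \<le> dist x y"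
  shows "hausdorff_outer m (A \<union> B) = hausdorff_outer m A + hausdorff_outer m B"
proof (rule antisym[OF hausdorff_outer_Un_le[OF \<open>m > 0\<close>]])
  define t where "t U = ennreal (unit_ball_vol (real m) * (diameter U / 2) ^ m)" for U :: "'a set"
  have t0: "t {} = 0" using \<open>m > 0\<close> by (simp add: t_def)
  have pre: "hausdorff_pre m \<delta> A + hausdorff_pre m \<delta> B \<le> hausdorff_pre m \<delta> (A \<union> B)"
    if "0 < \<delta>" "\<delta> < \<eta>" for \<delta>
  proof -
    have "hausdorff_pre m \<delta> A + hausdorff_pre m \<delta> B \<le> (\<Sum>n. t (U n))"
      if U: "A \<union> B \<subseteq> (\<Union>n. U n)" "\<And>n. bounded (U n) \<and> diameter (U n) \<le> \<delta>" for U :: "nat \<Rightarrow> 'a set"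
    proof -
      define UA where "UA n = (if U n \<inter> A \<noteq> {} then U n else {})" for n
      define UB where "UB n = (if U n \<inter> B \<noteq> {} then U n else {})" for n
      have "hausdorff_pre m \<delta> A \<le> (\<Sum>n. t (UA n))"
        unfolding hausdorff_pre_def t_def using U \<open>0 < \<delta>\<close>
        by (intro INF_lower) (fastforce simp: UA_def)
      moreover have "hausdorff_pre m \<delta> B \<le> (\<Sum>n. t (UB n))"
        unfolding hausdorff_pre_def t_def using U \<open>0 < \<delta>\<close>
        by (intro INF_lower) (fastforce simp: UB_def)
      ultimately have "hausdorff_pre m \<delta> A + hausdorff_pre m \<delta> B \<le> (\<Sum>n. t (UA n)) + (\<Sum>n. t (UB n))"
        by (rule add_mono)
      also have "\<dots> = (\<Sum>n. t (UA n) + t (UB n))"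
        by (rule suminf_add) auto
      also have "\<dots> \<le> (\<Sum>n. t (U n))"
      proof (intro suminf_le allI)
        fix n
        have "\<not> (U n \<inter> A \<noteq> {} \<and> U n \<inter> B \<noteq> {})"
        proof
          assume "U n \<inter> A \<noteq> {} \<and> U n \<inter> B \<noteq> {}"
          then obtain x y where xy: "x \<in> U n" "x \<in> A" "y \<in> U n" "y \<in> B" by auto
          have "dist x y \<le> diameter (U n)" using U(2) xy by (intro diameter_bounded_bound) auto
          with sep[OF xy(2,4)] U(2)[of n] \<open>\<delta> < \<eta>\<close> show False by linarith
        qed
        then show "t (UA n) + t (UB n) \<le> t (U n)"
          by (auto simp: UA_def UB_def t0)
      qed auto
      finally show ?thesis .
    qed
    then show ?thesis
      unfolding hausdorff_pre_def[of m \<delta> "A \<union> B"] t_def by (intro INF_greatest) auto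
  qed
  have "hausdorff_pre m \<delta> A + hausdorff_pre m \<epsilon> B \<le> hausdorff_outer m (A \<union> B)"
    if "\<delta> > 0" "\<epsilon> > 0" for \<delta> \<epsilon>
  proof -
    \<comment> \<open>The two suprema run over independent scales; a common finer scale below
      \<open>\<eta>\<close> joins them.\<close>
    define \<zeta> where "\<zeta> = min (min \<delta> \<epsilon>) (\<eta>/2)"
    have \<zeta>: "\<zeta> > 0" "\<zeta> \<le> \<delta>" "\<zeta> \<le> \<epsilon>" "\<zeta> < \<eta>" using that assms(2) by (auto simp: \<zeta>_def)
    have "hausdorff_pre m \<delta> A + hausdorff_pre m \<epsilon> B \<le> hausdorff_pre m \<zeta> A + hausdorff_pre m \<zeta> B"
      by (intro add_mono hausdorff_pre_antimono \<zeta>)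
    also have "\<dots> \<le> hausdorff_pre m \<zeta> (A \<union> B)" by (rule pre) (use \<zeta> in auto)
    also have "\<dots> \<le> hausdorff_outer m (A \<union> B)" by (rule hausdorff_pre_le_outer) (rule \<zeta>)
    finally show ?thesis .
  qed
  note * = this
  have ne: "{0<..} \<noteq> ({} :: real set)" by auto
  have "hausdorff_outer m A + hausdorff_outer m B
      = (SUP \<delta>\<in>{0<..}. SUP \<epsilon>\<in>{0<..}. hausdorff_pre m \<delta> A + hausdorff_pre m \<epsilon> B)"
    unfolding hausdorff_outer_def
    by (simp only: ennreal_SUP_add_left[OF ne] ennreal_SUP_add_right[OF ne, symmetric])
  also have "\<dots> \<le> hausdorff_outer m (A \<union> B)"
    by (intro SUP_least *) auto
  finally show "hausdorff_outer m A + hausdorff_outer m B \<le> hausdorff_outer m (A \<union> B)" .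
qed

section \<open>Caratheodory's criterion and the values of the surface measure\<close>

text \<open>One layer at a time is split off: it has positive distance from all later ones together,
  so the measures add.\<close>

lemma hausdorff_outer_separated_layers:
  assumes "m > 0" and D: "\<And>i. D i \<subseteq> A"
    and sep: "\<And>i j. i < j \<Longrightarrow> \<exists>\<eta>>0. \<forall>x\<in>D i. \<forall>y\<in>\<Union>(D ` {j..}). \<eta> \<le> dist x y"
  shows "(\<Sum>i. hausdorff_outer m (D i)) \<le> hausdorff_outer m A"
proof -
  have *: "(\<Sum>i<n. hausdorff_outer m (D (k + i))) \<le> hausdorff_outer m (\<Union>(D ` {k..}))" for n k
  proof (induction n arbitrary: k)
    case (Suc n)
    obtain \<eta> where \<eta>: "\<eta> > 0" "\<forall>x\<in>D k. \<forall>y\<in>\<Union>(D ` {Suc k..}). \<eta> \<le> dist x y"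
      using sep[of k "Suc k"] by auto
    have "(\<Sum>i<Suc n. hausdorff_outer m (D (k + i)))
        = hausdorff_outer m (D k) + (\<Sum>i<n. hausdorff_outer m (D (Suc k + i)))"
      by (subst sum.lessThan_Suc_shift) simp
    also have "\<dots> \<le> hausdorff_outer m (D k) + hausdorff_outer m (\<Union>(D ` {Suc k..}))"
      by (intro add_left_mono Suc)
    also have "\<dots> = hausdorff_outer m (D k \<union> \<Union>(D ` {Suc k..}))"
      using \<eta> by (intro hausdorff_outer_Un_separated[symmetric, OF \<open>m > 0\<close>, of \<eta>]) auto
    also have "\<dots> \<le> hausdorff_outer m (\<Union>(D ` {k..}))"
      by (rule hausdorff_outer_mono) fastforce
    finally show ?case .
  qed simp
  have "(\<Sum>i<n. hausdorff_outer m (D i)) \<le> hausdorff_outer m A" for n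
    using order_trans[OF *[where n = n and k = 0] hausdorff_outer_mono[of "\<Union>(D ` {0..})" A m]] D
    by (simp add: UN_subset_iff)
  then show ?thesis by (intro suminf_le_const) auto
qed

text \<open>\<open>A \<inter> F\<close> has positive distance from the set \<open>B n\<close> of
  points of \<open>A\<close> away from \<open>F\<close>, so additivity holds for these two. What
  remains of \<open>A - F\<close> lies in the tail of a convergent series of layers.\<close>

lemma closed_in_hausdorff_lambda_system:
  fixes F :: "'a::metric_space set"
  assumes m: "m > 0" and F: "closed F"
  shows "F \<in> lambda_system UNIV UNIV (hausdorff_outer m)"
proof -
  interpret sigma_algebra UNIV "UNIV :: 'a set set" using sigma_algebra_Pow[of UNIV] by simp
  let ?H = "hausdorff_outer m :: 'a set \<Rightarrow> ennreal"
  have "?H (A \<inter> F) + ?H (A - F) \<le> ?H A" if ne: "F \<noteq> {}" and fin: "?H A < top" for A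
  proof -
    define B where "B n = {x\<in>A. 1 / real (Suc n) \<le> infdist x F}" for n
    define R where "R n = {x\<in>A. 1 / real (Suc (Suc n)) \<le> infdist x F \<and> infdist x F < 1 / real (Suc n)}" for n
    have inf_le: "infdist x F \<le> infdist y F + dist x y" for x y
      by (rule infdist_triangle)
    have R_sub: "R i \<subseteq> A - F" for i
      using F ne by (auto simp: R_def in_closed_iff_infdist_zero)
    \<comment> \<open>Consecutive layers may touch, but layers whose indices differ by at least two
      are a positive distance apart. Even and odd layers are therefore summed separately, each sum
      being at most \<open>?H A\<close>.\<close>
    have sepR: "\<exists>\<eta>>0. \<forall>x\<in>R i. \<forall>y\<in>\<Union>(R ` {Suc (Suc i)..}). \<eta> \<le> dist x y" for i
    proof (intro exI conjI ballI)
      show "0 < 1 / real (Suc (Suc i)) - 1 / real (Suc (Suc (Suc i)))"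
        by (simp add: divide_strict_left_mono)
      fix x y assume "x \<in> R i" "y \<in> \<Union>(R ` {Suc (Suc i)..})"
      then obtain j where j: "Suc (Suc i) \<le> j" "y \<in> R j" by auto
      have "1 / real (Suc j) \<le> 1 / real (Suc (Suc (Suc i)))"
        using j by (intro divide_left_mono) auto
      then show "1 / real (Suc (Suc i)) - 1 / real (Suc (Suc (Suc i))) \<le> dist x y"
        using \<open>x \<in> R i\<close> j(2) inf_le[of x y] by (auto simp: R_def)
    qed
    have sum_sub: "(\<Sum>i. ?H (R (2 * i + p))) \<le> ?H A" for p
    proof (rule hausdorff_outer_separated_layers[OF m])
      show "R (2 * i + p) \<subseteq> A" for i using R_sub by blast
      fix i j :: nat assume "i < j"
      then have "\<Union>((\<lambda>i. R (2 * i + p)) ` {j..}) \<subseteq> \<Union>(R ` {Suc (Suc (2 * i + p))..})"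
        by (intro UN_least UN_upper) auto
      moreover obtain \<eta> where "\<eta> > 0" "\<forall>x\<in>R (2 * i + p). \<forall>y\<in>\<Union>(R ` {Suc (Suc (2 * i + p))..}). \<eta> \<le> dist x y"
        using sepR by blast
      ultimately show "\<exists>\<eta>>0. \<forall>x\<in>R (2 * i + p). \<forall>y\<in>\<Union>((\<lambda>i. R (2 * i + p)) ` {j..}). \<eta> \<le> dist x y"
        by (intro exI[of _ \<eta>]) (simp only: subset_eq, blast)
    qed
    have part: "(\<Sum>i<n. ?H (R i)) \<le> ?H A + ?H A" for n
    proof -
      have "(\<Sum>i<n. ?H (R i)) \<le> (\<Sum>i<2 * n. ?H (R i))"
        by (rule sum_mono2) auto
      also have "\<dots> = (\<Sum>i<n. ?H (R (2 * i))) + (\<Sum>i<n. ?H (R (2 * i + 1)))"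
        by (induction n) (auto simp: algebra_simps)
      also have "\<dots> \<le> (\<Sum>i. ?H (R (2 * i + 0))) + (\<Sum>i. ?H (R (2 * i + 1)))"
        by (intro add_mono; simp; intro sum_le_suminf; auto)
      also have "\<dots> \<le> ?H A + ?H A"
        by (intro add_mono sum_sub)
      finally show ?thesis .
    qed
    have "(\<Sum>i. ?H (R i)) \<le> ?H A + ?H A"
      using part by (intro suminf_le_const) auto
    then have sum_fin: "(\<Sum>i. ?H (R i)) < top"
      using fin by (simp add: le_less_trans)
    define d where "d i = enn2real (?H (R i))" for i
    have d: "?H (R i) = ennreal (d i)" "0 \<le> d i" for i
      using ennreal_suminf_lessD[OF sum_fin, of i] by (auto simp: d_def)
    have "summable d"
      using sum_fin d by (intro summable_suminf_not_top) (auto simp: less_top)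
    have AF: "A - F \<subseteq> B n \<union> (\<Union>i. R (i + n))" for n
    proof
      fix x assume x: "x \<in> A - F"
      then have pos: "infdist x F > 0"
        using F ne infdist_nonneg[of x F] by (auto simp: in_closed_iff_infdist_zero less_le)
      show "x \<in> B n \<union> (\<Union>i. R (i + n))"
      proof (cases "x \<in> B n")
        case False
        then have lt: "infdist x F < 1 / real (Suc n)" using x by (auto simp: B_def)
        \<comment> \<open>As \<open>x\<close> is not in \<open>B n\<close>, the first index
          \<open>K\<close> with \<open>1 / real (Suc K) \<le> infdist x F\<close> exceeds
          \<open>n\<close>, and minimality puts \<open>x\<close> into the layer with index
          \<open>K - 1\<close>.\<close>
        define K where "K = (LEAST k. 1 / real (Suc k) \<le> infdist x F)"
        obtain k where "inverse (real (Suc k)) < infdist x F" using reals_Archimedean[OF pos] by blast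
        then have K: "1 / real (Suc K) \<le> infdist x F"
          using LeastI[of "\<lambda>k. 1 / real (Suc k) \<le> infdist x F" k]
          by (simp add: K_def inverse_eq_divide del: of_nat_Suc)
        have "n < K"
        proof (rule ccontr)
          assume "\<not> n < K"
          then have "1 / real (Suc n) \<le> 1 / real (Suc K)" by (simp add: frac_le)
          with K lt show False by (meson leD order_trans)
        qed
        then obtain k' where k': "K = Suc k'" "n \<le> k'" by (cases K) auto
        have "\<not> 1 / real (Suc k') \<le> infdist x F"
          using not_less_Least[of k' "\<lambda>k. 1 / real (Suc k) \<le> infdist x F"] k' by (simp add: K_def)
        then have "x \<in> R (k' - n + n)" using K k' x by (auto simp: R_def)
        then show ?thesis by blast
      qed auto
    qed
    have bound: "?H (A \<inter> F) + ?H (A - F) \<le> ?H A + ennreal (\<Sum>i. d (i + n))" for n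
    proof -
      have "?H (A - F) \<le> ?H (B n) + ?H (\<Union>i. R (i + n))"
        using hausdorff_outer_mono[OF AF[of n], of m] hausdorff_outer_Un_le[OF m] order_trans by blast
      also have "?H (\<Union>i. R (i + n)) \<le> (\<Sum>i. ?H (R (i + n)))"
        by (rule hausdorff_outer_countable_subadditive)
      also have "\<dots> = ennreal (\<Sum>i. d (i + n))"
        using \<open>summable d\<close> d by (simp add: suminf_ennreal2 summable_iff_shift)
      finally have 1: "?H (A - F) \<le> ?H (B n) + ennreal (\<Sum>i. d (i + n))"
        by (simp add: add_left_mono)
      have "?H (A \<inter> F) + ?H (B n) = ?H (A \<inter> F \<union> B n)"
      proof (rule hausdorff_outer_Un_separated[symmetric, OF m, of "1 / real (Suc n)"])
        fix x y assume "x \<in> A \<inter> F" "y \<in> B n"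
        then show "1 / real (Suc n) \<le> dist x y"
          using inf_le[of y x] by (auto simp: B_def dist_commute)
      qed simp
      also have "\<dots> \<le> ?H A" by (rule hausdorff_outer_mono) (auto simp: B_def)
      finally have 2: "?H (A \<inter> F) + ?H (B n) \<le> ?H A" .
      have "?H (A \<inter> F) + ?H (A - F) \<le> ?H (A \<inter> F) + ?H (B n) + ennreal (\<Sum>i. d (i + n))"
        using 1 by (simp add: add_left_mono add.assoc)
      also have "\<dots> \<le> ?H A + ennreal (\<Sum>i. d (i + n))"
        using 2 by (rule add_right_mono)
      finally show ?thesis .
    qed
    show ?thesis
    proof (rule ennreal_le_epsilon)
      fix e :: real assume "0 < e"
      obtain N where "norm (\<Sum>i. d (i + N)) < e"
        using suminf_exist_split[OF \<open>0 < e\<close> \<open>summable d\<close>] by blast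
      then have "ennreal (\<Sum>i. d (i + N)) \<le> ennreal e" by (intro ennreal_leI) auto
      then show "?H (A \<inter> F) + ?H (A - F) \<le> ?H A + ennreal e"
        using bound[of N] by (meson add_left_mono order_trans)
    qed
  qed
  note * = this
  have **: "?H A \<le> ?H (A \<inter> F) + ?H (A - F)" for A
    using hausdorff_outer_Un_le[OF m, of "A \<inter> F" "A - F"] by (simp add: Int_Diff_Un)
  have "?H (A \<inter> F) + ?H (A - F) = ?H A" for A
  \<comment> \<open>\<open>infdist\<close> to the empty set is 0 by convention, so this case must be
    kept apart.\<close>
  proof (cases "F = {} \<or> ?H A = top")
    case True
    then show ?thesis using **[of A] by (auto simp: hausdorff_outer_empty[OF m] top_unique)
  next
    case False
    then show ?thesis by (intro antisym * **) (auto simp: less_top)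
  qed
  then show ?thesis by (simp add: lambda_system_eq)
qed

text \<open>\<open>measure_of\<close> yields the zero measure unless its function is countably
  additive on the given sets. Closed sets are Caratheodory measurable and generate the Borel sets,
  so the Caratheodory lemma supplies the additivity.\<close>

lemma emeasure_hausdorff_measure:
  assumes "m > 0" "A \<in> sets borel"
  shows "emeasure (hausdorff_measure m) A = hausdorff_outer m A"
proof -
  interpret sigma_algebra UNIV "UNIV :: 'a set set" using sigma_algebra_Pow[of UNIV] by simp
  have "outer_measure_space UNIV (hausdorff_outer m :: 'a set \<Rightarrow> _)"
    using assms(1) by (auto simp: outer_measure_space_def positive_def increasing_def
        countably_subadditive_def hausdorff_outer_empty
        intro: hausdorff_outer_mono hausdorff_outer_countable_subadditive)
  then have ms: "measure_space UNIV (lambda_system UNIV UNIV (hausdorff_outer m)) (hausdorff_outer m :: 'a set \<Rightarrow> _)"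
    by (rule caratheodory_lemma)
  have sa: "sigma_algebra UNIV (lambda_system UNIV UNIV (hausdorff_outer m :: 'a set \<Rightarrow> _))"
    using ms by (simp add: measure_space_def)
  have "sets borel = sigma_sets UNIV (Collect closed :: 'a set set)"
    by (subst borel_eq_closed) simp
  then have sub: "sets borel \<subseteq> lambda_system UNIV UNIV (hausdorff_outer m :: 'a set \<Rightarrow> _)"
    using sigma_algebra.sigma_sets_subset[OF sa, of "Collect closed"] assms(1)
      closed_in_hausdorff_lambda_system by blast
  have ms': "measure_space UNIV (sets borel) (hausdorff_outer m :: 'a set \<Rightarrow> _)"
    using measure_down[OF ms _ sub] sets.sigma_algebra_axioms[of "borel :: 'a measure"] by simp
  show ?thesis
    using ms' assms(2) unfolding measure_space_def
    by (intro emeasure_measure_of[OF hausdorff_measure_def])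
      (auto simp: hausdorff_measure_def sets_measure_of_conv sets.sigma_sets_eq[of borel, simplified])
qed

lemma sets_hausdorff_measure [simp, measurable_cong]: "sets (hausdorff_measure m) = sets borel"
  by (simp add: hausdorff_measure_def sets_measure_of_conv sets.sigma_sets_eq[of borel, simplified])

lemma space_hausdorff_measure [simp]: "space (hausdorff_measure m) = UNIV"
  by (simp add: hausdorff_measure_def space_measure_of_conv)

section \<open>Surface measure of the interface\<close>

text \<open>A quantitative substitute for the implicit function theorem: \<open>s * \<phi>\<close>
  increases strictly along every direction in a cone around the axis \<open>b\<close>. Both the
  upper and the lower bound for the surface measure start from this cone condition.\<close>

lemma level_set_transversal:
  fixes \<phi> :: "'a::euclidean_space \<Rightarrow> real"
  assumes "level_set_fun \<Omega> D x U \<phi>"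
  obtains r b K s where "r > 0" "ball x r \<subseteq> U" "b \<in> Basis" "K > 0" "s = 1 \<or> s = (-1::real)"
    "\<And>y z. \<lbrakk>y \<in> ball x r; z \<in> ball x r; (y - z) \<bullet> b > K * (\<Sum>e\<in>Basis - {b}. \<bar>(y - z) \<bullet> e\<bar>)\<rbrakk>
        \<Longrightarrow> s * \<phi> y > s * \<phi> z"
proof -
  define p where "p e y = frechet_derivative \<phi> (at y) e" for e y
  have U: "open U" "x \<in> U" and C: "C_k_on (Suc 0) U \<phi>" and g: "grad UNIV \<phi> x \<noteq> 0"
    using assms unfolding level_set_fun_def C_inf_on_def by auto
  have diff: "(\<phi> has_derivative frechet_derivative \<phi> (at y)) (at y)" if "y \<in> U" for y
    using C that by (auto simp: frechet_derivative_works)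
  have cont: "continuous_on U (p e)" if "e \<in> Basis" for e
    using C that by (simp add: p_def[abs_def])
  obtain b where b: "b \<in> Basis" "p b x \<noteq> 0"
    using g unfolding grad_def p_def by (metis (mono_tags, lifting) scaleR_eq_0_iff sum.neutral)
  define s where "s = sgn (p b x)"
  have s: "s = 1 \<or> s = -1" "s * p b x = \<bar>p b x\<bar>"
    using b by (auto simp: s_def sgn_if)
  \<comment> \<open>Near \<open>x\<close> the derivative along \<open>b\<close>, times its sign
    \<open>s\<close>, stays above half its value at \<open>x\<close>, and all partial derivatives
    stay below \<open>M\<close>; this makes \<open>M / c\<close> the slope of the cone.\<close>
  define c where "c = \<bar>p b x\<bar> / 2"
  define M where "M = (\<Sum>e\<in>Basis. \<bar>p e x\<bar>) + 1"
  have c: "c > 0" "c < s * p b x" using b s by (auto simp: c_def)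
  have M: "\<bar>p e x\<bar> < M" if "e \<in> Basis" for e
    using member_le_sum[of e Basis "\<lambda>e. \<bar>p e x\<bar>"] that by (simp add: M_def)
  have "M > 0" unfolding M_def by (simp add: add_nonneg_pos sum_nonneg)
  have at: "(p e \<longlongrightarrow> p e x) (at x)" if "e \<in> Basis" for e
    using cont[OF that] U by (simp add: continuous_on_eq_continuous_at isCont_def)
  have "eventually (\<lambda>y. c < s * p b y) (at x)"
    using order_tendstoD(1)[OF tendsto_mult_left[OF at[OF b(1)], of s] c(2)] .
  moreover have "eventually (\<lambda>y. \<forall>e\<in>Basis. \<bar>p e y\<bar> < M) (at x)"
    by (intro eventually_ball_finite ballI finite_Basis order_tendstoD(2)[OF tendsto_rabs[OF at]] M)
  moreover have "eventually (\<lambda>y. y \<in> U) (at x)"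
    using U by (simp add: eventually_at_in_open')
  ultimately have "eventually (\<lambda>y. y \<in> U \<and> c < s * p b y \<and> (\<forall>e\<in>Basis. \<bar>p e y\<bar> < M)) (at x)"
    by eventually_elim auto
  then obtain r where r: "r > 0"
    "\<And>y. y \<noteq> x \<Longrightarrow> dist y x < r \<Longrightarrow> y \<in> U \<and> c < s * p b y \<and> (\<forall>e\<in>Basis. \<bar>p e y\<bar> < M)"
    unfolding eventually_at by auto
  have ball: "y \<in> U" "c < s * p b y" "e \<in> Basis \<Longrightarrow> \<bar>p e y\<bar> < M" if "y \<in> ball x r" for y e
    using r(2)[of y] that U c M by (cases "y = x"; auto simp: dist_commute)+
  show thesis
  proof (rule that[OF r(1) _ b(1) _ s(1)])
    show "ball x r \<subseteq> U" using ball by auto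
    show "M / c > 0" using c \<open>M > 0\<close> by simp
    fix y z assume yz: "y \<in> ball x r" "z \<in> ball x r"
      and gt: "(y - z) \<bullet> b > M / c * (\<Sum>e\<in>Basis - {b}. \<bar>(y - z) \<bullet> e\<bar>)"
    define w where "w t = z + t *\<^sub>R (y - z)" for t
    have w: "w t \<in> ball x r" if "0 \<le> t" "t \<le> 1" for t
    proof -
      have "w t = (1 - t) *\<^sub>R z + t *\<^sub>R y" by (simp add: w_def algebra_simps)
      then show ?thesis using convexD[OF convex_ball yz(2,1), of "1 - t" t] that by simp
    qed
    have der: "((\<lambda>t. \<phi> (w t)) has_real_derivative frechet_derivative \<phi> (at (w t)) (y - z)) (at t)"
      if "0 \<le> t" "t \<le> 1" for t
    proof -
      have "(w has_derivative (\<lambda>h. h *\<^sub>R (y - z))) (at t)"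
        unfolding w_def by (auto intro!: derivative_eq_intros)
      then have "((\<lambda>t. \<phi> (w t)) has_derivative (\<lambda>h. frechet_derivative \<phi> (at (w t)) (h *\<^sub>R (y - z)))) (at t)"
        by (rule has_derivative_compose) (rule diff[OF ball(1)[OF w[OF that]]])
      moreover have "linear (frechet_derivative \<phi> (at (w t)))"
        using diff[OF ball(1)[OF w[OF that]]] has_derivative_linear by blast
      ultimately show ?thesis
        by (intro has_derivative_imp_has_field_derivative[rotated]) (auto simp: linear_scale)
    qed
    \<comment> \<open>Mean value theorem on the segment from \<open>z\<close> to \<open>y\<close>;
      inside the cone the term along \<open>b\<close> outweighs the others.\<close>
    obtain \<xi> where \<xi>: "0 < \<xi>" "\<xi> < 1" "\<phi> (w 1) - \<phi> (w 0) = (1 - 0) * frechet_derivative \<phi> (at (w \<xi>)) (y - z)"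
      using MVT2[of 0 1 "\<lambda>t. \<phi> (w t)", OF _ der] by auto
    have lin: "linear (frechet_derivative \<phi> (at (w \<xi>)))"
      using diff[OF ball(1)[OF w]] \<xi> has_derivative_linear by (metis less_imp_le)
    have "frechet_derivative \<phi> (at (w \<xi>)) (\<Sum>e\<in>Basis. ((y - z) \<bullet> e) *\<^sub>R e) = (\<Sum>e\<in>Basis. ((y - z) \<bullet> e) * p e (w \<xi>))"
      by (simp add: linear_sum[OF lin] linear_scale[OF lin] p_def)
    then have "\<phi> y - \<phi> z = (\<Sum>e\<in>Basis. ((y - z) \<bullet> e) * p e (w \<xi>))"
      using \<xi>(3) by (simp add: w_def euclidean_representation)
    also have "\<dots> = ((y - z) \<bullet> b) * p b (w \<xi>) + (\<Sum>e\<in>Basis-{b}. ((y - z) \<bullet> e) * p e (w \<xi>))"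
      by (rule sum.remove) (use b in auto)
    finally have "s * (\<phi> y - \<phi> z) = s * (((y - z) \<bullet> b) * p b (w \<xi>) + (\<Sum>e\<in>Basis-{b}. ((y - z) \<bullet> e) * p e (w \<xi>)))"
      by simp
    then have eq: "s * \<phi> y - s * \<phi> z = ((y - z) \<bullet> b) * (s * p b (w \<xi>)) + (\<Sum>e\<in>Basis-{b}. ((y - z) \<bullet> e) * (s * p e (w \<xi>)))"
      by (simp only: right_diff_distrib distrib_left sum_distrib_left mult.left_commute)
    let ?S = "\<Sum>e\<in>Basis - {b}. \<bar>(y - z) \<bullet> e\<bar>"
    have wb: "w \<xi> \<in> ball x r" using w \<xi> by auto
    have "?S \<ge> 0" by (simp add: sum_nonneg)
    then have "(y - z) \<bullet> b > 0" using gt \<open>M > 0\<close> c(1)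
      by (meson divide_nonneg_pos less_imp_le mult_nonneg_nonneg order_le_less_trans)
    have "\<bar>\<Sum>e\<in>Basis-{b}. ((y - z) \<bullet> e) * (s * p e (w \<xi>))\<bar> \<le> (\<Sum>e\<in>Basis-{b}. \<bar>(y - z) \<bullet> e\<bar> * M)"
      using s(1) less_imp_le[OF ball(3)[OF wb]]
      by (intro order_trans[OF sum_abs] sum_mono) (auto simp: abs_mult intro!: mult_left_mono)
    also have "\<dots> = M * ?S" by (simp add: sum_distrib_left mult.commute)
    also have "\<dots> < c * ((y - z) \<bullet> b)" using gt c(1) by (simp add: field_simps)
    also have "\<dots> \<le> ((y - z) \<bullet> b) * (s * p b (w \<xi>))"
      using ball(2)[OF wb] \<open>(y - z) \<bullet> b > 0\<close> by (simp add: mult.commute)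
    finally show "s * \<phi> z < s * \<phi> y" using eq by linarith
  qed
qed

text \<open>Such a point is a limit of points of \<open>D 1\<close>, where \<open>\<phi>\<close> is
  negative, and of points of \<open>D 2\<close>, where it is positive.\<close>

lemma level_set_interface:
  assumes L: "level_set_fun \<Omega> D x U \<phi>" and y: "y \<in> U" "y \<in> interface D"
  shows "\<phi> y = 0"
proof -
  have U: "open U" "C_k_on (Suc 0) U \<phi>" using L unfolding level_set_fun_def C_inf_on_def by auto
  then have co: "continuous_on U \<phi>"
    by (metis C_k_on.simps(2) continuous_at_imp_continuous_on differentiable_imp_continuous_within)
  have meets: "V \<inter> E \<noteq> {}" if "open V" "y \<in> V" "y \<in> closure E" for V E
    using that closure_iff_nhds_not_empty[of y E] by (metis inf_commute subset_refl)
  have "\<not> \<phi> y > 0"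
  proof
    assume "\<phi> y > 0"
    then have "U \<inter> \<phi> -` {0<..} \<inter> D 1 \<noteq> {}"
      using y by (intro meets continuous_open_preimage co U) (auto simp: interface_def)
    moreover have "\<phi> z < 0" if "z \<in> D 1" "z \<in> U" for z
      using L that unfolding level_set_fun_def by blast
    ultimately show False by force
  qed
  moreover have "\<not> \<phi> y < 0"
  proof
    assume "\<phi> y < 0"
    then have "U \<inter> \<phi> -` {..<0} \<inter> D 2 \<noteq> {}"
      using y by (intro meets continuous_open_preimage co U) (auto simp: interface_def)
    moreover have "\<phi> z > 0" if "z \<in> D 2" "z \<in> U" for z
      using L that unfolding level_set_fun_def by blast
    ultimately show False by force
  qed
  ultimately show ?thesis by fastforce
qed

text \<open>\<open>S\<close> is a Lipschitz graph over the hyperplane orthogonal to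
  \<open>b\<close>. A grid of \<open>(2 * N) ^ m\<close> cells of side \<open>r / N\<close> in that
  hyperplane cuts it into pieces of diameter proportional to \<open>1 / N\<close>, so the total cost
  does not depend on \<open>N\<close>.\<close>

lemma hausdorff_outer_graph_finite:
  fixes x :: "'a::euclidean_space"
  assumes m: "m = DIM('a) - 1" "m > 0" and b: "b \<in> Basis" and "r > 0" "M > 0" and S: "S \<subseteq> ball x r"
    and L: "\<And>y z. y \<in> S \<Longrightarrow> z \<in> S \<Longrightarrow> dist y z \<le> M * (\<Sum>e\<in>Basis - {b}. \<bar>(y - z) \<bullet> e\<bar>)"
  shows "hausdorff_outer m S < top"
proof -
  define B where "B = Basis - {b}"
  have B: "finite B" "card B = m" using b m by (auto simp: B_def)
  let ?u = "unit_ball_vol (real m)"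
  have "hausdorff_pre m \<delta> S \<le> ennreal (?u * (M * real m * r) ^ m)" if "\<delta> > 0" for \<delta>
  proof -
    obtain N :: nat where N: "real N > M * real m * r / \<delta>" using reals_Archimedean2 by blast
    have "M * real m * r / \<delta> > 0" using assms \<open>\<delta> > 0\<close> by simp
    then have N0: "N > 0" using N by (metis less_trans of_nat_0_less_iff)
    \<comment> \<open>The grid index of \<open>y\<close> in direction \<open>e\<close>; it takes at
      most \<open>2 * N\<close> values because \<open>S\<close> lies in the ball.\<close>
    define f where "f y e = \<lfloor>real N * ((y - x) \<bullet> e) / r\<rfloor>" for y e
    define I where "I = B \<rightarrow>\<^sub>E {- int N..<int N}"
    define T where "T i = {y\<in>S. \<forall>e\<in>B. f y e = i e}" for i
    have I: "finite I" "card I = (2 * N) ^ m"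
      using B N0 by (auto simp: I_def finite_PiE card_PiE nat_mult_distrib power_mult_distrib)
    have cover: "S \<subseteq> (\<Union>i\<in>I. T i)"
    proof
      fix y assume y: "y \<in> S"
      have "f y e \<in> {- int N..<int N}" if "e \<in> B" for e
      proof -
        have "\<bar>(y - x) \<bullet> e\<bar> \<le> norm (y - x)" using that by (intro Basis_le_norm) (simp add: B_def)
        then have "\<bar>(y - x) \<bullet> e\<bar> < r" using S y by (auto simp: dist_norm norm_minus_commute)
        then have "- r \<le> (y - x) \<bullet> e" "(y - x) \<bullet> e < r" by auto
        then have "real N * (- r) \<le> real N * ((y - x) \<bullet> e)" "real N * ((y - x) \<bullet> e) < real N * r"
          using N0 by (intro mult_left_mono mult_strict_left_mono; simp)+
        then have "- real N \<le> real N * ((y - x) \<bullet> e) / r" "real N * ((y - x) \<bullet> e) / r < real N"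
          using \<open>r > 0\<close> by (simp_all add: field_simps)
        then show ?thesis by (simp add: f_def le_floor_iff floor_less_iff)
      qed
      then have "restrict (f y) B \<in> I" "y \<in> T (restrict (f y) B)" using y by (auto simp: I_def T_def)
      then show "y \<in> (\<Union>i\<in>I. T i)" by blast
    qed
    have dist: "dist y z \<le> M * real m * r / real N" if "y \<in> T i" "z \<in> T i" for y z i
    proof -
      have "\<bar>(y - z) \<bullet> e\<bar> \<le> r / real N" if "e \<in> B" for e
      proof -
        have "f y e = f z e" using \<open>y \<in> T i\<close> \<open>z \<in> T i\<close> that by (simp add: T_def)
        then have "\<bar>real N * ((y - x) \<bullet> e) / r - real N * ((z - x) \<bullet> e) / r\<bar> \<le> 1"
          unfolding f_def by linarith
        moreover have "real N * ((y - x) \<bullet> e) / r - real N * ((z - x) \<bullet> e) / r = real N / r * ((y - z) \<bullet> e)"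
          by (simp add: inner_diff_left algebra_simps diff_divide_distrib add_divide_distrib)
        ultimately show ?thesis using N0 \<open>r > 0\<close> by (simp add: abs_mult field_simps)
      qed
      then have "(\<Sum>e\<in>B. \<bar>(y - z) \<bullet> e\<bar>) \<le> real m * (r / real N)"
        using sum_bounded_above[of B "\<lambda>e. \<bar>(y - z) \<bullet> e\<bar>" "r / real N"] B by simp
      then have "M * (\<Sum>e\<in>B. \<bar>(y - z) \<bullet> e\<bar>) \<le> M * (real m * (r / real N))"
        using \<open>M > 0\<close> by (intro mult_left_mono) auto
      moreover have "dist y z \<le> M * (\<Sum>e\<in>B. \<bar>(y - z) \<bullet> e\<bar>)"
        unfolding B_def using that by (intro L) (auto simp: T_def)
      ultimately show ?thesis by simp
    qed
    have diam: "diameter (T i) \<le> M * real m * r / real N" for i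
      using dist N0 assms by (intro diameter_le) (auto simp: dist_norm)
    have N\<delta>: "M * real m * r / real N \<le> \<delta>" using N N0 \<open>\<delta> > 0\<close> by (simp add: field_simps)
    have bdd: "bounded (T i)" for i
      using S by (auto simp: T_def intro: bounded_subset[OF bounded_ball[of x r]])
    have "hausdorff_pre m \<delta> S \<le> (\<Sum>i\<in>I. ennreal (?u * (diameter (T i) / 2) ^ m))"
      using \<open>\<delta> > 0\<close> bdd diam N\<delta>
      by (intro hausdorff_pre_finite_cover[OF m(2) I(1) cover]) (auto intro: order_trans)
    also have "\<dots> \<le> (\<Sum>i\<in>I. ennreal (?u * (M * real m * r / real N / 2) ^ m))"
      using diam diameter_ge_0[OF bdd]
      by (intro sum_mono ennreal_leI mult_left_mono power_mono divide_right_mono) auto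
    also have "\<dots> = ennreal (real ((2 * N) ^ m) * (?u * (M * real m * r / real N / 2) ^ m))"
      using I assms by (subst ennreal_mult) (auto simp: ennreal_of_nat_eq_real_of_nat)
    also have "real ((2 * N) ^ m) * (?u * (M * real m * r / real N / 2) ^ m) = ?u * (real (2 * N) * (M * real m * r / real N / 2)) ^ m"
      by (subst power_mult_distrib[of "real (2 * N)"]) simp
    also have "real (2 * N) * (M * real m * r / real N / 2) = M * real m * r"
      using N0 by (simp add: field_simps)
    finally show ?thesis .
  qed
  then have "hausdorff_outer m S \<le> ennreal (?u * (M * real m * r) ^ m)"
    unfolding hausdorff_outer_def by (intro SUP_least) auto
  then show ?thesis by (simp add: le_less_trans)
qed

text \<open>Needed for the integrability of squares of finite element functions; by compactness
  finitely many graph pieces suffice.\<close>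

lemma hausdorff_outer_interface_finite:
  fixes \<Omega> :: "'a::euclidean_space set"
  assumes "DIM('a) \<ge> 2" "smooth_interface \<Omega> D" "compact (interface D)"
  shows "hausdorff_outer (DIM('a) - 1) (interface D) < top"
proof -
  let ?m = "DIM('a) - 1"
  have "\<exists>r>0. hausdorff_outer ?m (interface D \<inter> ball x r) < top" if x: "x \<in> interface D" for x
  proof -
    obtain U \<phi> where L: "level_set_fun \<Omega> D x U \<phi>" using assms(2) x unfolding smooth_interface_def by blast
    obtain r b K s where r: "r > 0" "ball x r \<subseteq> U" "b \<in> Basis" "K > 0" and s: "s = 1 \<or> s = (-1::real)"
      and mono: "\<And>y z. \<lbrakk>y \<in> ball x r; z \<in> ball x r; (y - z) \<bullet> b > K * (\<Sum>e\<in>Basis - {b}. \<bar>(y - z) \<bullet> e\<bar>)\<rbrakk>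
        \<Longrightarrow> s * \<phi> y > s * \<phi> z"
      using level_set_transversal[OF L] by metis
    have "hausdorff_outer ?m (interface D \<inter> ball x r) < top"
    proof (rule hausdorff_outer_graph_finite[of _ b r "K + 1" _ x])
      fix y z assume y: "y \<in> interface D \<inter> ball x r" and z: "z \<in> interface D \<inter> ball x r"
      let ?S = "\<Sum>e\<in>Basis - {b}. \<bar>(y - z) \<bullet> e\<bar>"
      \<comment> \<open>Both points lie on the zero set, so neither \<open>y - z\<close> nor
        \<open>z - y\<close> lies in the cone. This bounds the coordinate along \<open>b\<close> by
        the others.\<close>
      have "\<phi> y = 0" "\<phi> z = 0" using level_set_interface[OF L] r y z by auto
      then have "\<not> K * ?S < (y - z) \<bullet> b" using mono[of y z] y z by auto
      moreover have "\<not> K * (\<Sum>e\<in>Basis - {b}. \<bar>(z - y) \<bullet> e\<bar>) < (z - y) \<bullet> b"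
        using mono[of z y] y z \<open>\<phi> y = 0\<close> \<open>\<phi> z = 0\<close> by auto
      moreover have "(\<Sum>e\<in>Basis - {b}. \<bar>(z - y) \<bullet> e\<bar>) = ?S"
        by (rule sum.cong) (auto simp: inner_diff_left)
      ultimately have "\<bar>(y - z) \<bullet> b\<bar> \<le> K * ?S" by (simp add: inner_diff_left)
      moreover have "dist y z \<le> (\<Sum>e\<in>Basis. \<bar>(y - z) \<bullet> e\<bar>)" by (simp add: dist_norm norm_le_l1)
      moreover have "\<dots> = \<bar>(y - z) \<bullet> b\<bar> + ?S" using r(3) by (simp add: sum.remove)
      ultimately show "dist y z \<le> (K + 1) * ?S" by (simp add: distrib_right)
    qed (use assms r in auto)
    then show ?thesis using r by blast
  qed
  then obtain r where r: "\<And>x. x \<in> interface D \<Longrightarrow> r x > 0"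
     "\<And>x. x \<in> interface D \<Longrightarrow> hausdorff_outer ?m (interface D \<inter> ball x (r x)) < top" by metis
  obtain X where X: "X \<subseteq> interface D" "finite X" "interface D \<subseteq> (\<Union>x\<in>X. ball x (r x))"
    using compactE_image[OF assms(3), of "interface D" "\<lambda>x. ball x (r x)"] r(1) by force
  have "hausdorff_outer ?m (interface D) \<le> hausdorff_outer ?m (\<Union>x\<in>X. interface D \<inter> ball x (r x))"
    using X by (intro hausdorff_outer_mono) auto
  also have "\<dots> \<le> (\<Sum>x\<in>X. hausdorff_outer ?m (interface D \<inter> ball x (r x)))"
    using X assms by (intro hausdorff_outer_UN_le) auto
  also have "\<dots> < top" using X r by (auto simp: less_top ennreal_sum_less_top)
  finally show ?thesis .
qed

text \<open>A cover of a set that meets all lines in direction \<open>b\<close> through a cube yields a cover of the cube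
  by boxes: this bounds the surface measure from below by means of \<open>d\<close>-dimensional volume only.\<close>

lemma vertical_boxes_volume:
  fixes x :: "'a::euclidean_space"
  assumes m: "m = DIM('a) - 1" "m > 0" and b: "b \<in> Basis" and a: "a > 0"
    and bd: "\<And>n. bounded (U n)"
    and cover: "\<And>y. y \<in> cbox (x - a *\<^sub>R One) (x + a *\<^sub>R One) \<Longrightarrow>
                  \<exists>n. \<exists>q\<in>U n. \<forall>e\<in>Basis - {b}. q \<bullet> e = y \<bullet> e"
  shows "ennreal (unit_ball_vol (real m) * (a / 2) ^ m) \<le> (\<Sum>n. ennreal (unit_ball_vol (real m) * (diameter (U n) / 2) ^ m))"
proof -
  let ?u = "unit_ball_vol (real m)" and ?C = "cbox (x - a *\<^sub>R One) (x + a *\<^sub>R One)"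
  define \<delta> where "\<delta> n = diameter (U n)" for n
  have \<delta>0: "\<delta> n \<ge> 0" for n unfolding \<delta>_def using bd by (rule diameter_ge_0)
  define p where "p n = (SOME q. q \<in> U n)" for n
  define h where "h n e = (if e = b then a else \<delta> n)" for n e
  define c where "c n e = (if e = b then x \<bullet> b else p n \<bullet> e)" for n e
  \<comment> \<open>A box of half-width \<open>\<delta> n\<close> across and with the full height of
    the cube along \<open>b\<close>: meeting a vertical line is then enough to cover its part in the
    cube. For empty \<open>U n\<close> the point \<open>p n\<close> is arbitrary, but the box has
    volume 0.\<close>
  define K where "K n = cbox (\<Sum>e\<in>Basis. (c n e - h n e) *\<^sub>R e) (\<Sum>e\<in>Basis. (c n e + h n e) *\<^sub>R e)" for n
  have u: "?u > 0" by simp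
  have prod: "(\<Prod>e\<in>Basis. if e = b then s else t) = t ^ m * s" for s t :: real
    using b m by (subst prod.remove[of _ b]) (auto intro!: prod.cong simp: card_Diff_singleton)
  have h0: "h n e \<ge> 0" for n e using a \<delta>0 by (simp add: h_def)
  have vK: "emeasure lborel (K n) = ennreal ((2 * \<delta> n) ^ m * (2 * a))" for n
  proof -
    have "emeasure lborel (K n) = (\<Prod>e\<in>Basis. 2 * h n e)"
      unfolding K_def using h0 by (subst emeasure_lborel_cbox) (auto intro!: prod.cong simp: inner_diff_left)
    also have "(\<Prod>e\<in>Basis. 2 * h n e) = (2 * \<delta> n) ^ m * (2 * a)"
      by (subst prod[symmetric]) (auto simp: h_def intro!: prod.cong)
    finally show ?thesis .
  qed
  have vC: "emeasure lborel ?C = ennreal ((2 * a) ^ m * (2 * a))"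
  proof -
    have "DIM('a) = Suc m" using m by simp
    then show ?thesis using a
      by (subst emeasure_lborel_cbox) (auto simp: inner_diff_left inner_add_left mult.commute)
  qed
  have "?C \<subseteq> (\<Union>n. K n)"
  proof
    fix y assume y: "y \<in> ?C"
    obtain n q where q: "q \<in> U n" "\<forall>e\<in>Basis - {b}. q \<bullet> e = y \<bullet> e" using cover[OF y] by blast
    have p: "p n \<in> U n" unfolding p_def using q(1) by (rule someI)
    have "dist q (p n) \<le> \<delta> n" unfolding \<delta>_def by (rule diameter_bounded_bound[OF bd q(1) p])
    then have "\<bar>(q - p n) \<bullet> e\<bar> \<le> \<delta> n" if "e \<in> Basis" for e
      using Basis_le_norm[OF that, of "q - p n"] by (simp add: dist_norm)
    then have "\<bar>y \<bullet> e - c n e\<bar> \<le> h n e" if "e \<in> Basis" for e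
      using y q(2) that by (cases "e = b") (force simp: c_def h_def inner_diff_left mem_box inner_add_left abs_le_iff)+
    then have "c n e - h n e \<le> y \<bullet> e \<and> y \<bullet> e \<le> c n e + h n e" if "e \<in> Basis" for e
      using that by (auto simp: abs_le_iff algebra_simps)
    then have "y \<in> K n" unfolding K_def mem_box by simp
    then show "y \<in> (\<Union>n. K n)" by blast
  qed
  then have "emeasure lborel ?C \<le> emeasure lborel (\<Union>n. K n)"
    by (intro emeasure_mono) (auto simp: K_def)
  also have "\<dots> \<le> (\<Sum>n. emeasure lborel (K n))"
    by (rule emeasure_subadditive_countably) (auto simp: K_def)
  finally have le: "ennreal ((2 * a) ^ m * (2 * a)) \<le> (\<Sum>n. ennreal ((2 * \<delta> n) ^ m * (2 * a)))"
    by (simp add: vK vC)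
  \<comment> \<open>Turns the box volume \<open>(2 * \<delta> n) ^ m * (2 * a)\<close> into a
    summand of \<open>hausdorff_pre\<close>; applied to the cube it gives the left-hand side of the
    claim.\<close>
  define \<tau> where "\<tau> = ?u / (4 ^ m * (2 * a))"
  have "\<tau> > 0" unfolding \<tau>_def using a by simp
  have sc: "\<tau> * ((2 * t) ^ m * (2 * a)) = ?u * (t / 2) ^ m" for t
  proof -
    have "(2 * t) ^ m = 4 ^ m * (t / 2) ^ m" by (subst power_mult_distrib[symmetric]) simp
    then show ?thesis using a by (simp add: \<tau>_def)
  qed
  have "ennreal (?u * (a / 2) ^ m) = ennreal \<tau> * ennreal ((2 * a) ^ m * (2 * a))"
    using a \<open>\<tau> > 0\<close> by (subst ennreal_mult[symmetric]) (simp_all only: sc, auto)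
  also have "\<dots> \<le> ennreal \<tau> * (\<Sum>n. ennreal ((2 * \<delta> n) ^ m * (2 * a)))"
    using le by (rule mult_left_mono) simp
  also have "\<dots> = (\<Sum>n. ennreal \<tau> * ennreal ((2 * \<delta> n) ^ m * (2 * a)))" by simp
  also have "\<dots> = (\<Sum>n. ennreal (?u * (\<delta> n / 2) ^ m))"
    using a \<delta>0 \<open>\<tau> > 0\<close> by (intro suminf_cong) (subst ennreal_mult[symmetric], simp_all only: sc, auto)
  finally show ?thesis by (simp add: \<delta>_def)
qed

lemma level_set_zero_in_interface:
  assumes "level_set_fun \<Omega> D x U \<phi>" "partitioning \<Omega> D" "y \<in> U" "y \<in> \<Omega>" "\<phi> y = 0"
  shows "y \<in> interface D"
proof -
  have "y \<notin> D 1 \<union> D 2"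
  proof
    assume "y \<in> D 1 \<union> D 2"
    then have "\<phi> y < 0 \<or> \<phi> y > 0" using assms(1,3) unfolding level_set_fun_def by blast
    then show False using assms(5) by simp
  qed
  moreover have "D 1 \<union> D 2 = \<Omega> - interface D" using assms(2) by (simp add: partitioning_def)
  ultimately show ?thesis using assms(4) by blast
qed

text \<open>On every line in direction \<open>b\<close> through a small cube around
  \<open>x\<close>, \<open>\<phi>\<close> changes sign inside the ball. So each such line meets the
  interface, and the box argument applies to any cover. The same \<open>\<epsilon>\<close> serves as
  radius and as constant, which suits the compactness argument that follows.\<close>

lemma hausdorff_outer_interface_ball_local:
  fixes \<Omega> :: "'a::euclidean_space set"
  assumes d: "DIM('a) \<ge> 2" and lev: "level_set_fun \<Omega> D x0 U \<phi>" and part: "partitioning \<Omega> D"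
  shows "\<exists>\<epsilon>>0. \<forall>x\<in>interface D \<inter> ball x0 \<epsilon>. \<forall>\<rho>. 0 < \<rho> \<and> \<rho> \<le> \<epsilon> \<and> ball x \<rho> \<subseteq> \<Omega> \<longrightarrow>
           ennreal (\<epsilon> * \<rho> ^ (DIM('a) - 1)) \<le> hausdorff_outer (DIM('a) - 1) (interface D \<inter> ball x \<rho>)"
proof -
  obtain r b K s where r: "r > 0" "ball x0 r \<subseteq> U" "b \<in> Basis" "K > 0" and s: "s = 1 \<or> s = (-1::real)"
    and mono: "\<And>y z. \<lbrakk>y \<in> ball x0 r; z \<in> ball x0 r; (y - z) \<bullet> b > K * (\<Sum>e\<in>Basis - {b}. \<bar>(y - z) \<bullet> e\<bar>)\<rbrakk>
      \<Longrightarrow> s * \<phi> y > s * \<phi> z"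
    using level_set_transversal[OF lev] by metis
  let ?m = "DIM('a) - 1"
  let ?u = "unit_ball_vol (real ?m)"
  \<comment> \<open>A vertical offset \<open>\<Lambda> * a\<close> beats the horizontal offset, at
    most \<open>real ?m * a\<close>, in the cone condition; \<open>\<kappa>\<close> makes both
    offsets together equal to \<open>\<rho> / 2\<close>.\<close>
  define \<Lambda> where "\<Lambda> = K * real ?m + 1"
  define \<kappa> where "\<kappa> = 1 / (2 * (real ?m + \<Lambda>))"
  have \<Lambda>: "\<Lambda> > 0" using r by (simp add: \<Lambda>_def add_nonneg_pos)
  have \<kappa>: "\<kappa> > 0" using \<Lambda> by (simp add: \<kappa>_def add_nonneg_pos)
  define \<epsilon> where "\<epsilon> = min (r / 2) (?u * (\<kappa> / 2) ^ ?m)"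
  have \<epsilon>: "\<epsilon> > 0" using r \<kappa> by (simp add: \<epsilon>_def)
  have Cphi: "continuous_on U \<phi>"
    using lev unfolding level_set_fun_def C_inf_on_def
    by (metis C_k_on.simps(2) continuous_at_imp_continuous_on differentiable_imp_continuous_within)
  have main: "ennreal (\<epsilon> * \<rho> ^ ?m) \<le> hausdorff_outer ?m (interface D \<inter> ball x \<rho>)"
    if x: "x \<in> interface D" "x \<in> ball x0 \<epsilon>" and \<rho>: "0 < \<rho>" "\<rho> \<le> \<epsilon>" "ball x \<rho> \<subseteq> \<Omega>" for x \<rho>
  proof -
    have sub: "ball x \<rho> \<subseteq> ball x0 r"
    proof
      fix y assume "y \<in> ball x \<rho>"
      then have "dist x0 y < r" using dist_triangle[of x0 y x] x \<rho> by (auto simp: \<epsilon>_def)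
      then show "y \<in> ball x0 r" by simp
    qed
    have "x \<in> ball x \<rho>" using \<rho> by simp
    then have "x \<in> U" using sub r by blast
    then have \<phi>x: "\<phi> x = 0" using level_set_interface[OF lev] x by blast
    define a where "a = \<kappa> * \<rho>"
    define \<mu> where "\<mu> = real ?m + \<Lambda>"
    have "\<mu> > 0" using \<Lambda> by (simp add: \<mu>_def add_nonneg_pos)
    moreover have "\<kappa> = 1 / (2 * \<mu>)" by (simp add: \<kappa>_def \<mu>_def)
    ultimately have "\<mu> * a = \<rho> / 2" by (simp add: a_def)
    then have "(real ?m + \<Lambda>) * a = \<rho> / 2" by (simp add: \<mu>_def)
    then have a: "a > 0" "(real ?m + \<Lambda>) * a < \<rho>" using \<kappa> \<rho> by (auto simp: a_def)
    have hit: "\<exists>q\<in>interface D \<inter> ball x \<rho>. \<forall>e\<in>Basis - {b}. q \<bullet> e = y \<bullet> e"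
      if y: "y \<in> cbox (x - a *\<^sub>R One) (x + a *\<^sub>R One)" for y
    proof -
      \<comment> \<open>The vertical line through \<open>y\<close>, parametrised by the height over
        \<open>x\<close>.\<close>
      define q where "q t = y + ((x - y) \<bullet> b + t) *\<^sub>R b" for t
      have qe: "(q t - x) \<bullet> e = (y - x) \<bullet> e" if "e \<in> Basis - {b}" for t e
        using that r(3) by (auto simp: q_def inner_diff_left inner_add_left inner_Basis)
      have qb: "(q t - x) \<bullet> b = t" for t
        using r(3) by (simp add: q_def inner_diff_left inner_add_left inner_Basis)
      have ye: "\<bar>(y - x) \<bullet> e\<bar> \<le> a" if "e \<in> Basis" for e
        using y that by (auto simp: mem_box inner_diff_left inner_add_left abs_le_iff algebra_simps)
      have S: "(\<Sum>e\<in>Basis - {b}. \<bar>(q t - x) \<bullet> e\<bar>) \<le> real ?m * a" for t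
        using sum_bounded_above[of "Basis - {b}" "\<lambda>e. \<bar>(q t - x) \<bullet> e\<bar>" a] qe ye r(3) by simp
      have qball: "q t \<in> ball x \<rho>" if "\<bar>t\<bar> \<le> \<Lambda> * a" for t
      proof -
        have "norm (q t - x) \<le> (\<Sum>e\<in>Basis. \<bar>(q t - x) \<bullet> e\<bar>)" by (rule norm_le_l1)
        also have "\<dots> = \<bar>(q t - x) \<bullet> b\<bar> + (\<Sum>e\<in>Basis - {b}. \<bar>(q t - x) \<bullet> e\<bar>)"
          using r(3) by (simp add: sum.remove)
        also have "\<dots> \<le> \<Lambda> * a + real ?m * a" using qb S that by (intro add_mono) auto
        also have "\<dots> < \<rho>" using a by (simp add: algebra_simps)
        finally show ?thesis by (simp add: dist_norm norm_minus_commute)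
      qed
      have big: "K * (real ?m * a) < \<Lambda> * a" using a(1) by (simp add: \<Lambda>_def algebra_simps)
      have "K * (\<Sum>e\<in>Basis - {b}. \<bar>(q t - x) \<bullet> e\<bar>) < \<Lambda> * a" for t
        using mult_left_mono[OF S[of t], of K] r(4) big by linarith
      note KS = this
      have x0: "x \<in> ball x0 r" using sub \<open>x \<in> ball x \<rho>\<close> by blast
      have q0: "q (\<Lambda> * a) \<in> ball x0 r" "q (- (\<Lambda> * a)) \<in> ball x0 r"
        using sub qball[of "\<Lambda> * a"] qball[of "- (\<Lambda> * a)"] a(1) \<Lambda> by auto
      have top: "s * \<phi> (q (\<Lambda> * a)) > 0"
        using mono[OF q0(1) x0] KS[of "\<Lambda> * a"] by (simp add: qb \<phi>x)
      have bot: "s * \<phi> (q (- (\<Lambda> * a))) < 0"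
      proof -
        have "(x - q (- (\<Lambda> * a))) \<bullet> b = \<Lambda> * a" using qb[of "- (\<Lambda> * a)"] by (simp add: inner_diff_left)
        moreover have "(\<Sum>e\<in>Basis - {b}. \<bar>(x - q t) \<bullet> e\<bar>) = (\<Sum>e\<in>Basis - {b}. \<bar>(q t - x) \<bullet> e\<bar>)" for t
          by (rule sum.cong) (auto simp: inner_diff_left)
        ultimately show ?thesis
          using mono[OF x0 q0(2)] KS[of "- (\<Lambda> * a)"] by (simp add: \<phi>x)
      qed
      have "continuous_on {- (\<Lambda> * a)..\<Lambda> * a} (\<lambda>t. s * \<phi> (q t))"
      proof (intro continuous_intros continuous_on_compose2[OF Cphi])
        show "continuous_on {- (\<Lambda> * a)..\<Lambda> * a} q" unfolding q_def by (intro continuous_intros)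
        show "q ` {- (\<Lambda> * a)..\<Lambda> * a} \<subseteq> U"
        proof (clarify)
          fix t assume "t \<in> {- (\<Lambda> * a)..\<Lambda> * a}"
          then have "q t \<in> ball x \<rho>" by (intro qball) (auto simp: abs_le_iff)
          then show "q t \<in> U" using sub r(2) by blast
        qed
      qed
      then obtain t where t: "- (\<Lambda> * a) \<le> t" "t \<le> \<Lambda> * a" "s * \<phi> (q t) = 0"
        using IVT'[of "\<lambda>t. s * \<phi> (q t)" "- (\<Lambda> * a)" 0 "\<Lambda> * a"] top bot a(1) \<Lambda> by auto
      then have "q t \<in> ball x \<rho>" "\<phi> (q t) = 0" using qball[of t] s by auto
      then have "q t \<in> interface D"
        using level_set_zero_in_interface[OF lev part] sub r(2) \<rho>(3) by blast
      then show ?thesis using \<open>q t \<in> ball x \<rho>\<close> qe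
        by (intro bexI[of _ "q t"]) (auto simp: inner_diff_left)
    qed
    have "ennreal (?u * (a / 2) ^ ?m) \<le> hausdorff_pre ?m 1 (interface D \<inter> ball x \<rho>)"
      unfolding hausdorff_pre_def
    proof (intro INF_greatest, clarify)
      fix V :: "nat \<Rightarrow> 'a set"
      assume V: "interface D \<inter> ball x \<rho> \<subseteq> (\<Union>n. V n)" "\<forall>n. bounded (V n) \<and> diameter (V n) \<le> 1"
      show "ennreal (?u * (a / 2) ^ ?m) \<le> (\<Sum>n. ennreal (?u * (diameter (V n) / 2) ^ ?m))"
        using d V hit by (intro vertical_boxes_volume[OF refl _ r(3) a(1)]) (auto, blast)
    qed
    also have "\<dots> \<le> hausdorff_outer ?m (interface D \<inter> ball x \<rho>)"
      by (rule hausdorff_pre_le_outer) simp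
    finally have "ennreal (?u * (a / 2) ^ ?m) \<le> hausdorff_outer ?m (interface D \<inter> ball x \<rho>)" .
    moreover have "\<epsilon> * \<rho> ^ ?m \<le> ?u * (a / 2) ^ ?m"
    proof -
      have "\<epsilon> * \<rho> ^ ?m \<le> ?u * (\<kappa> / 2) ^ ?m * \<rho> ^ ?m"
        using \<rho> by (intro mult_right_mono) (auto simp: \<epsilon>_def)
      also have "\<dots> = ?u * (a / 2) ^ ?m" by (simp add: a_def power_mult_distrib power_divide)
      finally show ?thesis .
    qed
    ultimately show ?thesis by (meson ennreal_leI order_trans)
  qed
  show ?thesis
  proof (intro exI conjI ballI allI impI)
    show "\<epsilon> > 0" by (rule \<epsilon>)
    fix x \<rho> assume "x \<in> interface D \<inter> ball x0 \<epsilon>" "0 < \<rho> \<and> \<rho> \<le> \<epsilon> \<and> ball x \<rho> \<subseteq> \<Omega>"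
    then show "ennreal (\<epsilon> * \<rho> ^ ?m) \<le> hausdorff_outer ?m (interface D \<inter> ball x \<rho>)"
      by (intro main) auto
  qed
qed

text \<open>Since \<open>P\<close> persists when its number shrinks, the least radius of a finite
  subcover works everywhere; the inserted 1 covers the case of empty \<open>S\<close>.\<close>

lemma compact_uniform_constant:
  fixes S :: "'a::metric_space set" and P :: "'a \<Rightarrow> real \<Rightarrow> bool"
  assumes "compact S"
    and loc: "\<And>x. x \<in> S \<Longrightarrow> \<exists>\<epsilon>>0. \<forall>y\<in>S \<inter> ball x \<epsilon>. P y \<epsilon>"
    and mono: "\<And>y \<epsilon> \<delta>. P y \<epsilon> \<Longrightarrow> 0 < \<delta> \<Longrightarrow> \<delta> \<le> \<epsilon> \<Longrightarrow> P y \<delta>"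
  shows "\<exists>\<epsilon>>0. \<forall>y\<in>S. P y \<epsilon>"
proof -
  obtain r where r: "\<And>x. x \<in> S \<Longrightarrow> r x > 0" "\<And>x y. x \<in> S \<Longrightarrow> y \<in> S \<inter> ball x (r x) \<Longrightarrow> P y (r x)"
    using loc by metis
  obtain X where X: "X \<subseteq> S" "finite X" "S \<subseteq> (\<Union>x\<in>X. ball x (r x))"
    using compactE_image[OF assms(1), of S "\<lambda>x. ball x (r x)"] r(1) by force
  define \<epsilon> where "\<epsilon> = Min (insert 1 (r ` X))"
  have pos: "\<epsilon> > 0" using X r by (auto simp: \<epsilon>_def)
  have "P y \<epsilon>" if y: "y \<in> S" for y
  proof -
    obtain x where x: "x \<in> X" "y \<in> ball x (r x)" using X y by blast
    have "\<epsilon> \<le> r x" using x X by (auto simp: \<epsilon>_def intro: Min_le)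
    then show ?thesis using mono[OF r(2)[of x y] pos] x X y by blast
  qed
  then show ?thesis using pos by blast
qed

lemma hausdorff_outer_interface_ball:
  fixes \<Omega> :: "'a::euclidean_space set"
  assumes d: "DIM('a) \<ge> 2" and "smooth_interface \<Omega> D" "partitioning \<Omega> D" "compact (interface D)"
  shows "\<exists>\<epsilon>>0. \<forall>x\<in>interface D. \<forall>\<rho>. 0 < \<rho> \<and> \<rho> \<le> \<epsilon> \<and> ball x \<rho> \<subseteq> \<Omega> \<longrightarrow>
           ennreal (\<epsilon> * \<rho> ^ (DIM('a) - 1)) \<le> hausdorff_outer (DIM('a) - 1) (interface D \<inter> ball x \<rho>)"
proof (rule compact_uniform_constant[OF assms(4)])
  fix x assume "x \<in> interface D"
  then obtain U \<phi> where "level_set_fun \<Omega> D x U \<phi>" using assms(2) unfolding smooth_interface_def by blast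
  from hausdorff_outer_interface_ball_local[OF d this assms(3)]
  show "\<exists>\<epsilon>>0. \<forall>y\<in>interface D \<inter> ball x \<epsilon>. \<forall>\<rho>. 0 < \<rho> \<and> \<rho> \<le> \<epsilon> \<and> ball y \<rho> \<subseteq> \<Omega> \<longrightarrow>
           ennreal (\<epsilon> * \<rho> ^ (DIM('a) - 1)) \<le> hausdorff_outer (DIM('a) - 1) (interface D \<inter> ball y \<rho>)" .
next
  fix y and \<epsilon> \<delta> :: real
  assume *: "\<forall>\<rho>. 0 < \<rho> \<and> \<rho> \<le> \<epsilon> \<and> ball y \<rho> \<subseteq> \<Omega> \<longrightarrow>
           ennreal (\<epsilon> * \<rho> ^ (DIM('a) - 1)) \<le> hausdorff_outer (DIM('a) - 1) (interface D \<inter> ball y \<rho>)"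
    and "0 < \<delta>" "\<delta> \<le> \<epsilon>"
  show "\<forall>\<rho>. 0 < \<rho> \<and> \<rho> \<le> \<delta> \<and> ball y \<rho> \<subseteq> \<Omega> \<longrightarrow>
           ennreal (\<delta> * \<rho> ^ (DIM('a) - 1)) \<le> hausdorff_outer (DIM('a) - 1) (interface D \<inter> ball y \<rho>)"
  proof (intro allI impI)
    fix \<rho> assume \<rho>: "0 < \<rho> \<and> \<rho> \<le> \<delta> \<and> ball y \<rho> \<subseteq> \<Omega>"
    have "ennreal (\<delta> * \<rho> ^ (DIM('a) - 1)) \<le> ennreal (\<epsilon> * \<rho> ^ (DIM('a) - 1))"
      using \<rho> \<open>\<delta> \<le> \<epsilon>\<close> by (intro ennreal_leI mult_right_mono) auto
    then show "ennreal (\<delta> * \<rho> ^ (DIM('a) - 1)) \<le> hausdorff_outer (DIM('a) - 1) (interface D \<inter> ball y \<rho>)"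
      using * \<rho> \<open>\<delta> \<le> \<epsilon>\<close> by (meson order_trans)
  qed
qed

section \<open>Polynomials on simplices\<close>

definition monomials :: "nat \<Rightarrow> ('a::euclidean_space \<Rightarrow> nat) set" where
  "monomials k = {m \<in> Basis \<rightarrow>\<^sub>E {..k}. (\<Sum>b\<in>Basis. m b) \<le> k}"

lemma finite_monomials: "finite (monomials k)"
  unfolding monomials_def by (simp add: finite_PiE)

lemma poly_fun_iff:
  "p \<in> poly_fun k \<longleftrightarrow> (\<exists>c. p = (\<lambda>x. \<Sum>m\<in>monomials k. c m * (\<Prod>b\<in>Basis. (x \<bullet> b) ^ m b)))"
  by (simp add: poly_fun_def monomials_def)

lemma poly_fun_monomial:
  fixes m :: "'a::euclidean_space \<Rightarrow> nat"
  assumes "(\<Sum>b\<in>Basis. m b) \<le> k"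
  shows "(\<lambda>x. \<Prod>b\<in>Basis. (x \<bullet> b) ^ m b) \<in> poly_fun k"
proof -
  let ?m = "restrict m Basis"
  have "m b \<le> k" if "b \<in> Basis" for b
    using assms member_le_sum[of b Basis m] that by simp
  then have "?m \<in> monomials k" using assms by (auto simp: monomials_def)
  then have "(\<Sum>n\<in>monomials k. (if n = ?m then 1 else 0) * (\<Prod>b\<in>Basis. (x \<bullet> b) ^ n b)) = (\<Prod>b\<in>Basis. (x \<bullet> b) ^ m b)" for x :: 'a
    by (simp add: finite_monomials sum.delta' if_distrib[of "\<lambda>c. c * _"] sum.delta cong: if_cong)
  then show ?thesis unfolding poly_fun_iff by (intro exI[of _ "\<lambda>n. if n = ?m then 1 else 0"]) simp
qed

lemma poly_fun_0: "(\<lambda>x. 0) \<in> poly_fun k"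
  unfolding poly_fun_iff by (intro exI[of _ "\<lambda>_. 0"]) simp

lemma poly_fun_add: "p \<in> poly_fun k \<Longrightarrow> q \<in> poly_fun k \<Longrightarrow> (\<lambda>x. p x + q x) \<in> poly_fun k"
  unfolding poly_fun_iff
  apply (elim exE)
  subgoal for c d by (intro exI[of _ "\<lambda>m. c m + d m"]) (simp add: sum.distrib distrib_right)
  done

lemma poly_fun_cmult: "p \<in> poly_fun k \<Longrightarrow> (\<lambda>x. c * p x) \<in> poly_fun k"
  unfolding poly_fun_iff
  apply (elim exE)
  subgoal for d by (intro exI[of _ "\<lambda>m. c * d m"]) (simp add: sum_distrib_left mult.assoc)
  done

lemma poly_fun_diff: "p \<in> poly_fun k \<Longrightarrow> q \<in> poly_fun k \<Longrightarrow> (\<lambda>x. p x - q x) \<in> poly_fun k"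
  using poly_fun_add[OF _ poly_fun_cmult[of q k "-1"], of p] by simp

lemma poly_fun_sum: "(\<And>i. i \<in> I \<Longrightarrow> f i \<in> poly_fun k) \<Longrightarrow> (\<lambda>x. \<Sum>i\<in>I. f i x) \<in> poly_fun k"
  by (induction I rule: infinite_finite_induct) (auto intro: poly_fun_0 poly_fun_add)

lemma poly_fun_mono:
  assumes "p \<in> poly_fun k" "k \<le> l" shows "p \<in> poly_fun l"
proof -
  obtain c where p: "p = (\<lambda>x. \<Sum>m\<in>monomials k. c m * (\<Prod>b\<in>Basis. (x \<bullet> b) ^ m b))"
    using assms by (auto simp: poly_fun_iff)
  show ?thesis unfolding p using assms(2)
    by (intro poly_fun_sum poly_fun_cmult poly_fun_monomial) (auto simp: monomials_def)
qed

lemma poly_fun_mult: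
  assumes "p \<in> poly_fun k" "q \<in> poly_fun l" shows "(\<lambda>x. p x * q x) \<in> poly_fun (k + l)"
proof -
  obtain c d where p: "p = (\<lambda>x. \<Sum>m\<in>monomials k. c m * (\<Prod>b\<in>Basis. (x \<bullet> b) ^ m b))"
    and q: "q = (\<lambda>x. \<Sum>m\<in>monomials l. d m * (\<Prod>b\<in>Basis. (x \<bullet> b) ^ m b))"
    using assms by (auto simp: poly_fun_iff)
  have "(\<lambda>x. p x * q x) = (\<lambda>x. \<Sum>m\<in>monomials k. \<Sum>n\<in>monomials l. c m * d n * (\<Prod>b\<in>Basis. (x \<bullet> b) ^ (m b + n b)))"
    unfolding p q by (simp add: sum_product power_add prod.distrib mult_ac)
  also have "\<dots> \<in> poly_fun (k + l)"
    by (intro poly_fun_sum poly_fun_cmult poly_fun_monomial) (auto simp: monomials_def sum.distrib add_mono)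
  finally show ?thesis .
qed

lemma poly_fun_const: "(\<lambda>x. c) \<in> poly_fun k"
  using poly_fun_cmult[OF poly_fun_monomial[of "\<lambda>_. 0" k], of c] by simp

lemma poly_fun_inner_Basis:
  assumes "b \<in> Basis" shows "(\<lambda>x. x \<bullet> b) \<in> poly_fun (Suc 0)"
proof -
  have "(\<lambda>x. \<Prod>e\<in>Basis. (x \<bullet> e) ^ (if e = b then 1 else 0)) \<in> poly_fun (Suc 0)"
    by (rule poly_fun_monomial) (use assms in \<open>simp add: sum.delta'\<close>)
  moreover have "(\<Prod>e\<in>Basis. (x \<bullet> e) ^ (if e = b then 1 else 0)) = x \<bullet> b" for x
    using assms by (simp add: if_distrib[of "\<lambda>n. _ ^ n"] prod.delta' cong: if_cong)
  ultimately show ?thesis by simp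
qed

lemma poly_fun_affine: "(\<lambda>x. a \<bullet> x + c) \<in> poly_fun (Suc 0)"
proof -
  have "(\<lambda>x. (\<Sum>b\<in>Basis. (a \<bullet> b) * (x \<bullet> b)) + c) \<in> poly_fun (Suc 0)"
    by (intro poly_fun_add poly_fun_sum poly_fun_cmult poly_fun_inner_Basis poly_fun_const)
  then show ?thesis by (simp only: euclidean_inner[symmetric])
qed

lemma poly_fun_prod:
  "(\<And>i. i \<in> I \<Longrightarrow> f i \<in> poly_fun (n i)) \<Longrightarrow> (\<lambda>x. \<Prod>i\<in>I. f i x) \<in> poly_fun (\<Sum>i\<in>I. n i)"
  by (induction I rule: infinite_finite_induct) (auto intro: poly_fun_const poly_fun_mult)

text \<open>The class \<open>PD\<close> contains constants and coordinates and is closed under sums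
  and products. The degree of the derivative is not lowered: this suffices for the product rule and
  spares a special case for degree 0.\<close>

lemma poly_fun_derivative_aux:
  "p \<in> poly_fun k \<Longrightarrow> \<exists>g. (\<forall>x. (p has_derivative (\<lambda>h. g x \<bullet> h)) (at x)) \<and> (\<forall>b\<in>Basis. (\<lambda>x. g x \<bullet> b) \<in> poly_fun k)"
proof -
  define PD where "PD k = {f \<in> poly_fun k. \<exists>g. (\<forall>x. (f has_derivative (\<lambda>h. g x \<bullet> h)) (at x)) \<and>
      (\<forall>b\<in>Basis. (\<lambda>x::'a. g x \<bullet> b) \<in> poly_fun k)}" for k
  have const: "(\<lambda>x. c) \<in> PD k" for c k
  proof -
    have "((\<lambda>x. c) has_derivative (\<lambda>h. 0 \<bullet> h)) (at x)" for x :: 'a by simp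
    then show ?thesis by (auto simp only: PD_def poly_fun_const inner_zero_left intro!: exI[of _ "\<lambda>_. 0"])
  qed
  have coord: "(\<lambda>x. x \<bullet> b) \<in> PD (Suc 0)" if "b \<in> Basis" for b
    using that by (auto simp: PD_def poly_fun_inner_Basis poly_fun_const inner_commute intro!: exI[of _ "\<lambda>_. b"] derivative_eq_intros)
  have add: "(\<lambda>x. f x + g x) \<in> PD k" if fg: "f \<in> PD k" "g \<in> PD k" for f g k
  proof -
    obtain f' g' where "\<forall>x. (f has_derivative (\<lambda>h. f' x \<bullet> h)) (at x)" "\<forall>b\<in>Basis. (\<lambda>x. f' x \<bullet> b) \<in> poly_fun k"
      "\<forall>x. (g has_derivative (\<lambda>h. g' x \<bullet> h)) (at x)" "\<forall>b\<in>Basis. (\<lambda>x. g' x \<bullet> b) \<in> poly_fun k"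
      using fg unfolding PD_def by blast
    then have "((\<lambda>x. f x + g x) has_derivative (\<lambda>h. (f' x + g' x) \<bullet> h)) (at x)"
        "b \<in> Basis \<Longrightarrow> (\<lambda>x. (f' x + g' x) \<bullet> b) \<in> poly_fun k" for x b
      unfolding inner_add_left by (auto intro!: has_derivative_add poly_fun_add)
    then show ?thesis using fg unfolding PD_def
      by (intro CollectI conjI exI[of _ "\<lambda>x. f' x + g' x"] allI ballI poly_fun_add) auto
  qed
  have mult: "(\<lambda>x. f x * g x) \<in> PD (k + l)" if fg: "f \<in> PD k" "g \<in> PD l" for f g k l
  proof -
    obtain f' g' where der: "\<forall>x. (f has_derivative (\<lambda>h. f' x \<bullet> h)) (at x)" "\<forall>b\<in>Basis. (\<lambda>x. f' x \<bullet> b) \<in> poly_fun k"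
      "\<forall>x. (g has_derivative (\<lambda>h. g' x \<bullet> h)) (at x)" "\<forall>b\<in>Basis. (\<lambda>x. g' x \<bullet> b) \<in> poly_fun l"
      using fg unfolding PD_def by blast
    have "((\<lambda>x. f x * g x) has_derivative (\<lambda>h. (f x *\<^sub>R g' x + g x *\<^sub>R f' x) \<bullet> h)) (at x)"
        "b \<in> Basis \<Longrightarrow> (\<lambda>x. (f x *\<^sub>R g' x + g x *\<^sub>R f' x) \<bullet> b) \<in> poly_fun (k + l)" for x b
    proof -
      have "((\<lambda>x. f x * g x) has_derivative (\<lambda>h. f x * (g' x \<bullet> h) + (f' x \<bullet> h) * g x)) (at x)"
        using der by (intro has_derivative_mult) auto
      then show "((\<lambda>x. f x * g x) has_derivative (\<lambda>h. (f x *\<^sub>R g' x + g x *\<^sub>R f' x) \<bullet> h)) (at x)"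
        by (simp add: inner_add_left mult.commute)
      assume "b \<in> Basis"
      then have "(\<lambda>x. f x * (g' x \<bullet> b) + (f' x \<bullet> b) * g x) \<in> poly_fun (k + l)"
        using fg der by (intro poly_fun_add poly_fun_mult) (auto simp: PD_def)
      then show "(\<lambda>x. (f x *\<^sub>R g' x + g x *\<^sub>R f' x) \<bullet> b) \<in> poly_fun (k + l)"
        by (simp add: inner_add_left mult.commute)
    qed
    then show ?thesis using fg unfolding PD_def
      by (intro CollectI conjI exI[of _ "\<lambda>x. f x *\<^sub>R g' x + g x *\<^sub>R f' x"] allI ballI poly_fun_mult) auto
  qed
  have pow: "(\<lambda>x. (x \<bullet> b) ^ n) \<in> PD n" if "b \<in> Basis" for b n
  proof (induction n)
    case (Suc n)
    show ?case using mult[OF coord[OF that] Suc] by simp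
  qed (simp add: const)
  have prod: "(\<lambda>x. \<Prod>b\<in>B. (x \<bullet> b) ^ m b) \<in> PD (\<Sum>b\<in>B. m b)" if "B \<subseteq> Basis" for B and m :: "'a \<Rightarrow> nat"
    using that
  proof (induction B rule: infinite_finite_induct)
    case (insert b B)
    have "(\<lambda>x. (x \<bullet> b) ^ m b * (\<Prod>b\<in>B. (x \<bullet> b) ^ m b)) \<in> PD (m b + (\<Sum>b\<in>B. m b))"
      by (rule mult[OF pow]) (use insert in auto)
    then show ?case using insert by simp
  qed (auto intro: const)
  have mono: "f \<in> PD l" if "f \<in> PD k" "k \<le> l" for f k l
    using that poly_fun_mono unfolding PD_def by blast
  have sum: "(\<lambda>x. \<Sum>i\<in>I. f i x) \<in> PD k" if "\<And>i. i \<in> I \<Longrightarrow> f i \<in> PD k" for I and f :: "('a \<Rightarrow> nat) \<Rightarrow> 'a \<Rightarrow> real"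
    using that by (induction I rule: infinite_finite_induct) (auto intro: const add)
  assume "p \<in> poly_fun k"
  then obtain c where p: "p = (\<lambda>x. \<Sum>m\<in>monomials k. c m * (\<Prod>b\<in>Basis. (x \<bullet> b) ^ m b))"
    by (auto simp: poly_fun_iff)
  have "p \<in> PD k" unfolding p
  proof (rule sum)
    fix m :: "'a \<Rightarrow> nat" assume "m \<in> monomials k"
    then show "(\<lambda>x. c m * (\<Prod>b\<in>Basis. (x \<bullet> b) ^ m b)) \<in> PD k"
      using mono[OF mult[OF const[where k = 0] prod[of Basis m]]] by (simp add: monomials_def)
  qed
  then show ?thesis by (simp add: PD_def)
qed

lemma
  assumes "p \<in> poly_fun k"
  shows poly_fun_has_derivative: "(p has_derivative (\<lambda>h. grad UNIV p x \<bullet> h)) (at x)"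
    and poly_fun_grad: "b \<in> Basis \<Longrightarrow> (\<lambda>x. grad UNIV p x \<bullet> b) \<in> poly_fun k"
proof -
  obtain g where g: "\<And>x. (p has_derivative (\<lambda>h. g x \<bullet> h)) (at x)" "\<And>b. b \<in> Basis \<Longrightarrow> (\<lambda>x. g x \<bullet> b) \<in> poly_fun k"
    using poly_fun_derivative_aux[OF assms] by blast
  have "frechet_derivative p (at x) = (\<lambda>h. g x \<bullet> h)" for x
    using frechet_derivative_at[OF g(1)] by simp
  then have eq: "grad UNIV p x = g x" for x by (simp add: grad_def euclidean_representation)
  show "(p has_derivative (\<lambda>h. grad UNIV p x \<bullet> h)) (at x)" using g(1) by (simp add: eq)
  show "(\<lambda>x. grad UNIV p x \<bullet> b) \<in> poly_fun k" if "b \<in> Basis" using g(2)[OF that] by (simp add: eq)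
qed

lemma poly_fun_continuous_on: "p \<in> poly_fun k \<Longrightarrow> continuous_on S p"
  by (intro continuous_at_imp_continuous_on ballI has_derivative_continuous[OF poly_fun_has_derivative])

lemma grad_poly_fun_continuous_on:
  assumes "p \<in> poly_fun k" shows "continuous_on S (grad UNIV p)"
  by (rule iffD2[OF continuous_on_componentwise])
    (intro ballI poly_fun_continuous_on[OF poly_fun_grad[OF assms]])

section \<open>Barycentric coordinates\<close>

text \<open>An affine function on the whole space rather than on the simplex, so that polynomials
  can be built from it.\<close>

definition bary :: "'a::euclidean_space set \<Rightarrow> 'a \<Rightarrow> 'a \<Rightarrow> real" where
  "bary C v = (SOME f. (\<exists>a c. f = (\<lambda>x. a \<bullet> x + c)) \<and> (\<forall>w\<in>C. f w = (if w = v then 1 else 0)))"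

text \<open>The differences to another vertex \<open>v0\<close> are linearly independent, so a
  linear functional with value 1 at \<open>v - v0\<close> and 0 at the others exists;
  \<open>adjoint g 1\<close> is the vector representing it.\<close>

lemma bary_exists:
  fixes C :: "'a::euclidean_space set"
  assumes "\<not> affine_dependent C" "v \<in> C"
  shows "\<exists>f::'a \<Rightarrow> real. (\<exists>a c. f = (\<lambda>x. a \<bullet> x + c)) \<and> (\<forall>w\<in>C. f w = (if w = v then 1 else 0))"
proof (cases "C = {v}")
  case True
  then show ?thesis by (intro exI[of _ "\<lambda>x. 0 \<bullet> x + 1"] conjI exI[of _ "0 :: 'a"] exI[of _ "1 :: real"]) auto
next
  case False
  then obtain v0 where v0: "v0 \<in> C" "v0 \<noteq> v" using assms by blast
  have "independent ((\<lambda>x. - v0 + x) ` (C - {v0}))"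
    using assms(1) affine_dependent_iff_dependent2[OF v0(1)] by simp
  from linear_independent_extend[OF this, of "\<lambda>z. if z = - v0 + v then 1 else (0::real)"]
  obtain g where g: "linear g" "\<And>z. z \<in> (\<lambda>x. - v0 + x) ` (C - {v0}) \<Longrightarrow> g z = (if z = - v0 + v then 1 else (0::real))"
    by blast
  show ?thesis
  proof (intro exI[of _ "\<lambda>x. adjoint g 1 \<bullet> x + (- g v0)"] conjI ballI)
    show "\<exists>a c. (\<lambda>x. adjoint g 1 \<bullet> x + - g v0) = (\<lambda>x. a \<bullet> x + c)" by blast
    fix w assume w: "w \<in> C"
    have "adjoint g 1 \<bullet> w = g w" using adjoint_works[OF g(1), of w 1] by (simp add: inner_commute)
    then have "adjoint g 1 \<bullet> w + - g v0 = g (- v0 + w)" using g(1) by (simp add: linear_diff)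
    also have "\<dots> = (if w = v then 1 else 0)"
      using g v0 w by (cases "w = v0") (auto simp: linear_0)
    finally show "adjoint g 1 \<bullet> w + - g v0 = (if w = v then 1 else 0)" .
  qed
qed

lemma
  assumes "\<not> affine_dependent C" "v \<in> C"
  shows bary_affine: "\<exists>a c. bary C v = (\<lambda>x. a \<bullet> x + c)"
    and bary_vertex: "w \<in> C \<Longrightarrow> bary C v w = (if w = v then 1 else 0)"
  using someI_ex[OF bary_exists[OF assms]] unfolding bary_def by blast+

lemma bary_combination:
  assumes C: "\<not> affine_dependent C" "v \<in> C" and u: "sum u C = 1"
  shows "bary C v (\<Sum>w\<in>C. u w *\<^sub>R w) = u v"
proof -
  obtain a c where ac: "bary C v = (\<lambda>x. a \<bullet> x + c)" using bary_affine[OF C] by blast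
  have fin: "finite C" using C(1) by (rule aff_independent_finite)
  have "bary C v (\<Sum>w\<in>C. u w *\<^sub>R w) = (\<Sum>w\<in>C. u w * (a \<bullet> w)) + (\<Sum>w\<in>C. u w) * c"
    unfolding ac by (simp add: inner_sum_right u)
  also have "\<dots> = (\<Sum>w\<in>C. u w * bary C v w)"
    unfolding ac by (simp add: distrib_left sum.distrib sum_distrib_right)
  also have "\<dots> = (\<Sum>w\<in>C. u w * (if w = v then 1 else 0))"
    using bary_vertex[OF C] by (intro sum.cong) auto
  also have "\<dots> = u v" using fin C(2) by (simp add: if_distrib sum.delta cong: if_cong)
  finally show ?thesis .
qed

lemma
  assumes C: "\<not> affine_dependent C" and x: "x \<in> convex hull C"
  shows bary_nonneg: "v \<in> C \<Longrightarrow> 0 \<le> bary C v x" and bary_le_1: "v \<in> C \<Longrightarrow> bary C v x \<le> 1"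
    and bary_sum: "(\<Sum>v\<in>C. bary C v x) = 1" and bary_sum_vertices: "(\<Sum>v\<in>C. bary C v x *\<^sub>R v) = x"
proof -
  have fin: "finite C" using C by (rule aff_independent_finite)
  obtain u where u: "\<forall>v\<in>C. 0 \<le> u v" "sum u C = 1" "x = (\<Sum>v\<in>C. u v *\<^sub>R v)"
    using x unfolding convex_hull_finite[OF fin] by auto
  have b: "bary C v x = u v" if "v \<in> C" for v
    unfolding u(3) by (rule bary_combination[OF C that u(2)])
  show "v \<in> C \<Longrightarrow> 0 \<le> bary C v x" using b u by simp
  show "v \<in> C \<Longrightarrow> bary C v x \<le> 1" using b u member_le_sum[of v C u] fin by force
  show "(\<Sum>v\<in>C. bary C v x) = 1" using b u by simp
  show "(\<Sum>v\<in>C. bary C v x *\<^sub>R v) = x" using b u by simp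
qed

lemma bary_face_iff:
  assumes C: "\<not> affine_dependent C" "c \<subseteq> C" and x: "x \<in> convex hull C"
  shows "x \<in> convex hull c \<longleftrightarrow> (\<forall>v\<in>C - c. bary C v x = 0)"
proof
  have fin: "finite C" "finite c" using C aff_independent_finite finite_subset by blast+
  assume "x \<in> convex hull c"
  then obtain u where u: "\<forall>v\<in>c. 0 \<le> u v" "sum u c = 1" "x = (\<Sum>v\<in>c. u v *\<^sub>R v)"
    unfolding convex_hull_finite[OF fin(2)] by auto
  define w where "w v = (if v \<in> c then u v else 0)" for v
  have "sum w C = sum u c" "(\<Sum>v\<in>C. w v *\<^sub>R v) = (\<Sum>v\<in>c. u v *\<^sub>R v)"
    using C(2) fin by (auto simp: w_def intro!: sum.mono_neutral_cong_right)
  then have "bary C v x = w v" if "v \<in> C" for v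
    using bary_combination[OF C(1) that, of w] u by simp
  then show "\<forall>v\<in>C - c. bary C v x = 0" by (auto simp: w_def)
next
  have fin: "finite C" "finite c" using C aff_independent_finite finite_subset by blast+
  assume 0: "\<forall>v\<in>C - c. bary C v x = 0"
  have "(\<Sum>v\<in>C. bary C v x) = (\<Sum>v\<in>c. bary C v x)" "(\<Sum>v\<in>C. bary C v x *\<^sub>R v) = (\<Sum>v\<in>c. bary C v x *\<^sub>R v)"
    using fin C 0 by (auto intro!: sum.mono_neutral_right)
  then show "x \<in> convex hull c"
    unfolding convex_hull_finite[OF fin(2)]
    using bary_sum[OF C(1) x] bary_sum_vertices[OF C(1) x] bary_nonneg[OF C(1) x] C(2)
    by (intro CollectI exI[of _ "\<lambda>v. bary C v x"]) auto
qed

text \<open>Along the diameter of the inscribed ball in the direction of the gradient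
  \<open>a\<close> the coordinate changes by \<open>2 * r * norm a\<close>; both ends lie in the
  simplex, where its values are between 0 and 1.\<close>

lemma bary_lipschitz:
  assumes C: "\<not> affine_dependent C" "v \<in> C" and r: "0 < r" "cball z r \<subseteq> convex hull C"
  shows "\<bar>bary C v x - bary C v y\<bar> \<le> dist x y / (2 * r)"
proof -
  obtain a c where ac: "bary C v = (\<lambda>x. a \<bullet> x + c)" using bary_affine[OF C] by blast
  have "norm a * (2 * r) \<le> 1"
  proof (cases "a = 0")
    case False
    define p where "p = z + (r / norm a) *\<^sub>R a"
    define q where "q = z - (r / norm a) *\<^sub>R a"
    have "norm ((r / norm a) *\<^sub>R a) = r" using r False by simp
    then have "p \<in> cball z r" "q \<in> cball z r" by (simp_all only: p_def q_def mem_cball dist_norm) (simp_all add: norm_minus_commute)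
    then have pq: "p \<in> convex hull C" "q \<in> convex hull C" using r(2) by auto
    have "bary C v p - bary C v q \<le> 1"
      using bary_le_1[OF C(1) pq(1) C(2)] bary_nonneg[OF C(1) pq(2) C(2)] by linarith
    moreover have "bary C v p - bary C v q = a \<bullet> ((2 * r / norm a) *\<^sub>R a)"
      unfolding ac p_def q_def by (simp add: inner_add_right inner_diff_right)
    moreover have "\<dots> = 2 * r * norm a" using False by (simp add: dot_square_norm power2_eq_square)
    ultimately show ?thesis by (simp add: mult.commute)
  qed simp
  then have na: "norm a \<le> 1 / (2 * r)" using r by (simp add: field_simps)
  have "\<bar>bary C v x - bary C v y\<bar> = \<bar>a \<bullet> (x - y)\<bar>" unfolding ac by (simp add: inner_diff_right)
  also have "\<dots> \<le> norm a * norm (x - y)" by (rule Cauchy_Schwarz_ineq2)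
  also have "\<dots> \<le> 1 / (2 * r) * norm (x - y)" using na by (rule mult_right_mono) simp
  finally show ?thesis by (simp add: dist_norm)
qed

section \<open>Lattice nodes and Lagrange shape functions\<close>

definition multi_index :: "nat \<Rightarrow> 'a set \<Rightarrow> ('a \<Rightarrow> nat) set" where
  "multi_index k C = {m \<in> C \<rightarrow>\<^sub>E {..k}. sum m C = k}"

definition lattice_point :: "nat \<Rightarrow> 'a::euclidean_space set \<Rightarrow> ('a \<Rightarrow> nat) \<Rightarrow> 'a" where
  "lattice_point k C m = (\<Sum>v\<in>C. (real (m v) / real k) *\<^sub>R v)"

text \<open>The Lagrange basis of the principal lattice in product form: for each vertex
  \<open>v\<close> the factors vanish on the lattice layers
  \<open>real k * bary C v x = real l\<close> with \<open>l < m v\<close>, those below the layer of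
  the node.\<close>

definition shape_fun :: "nat \<Rightarrow> 'a::euclidean_space set \<Rightarrow> ('a \<Rightarrow> nat) \<Rightarrow> 'a \<Rightarrow> real" where
  "shape_fun k C m x = (\<Prod>v\<in>C. \<Prod>l<m v. (real k * bary C v x - real l) / (real (m v) - real l))"

lemma finite_multi_index: "finite C \<Longrightarrow> finite (multi_index k C)"
  unfolding multi_index_def by (simp add: finite_PiE)

lemma card_multi_index_le: "finite C \<Longrightarrow> card (multi_index k C) \<le> Suc k ^ card C"
proof -
  assume C: "finite C"
  have "card (multi_index k C) \<le> card (C \<rightarrow>\<^sub>E {..k})"
    using C by (intro card_mono) (auto simp: multi_index_def finite_PiE)
  then show ?thesis using C by (simp add: card_PiE)
qed

lemma lattice_nodes_eq:
  assumes "\<not> affine_dependent C" "k > 0"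
  shows "lattice_nodes k (convex hull C) = lattice_point k C ` multi_index k C"
proof -
  have fin: "finite C" using assms(1) by (rule aff_independent_finite)
  have ext: "{v. v extreme_point_of convex hull C} = C"
    using extreme_point_of_convex_hull_affine_independent[OF assms(1)] by blast
  have le: "m v \<le> k" if "sum m C = k" "v \<in> C" for m :: "'a \<Rightarrow> nat" and v
    using member_le_sum[of v C m] that fin by simp
  show ?thesis
  proof (intro equalityI subsetI)
    fix x assume "x \<in> lattice_nodes k (convex hull C)"
    then obtain m where m: "sum m C = k" "x = lattice_point k C m"
      unfolding lattice_nodes_def ext lattice_point_def by blast
    have "restrict m C \<in> multi_index k C" "x = lattice_point k C (restrict m C)"
      using m le[OF m(1)] by (auto simp: multi_index_def lattice_point_def)
    then show "x \<in> lattice_point k C ` multi_index k C" by blast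
  next
    fix x assume "x \<in> lattice_point k C ` multi_index k C"
    then show "x \<in> lattice_nodes k (convex hull C)"
      unfolding lattice_nodes_def ext by (auto simp: lattice_point_def multi_index_def)
  qed
qed

lemma bary_lattice_point:
  assumes "\<not> affine_dependent C" "v \<in> C" "k > 0" "m \<in> multi_index k C"
  shows "bary C v (lattice_point k C m) = real (m v) / real k"
  unfolding lattice_point_def
proof (rule bary_combination[OF assms(1,2)])
  have "(\<Sum>v\<in>C. real (m v) / real k) = real (sum m C) / real k" by (simp add: sum_divide_distrib)
  then show "(\<Sum>v\<in>C. real (m v) / real k) = 1" using assms by (simp add: multi_index_def del: of_nat_sum)
qed

lemma lattice_point_in_hull:
  assumes "finite C" "k > 0" "m \<in> multi_index k C"
  shows "lattice_point k C m \<in> convex hull C"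
proof -
  have "(\<Sum>v\<in>C. real (m v) / real k) = real (sum m C) / real k" by (simp add: sum_divide_distrib)
  then have "(\<Sum>v\<in>C. real (m v) / real k) = 1" using assms by (simp add: multi_index_def del: of_nat_sum)
  then show ?thesis unfolding convex_hull_finite[OF assms(1)] lattice_point_def
    by (intro CollectI exI[of _ "\<lambda>v. real (m v) / real k"]) auto
qed

text \<open>Different multi-indices with the same sum have a vertex with \<open>n v < m v\<close>,
  where the factor for \<open>l = n v\<close> vanishes.\<close>

lemma shape_fun_lattice_point:
  assumes C: "\<not> affine_dependent C" "k > 0" and m: "m \<in> multi_index k C" and n: "n \<in> multi_index k C"
  shows "shape_fun k C m (lattice_point k C n) = (if n = m then 1 else 0)"
proof -
  have fin: "finite C" using C(1) by (rule aff_independent_finite)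
  have eq: "shape_fun k C m (lattice_point k C n) = (\<Prod>v\<in>C. \<Prod>l<m v. (real (n v) - real l) / (real (m v) - real l))"
    unfolding shape_fun_def using bary_lattice_point[OF C(1) _ C(2) n] C(2) by (intro prod.cong) auto
  show ?thesis
  proof (cases "n = m")
    case False
    have "\<exists>v\<in>C. n v < m v"
    proof (rule ccontr)
      assume "\<not> (\<exists>v\<in>C. n v < m v)"
      then have ge: "\<And>v. v \<in> C \<Longrightarrow> m v \<le> n v" by force
      have "\<exists>v\<in>C. n v \<noteq> m v"
        using False m n unfolding multi_index_def by (metis (no_types, lifting) PiE_ext mem_Collect_eq)
      then have "sum m C < sum n C" using ge fin by (metis sum_strict_mono_ex1 le_neq_implies_less)
      then show False using m n by (simp add: multi_index_def)
    qed
    then obtain v where v: "v \<in> C" "n v < m v" by blast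
    then have "(\<Prod>l<m v. (real (n v) - real l) / (real (m v) - real l)) = 0" by (intro prod_zero) auto
    then show ?thesis using v fin False unfolding eq by (auto intro: prod_zero)
  next
    case True
    have "(\<Prod>l<m v. (real (m v) - real l) / (real (m v) - real l)) = 1" for v by (intro prod.neutral) auto
    then show ?thesis using eq True by simp
  qed
qed

lemma shape_fun_poly:
  assumes C: "\<not> affine_dependent C" and m: "m \<in> multi_index k C"
  shows "shape_fun k C m \<in> poly_fun k"
proof -
  have factor: "(\<lambda>x. (real k * bary C v x - real l) / (real (m v) - real l)) \<in> poly_fun 1" if v: "v \<in> C" for v l
  proof -
    obtain a c where ac: "bary C v = (\<lambda>x. a \<bullet> x + c)" using bary_affine[OF C v] by blast
    have "(\<lambda>x. (1 / (real (m v) - real l)) * (real k * (a \<bullet> x + c) - real l)) \<in> poly_fun 1"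
      using poly_fun_affine[of a c] by (intro poly_fun_cmult poly_fun_diff poly_fun_const) simp
    then show ?thesis unfolding ac by simp
  qed
  have "(\<lambda>x. \<Prod>v\<in>C. \<Prod>l<m v. (real k * bary C v x - real l) / (real (m v) - real l)) \<in> poly_fun (\<Sum>v\<in>C. \<Sum>l<m v. 1)"
    by (intro poly_fun_prod factor)
  moreover have "(\<Sum>v\<in>C. \<Sum>l<m v. 1) = k" using m by (simp add: multi_index_def)
  ultimately show ?thesis unfolding shape_fun_def[abs_def] by simp
qed

text \<open>Homogenisation: the degree that a monomial lacks to \<open>k\<close> goes to one extra
  vertex \<open>v0\<close>; the other vertices are matched with the coordinate axes.\<close>

lemma card_monomials_le_multi_index:
  fixes C :: "'a::euclidean_space set"
  assumes "finite C" "card C = Suc DIM('a)"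
  shows "card (monomials k :: ('a \<Rightarrow> nat) set) \<le> card (multi_index k C)"
proof -
  obtain v0 where v0: "v0 \<in> C" using assms(2) by fastforce
  have "card (C - {v0}) = card (Basis :: 'a set)" using assms v0 by simp
  then obtain g where g: "bij_betw g (C - {v0}) (Basis :: 'a set)"
    using assms(1) by (metis finite_Basis finite_Diff finite_same_card_bij)
  define h where "h m = restrict (\<lambda>v. if v = v0 then k - (\<Sum>b\<in>Basis. m b) else m (g v)) C" for m :: "'a \<Rightarrow> nat"
  have gB: "g v \<in> Basis" if "v \<in> C - {v0}" for v using g that by (rule bij_betwE[THEN bspec])
  have sum: "(\<Sum>v\<in>C - {v0}. m (g v)) = (\<Sum>b\<in>Basis. m b)" for m :: "'a \<Rightarrow> nat"
    by (rule sum.reindex_bij_betw[OF g])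
  show ?thesis
  proof (rule card_inj_on_le[of h])
    show "inj_on h (monomials k)"
    proof (rule inj_onI)
      fix m n assume mn: "m \<in> monomials k" "n \<in> monomials k" "h m = h n"
      have "m b = n b" if b: "b \<in> Basis" for b
      proof -
        have "b \<in> g ` (C - {v0})" using bij_betw_imp_surj_on[OF g] b by simp
        then obtain v where v: "v \<in> C - {v0}" "g v = b" by auto
        then show ?thesis using fun_cong[OF mn(3), of v] by (simp add: h_def)
      qed
      then show "m = n" using mn by (auto simp: monomials_def intro: PiE_ext)
    qed
    show "h ` monomials k \<subseteq> multi_index k C"
    proof
      fix n assume "n \<in> h ` monomials k"
      then obtain m where m: "m \<in> monomials k" "n = h m" by blast
      have "sum n C = n v0 + (\<Sum>v\<in>C - {v0}. n v)" using assms v0 by (simp add: sum.remove)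
      also have "(\<Sum>v\<in>C - {v0}. n v) = (\<Sum>b\<in>Basis. m b)"
        unfolding sum[symmetric] m(2) by (rule sum.cong) (auto simp: h_def)
      also have "n v0 + \<dots> = k" using m v0 by (simp add: h_def monomials_def)
      finally have "sum n C = k" .
      moreover have "m b \<le> k" if "b \<in> Basis" for b using m that by (auto simp: monomials_def)
      then have "n \<in> C \<rightarrow>\<^sub>E {..k}" using gB by (auto simp: m(2) h_def)
      ultimately show "n \<in> multi_index k C" by (simp add: multi_index_def)
    qed
    show "finite (multi_index k C)" by (rule finite_multi_index[OF assms(1)])
  qed
qed

text \<open>The shape functions are as many as the monomials and independent, hence they span.\<close>

lemma poly_fun_interpolation:
  fixes C :: "'a::euclidean_space set"
  assumes C: "\<not> affine_dependent C" "card C = Suc DIM('a)" "k > 0" and p: "p \<in> poly_fun k"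
  shows "p x = (\<Sum>m\<in>multi_index k C. p (lattice_point k C m) * shape_fun k C m x)"
proof -
  interpret fs: vector_space "\<lambda>(c::real) (f::'a \<Rightarrow> real) x. c * f x"
    by unfold_locales (auto simp: fun_eq_iff algebra_simps)
  have sum_app: "sum F A x = (\<Sum>i\<in>A. F i x)" for F :: "'i \<Rightarrow> 'a \<Rightarrow> real" and A x
    by (induction A rule: infinite_finite_induct) auto
  have fin: "finite C" using C(1) by (rule aff_independent_finite)
  define M where "M = (\<lambda>m x. \<Prod>b\<in>Basis. (x \<bullet> b) ^ m b :: real) ` (monomials k :: ('a \<Rightarrow> nat) set)"
  define S where "S = shape_fun k C ` multi_index k C"
  have finM: "finite M" "card M \<le> card (multi_index k C)"
    using card_image_le[OF finite_monomials, of "\<lambda>m x. \<Prod>b\<in>Basis. (x \<bullet> b) ^ m b :: real" k]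
      card_monomials_le_multi_index[OF fin C(2), of k] by (auto simp: M_def finite_monomials intro: order_trans)
  have span: "q \<in> fs.span M" if q_poly: "q \<in> poly_fun k" for q
  proof -
    obtain c where q: "q = (\<lambda>x. \<Sum>m\<in>monomials k. c m * (\<Prod>b\<in>Basis. (x \<bullet> b) ^ m b))"
      using q_poly unfolding poly_fun_iff by blast
    have "q = (\<Sum>m\<in>monomials k. (\<lambda>x. c m * (\<Prod>b\<in>Basis. (x \<bullet> b) ^ m b)))"
      by (simp add: q fun_eq_iff sum_app)
    also have "\<dots> \<in> fs.span M" by (intro fs.span_sum fs.span_scale fs.span_base) (auto simp: M_def)
    finally show ?thesis .
  qed
  have inj: "inj_on (shape_fun k C) (multi_index k C)"
  proof (rule inj_onI)
    fix m n assume "m \<in> multi_index k C" "n \<in> multi_index k C" "shape_fun k C m = shape_fun k C n"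
    then show "m = n" using shape_fun_lattice_point[OF C(1,3)] by (metis zero_neq_one)
  qed
  have finS: "finite S" "card S = card (multi_index k C)"
    using finite_multi_index[OF fin] inj by (auto simp: S_def card_image)
  \<comment> \<open>Evaluation at the node of \<open>n\<close> isolates one coefficient. This yields
    both the independence and, at the end, the coefficients of \<open>p\<close>.\<close>
  have eval: "(\<Sum>s\<in>S. c s * s (lattice_point k C n)) = c (shape_fun k C n)" if n: "n \<in> multi_index k C" for c n
  proof -
    have "(\<Sum>s\<in>S. c s * s (lattice_point k C n))
        = (\<Sum>m\<in>multi_index k C. c (shape_fun k C m) * shape_fun k C m (lattice_point k C n))"
      unfolding S_def using inj by (simp add: sum.reindex)
    also have "\<dots> = (\<Sum>m\<in>multi_index k C. c (shape_fun k C m) * (if n = m then 1 else 0))"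
      using shape_fun_lattice_point[OF C(1,3) _ n] by (intro sum.cong) auto
    also have "\<dots> = c (shape_fun k C n)"
      using n finite_multi_index[OF fin, of k] by (simp add: if_distrib sum.delta cong: if_cong)
    finally show ?thesis .
  qed
  have indep: "fs.independent S"
  proof (rule fs.independent_if_scalars_zero[OF finS(1)])
    fix c s assume 0: "(\<Sum>x\<in>S. (\<lambda>y. c x * x y)) = 0" and "s \<in> S"
    then obtain n where n: "n \<in> multi_index k C" "s = shape_fun k C n" by (auto simp: S_def)
    show "c s = 0" using fun_cong[OF 0, of "lattice_point k C n"] eval[OF n(1), of c] n(2)
      by (simp add: sum_app)
  qed
  \<comment> \<open>Otherwise \<open>p\<close> and the shape functions would form an independent set
    in the span of the monomials with more members than there are monomials.\<close>
  have "p \<in> fs.span S"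
  proof (rule ccontr)
    assume notin: "p \<notin> fs.span S"
    then have "fs.independent (insert p S)" using indep by (simp add: fs.independent_insert)
    moreover have "insert p S \<subseteq> fs.span M"
      using span p shape_fun_poly[OF C(1)] by (auto simp: S_def)
    ultimately have "card (insert p S) \<le> card M" using fs.independent_span_bound[OF finM(1)] by blast
    moreover have "p \<notin> S" using notin fs.span_base by blast
    ultimately show False using finS finM by simp
  qed
  then obtain c where pc: "p = (\<Sum>s\<in>S. (\<lambda>x. c s * s x))"
    using fs.span_finite[OF finS(1)] by auto
  have "p (lattice_point k C m) = c (shape_fun k C m)" if "m \<in> multi_index k C" for m
    using eval[OF that, of c] by (simp add: pc sum_app)
  then have "(\<Sum>m\<in>multi_index k C. p (lattice_point k C m) * shape_fun k C m x)
      = (\<Sum>m\<in>multi_index k C. c (shape_fun k C m) * shape_fun k C m x)" by simp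
  also have "\<dots> = (\<Sum>s\<in>S. c s * s x)" unfolding S_def using inj by (simp add: sum.reindex)
  also have "\<dots> = p x" by (simp add: pc sum_app)
  finally show ?thesis by simp
qed

text \<open>Once \<open>real k ^ k\<close> is taken out, \<open>k\<close> factors of absolute value
  at most 1 remain on the simplex, and the difference of two such products is at most the sum of the
  differences of the factors.\<close>

lemma shape_fun_lipschitz:
  assumes C: "\<not> affine_dependent C" "k > 0" and m: "m \<in> multi_index k C" and r: "0 < r" "cball z r \<subseteq> convex hull C"
    and x: "x \<in> convex hull C"
    and y: "y \<in> convex hull C"
  shows "\<bar>shape_fun k C m x - shape_fun k C m y\<bar> \<le> real k ^ k * (real k * (dist x y / (2 * r)))"
proof -
  have fin: "finite C" using C(1) by (rule aff_independent_finite)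
  define I where "I = Sigma C (\<lambda>v. {..<m v})"
  define f where "f x = (\<lambda>(v, l). (bary C v x - real l / real k) / (real (m v) - real l))" for x
  have cardI: "card I = k" "finite I" using fin m by (auto simp: I_def multi_index_def)
  have "shape_fun k C m x = (\<Prod>(v, l)\<in>I. (real k * bary C v x - real l) / (real (m v) - real l))" for x
    unfolding shape_fun_def I_def using fin by (subst prod.Sigma) auto
  also have "\<dots> x = (\<Prod>i\<in>I. real k * f x i)" for x
    using C(2) by (intro prod.cong) (auto simp: f_def right_diff_distrib)
  finally have eq: "shape_fun k C m x = real k ^ k * (\<Prod>i\<in>I. f x i)" for x
    using cardI by (simp add: prod.distrib)
  have f1: "\<bar>f x i\<bar> \<le> 1" if x: "x \<in> convex hull C" and i: "i \<in> I" for x i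
  proof -
    obtain v l where vl: "i = (v, l)" "v \<in> C" "l < m v" using i by (auto simp: I_def)
    have "m v \<le> k" using m vl by (auto simp: multi_index_def)
    then have "real l / real k \<le> 1" "0 \<le> real l / real k" using vl C(2) by auto
    then have "\<bar>bary C v x - real l / real k\<bar> \<le> 1"
      using bary_nonneg[OF C(1) x vl(2)] bary_le_1[OF C(1) x vl(2)] by linarith
    moreover have "1 \<le> real (m v) - real l" using vl by linarith
    ultimately show ?thesis by (simp add: f_def vl)
  qed
  have "\<bar>(\<Prod>i\<in>I. f x i) - (\<Prod>i\<in>I. f y i)\<bar> \<le> (\<Sum>i\<in>I. \<bar>f x i - f y i\<bar>)"
    using norm_prod_diff[of I "f x" "f y"] f1[OF x] f1[OF y] by simp
  also have "\<dots> \<le> (\<Sum>i\<in>I. dist x y / (2 * r))"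
  proof (rule sum_mono)
    fix i assume "i \<in> I"
    then obtain v l where vl: "i = (v, l)" "v \<in> C" "l < m v" by (auto simp: I_def)
    have "1 \<le> real (m v) - real l" using vl by linarith
    moreover have "f x i - f y i = (bary C v x - bary C v y) / (real (m v) - real l)"
      by (simp add: f_def vl diff_divide_distrib)
    ultimately have "\<bar>f x i - f y i\<bar> \<le> \<bar>bary C v x - bary C v y\<bar>"
      by (simp add: abs_divide divide_le_eq mult_le_cancel_left1)
    also have "\<dots> \<le> dist x y / (2 * r)" by (rule bary_lipschitz[OF C(1) vl(2) r])
    finally show "\<bar>f x i - f y i\<bar> \<le> dist x y / (2 * r)" .
  qed
  also have "\<dots> = real k * (dist x y / (2 * r))" using cardI by simp
  finally have le: "\<bar>(\<Prod>i\<in>I. f x i) - (\<Prod>i\<in>I. f y i)\<bar> \<le> real k * (dist x y / (2 * r))" .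
  show "\<bar>shape_fun k C m x - shape_fun k C m y\<bar> \<le> real k ^ k * (real k * (dist x y / (2 * r)))"
    using mult_left_mono[OF le, of "real k ^ k"]
    by (simp only: eq abs_mult zero_le_power of_nat_0_le_iff abs_of_nonneg flip: right_diff_distrib)
qed

section \<open>Estimates on a single element\<close>

text \<open>At a boundary point uniqueness is not automatic. One-sided derivatives along segments
  fix the derivative on all \<open>y - x\<close> with \<open>y \<in> T\<close>, and these vectors
  span the space because \<open>T\<close> has an interior point.\<close>

lemma has_derivative_unique_within_convex:
  fixes f :: "'a::euclidean_space \<Rightarrow> real"
  assumes T: "convex T" "x \<in> T" and z: "z \<in> interior T"
    and f': "(f has_derivative f') (at x within T)" and f'': "(f has_derivative f'') (at x within T)"
  shows "f' = f''"
proof -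
  have lin: "linear f'" "linear f''" using f' f'' has_derivative_linear by blast+
  have eq: "f' (y - x) = f'' (y - x)" if y: "y \<in> T" for y
  proof -
    define w where "w t = x + t *\<^sub>R (y - x)" for t
    have w: "(w has_derivative (\<lambda>h. h *\<^sub>R (y - x))) (at 0 within {0..1})"
      unfolding w_def by (auto intro!: derivative_eq_intros)
    have sub: "w ` {0..1} \<subseteq> T"
    proof (clarify)
      fix t :: real assume "t \<in> {0..1}"
      then have "(1 - t) *\<^sub>R x + t *\<^sub>R y \<in> T" using T y by (intro convexD) auto
      then show "w t \<in> T" by (simp add: w_def algebra_simps)
    qed
    have comp: "((\<lambda>t. f (w t)) has_vector_derivative g (y - x)) (at 0 within {0..1})"
      if "(f has_derivative g) (at x within T)" "linear g" for g
    proof -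
      have "(f has_derivative g) (at (w 0) within w ` {0..1})"
        using has_derivative_subset[OF that(1) sub] by (simp add: w_def)
      from has_derivative_in_compose[OF w this]
      have "((\<lambda>t. f (w t)) has_derivative (\<lambda>h. g (h *\<^sub>R (y - x)))) (at 0 within {0..1})" .
      then show ?thesis using that(2) by (simp add: has_vector_derivative_def linear_scale)
    qed
    show ?thesis
      by (rule vector_derivative_unique_within[OF _ comp[OF f' lin(1)] comp[OF f'' lin(2)]])
        (simp add: trivial_limit_within islimpt_Icc)
  qed
  obtain e where e: "e > 0" "ball z e \<subseteq> T" using z by (meson mem_interior)
  show ?thesis
  proof
    fix v :: 'a
    \<comment> \<open>Scales \<open>v\<close> such that \<open>z + c *\<^sub>R v\<close> stays in
      \<open>T\<close>; then \<open>c *\<^sub>R v\<close> is the difference of two vectors of the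
      form \<open>y - x\<close>.\<close>
    define c where "c = e / (2 * (norm v + 1))"
    have c: "c > 0" unfolding c_def using e(1) by (intro divide_pos_pos) (auto simp: add_nonneg_pos)
    have "c * norm v < e"
    proof -
      have "c * norm v \<le> c * (norm v + 1)" using c by simp
      also have "\<dots> = e / 2" using norm_ge_zero[of v] by (simp add: c_def field_simps add_nonneg_eq_0_iff)
      finally show ?thesis using e(1) by linarith
    qed
    then have "z + c *\<^sub>R v \<in> T" using e(2) c by (auto simp: dist_norm)
    moreover have "z \<in> T" using z interior_subset by blast
    ultimately have "f' ((z + c *\<^sub>R v - x) - (z - x)) = f'' ((z + c *\<^sub>R v - x) - (z - x))"
      using eq by (simp only: linear_diff[OF lin(1)] linear_diff[OF lin(2)])
    then have "c * f' v = c * f'' v" using lin by (simp add: linear_scale)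
    then show "f' v = f'' v" using c by simp
  qed
qed

text \<open>Replaces the gradient within \<open>T\<close>, which rests on a choice operator, by one
  that is linear in the function.\<close>

lemma grad_eq_grad_poly:
  assumes T: "convex T" "x \<in> T" "z \<in> interior T" and p: "p \<in> poly_fun k" and eq: "\<And>y. y \<in> T \<Longrightarrow> f y = p y"
  shows "grad T f x = grad UNIV p x"
proof -
  have "(p has_derivative (\<lambda>h. grad UNIV p x \<bullet> h)) (at x within T)"
    using poly_fun_has_derivative[OF p] has_derivative_at_withinI by blast
  then have 1: "(f has_derivative (\<lambda>h. grad UNIV p x \<bullet> h)) (at x within T)"
    using T(2) eq by (metis has_derivative_transform)
  then have "(f has_derivative frechet_derivative f (at x within T)) (at x within T)"
    by (meson differentiable_def frechet_derivative_works)
  then have "frechet_derivative f (at x within T) = (\<lambda>h. grad UNIV p x \<bullet> h)"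
    using has_derivative_unique_within_convex[OF T] 1 by blast
  then show ?thesis by (simp add: grad_def[of T] euclidean_representation)
qed

section \<open>Dirichlet energy of polynomials\<close>

definition dirichlet :: "'a::euclidean_space set \<Rightarrow> ('a \<Rightarrow> real) \<Rightarrow> real" where
  "dirichlet T p = (LINT x:T|lborel. (norm (grad UNIV p x))\<^sup>2)"

lemma dirichlet_integrable:
  assumes "compact T" "p \<in> poly_fun k"
  shows "set_integrable lborel T (\<lambda>x. (norm (grad UNIV p x))\<^sup>2)"
  unfolding set_integrable_def
  by (intro borel_integrable_compact assms(1) continuous_intros grad_poly_fun_continuous_on[OF assms(2)])

lemma dirichlet_nonneg: "0 \<le> dirichlet T p"
  unfolding dirichlet_def set_lebesgue_integral_def by (intro integral_nonneg_AE AE_I2) simp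

lemma grad_poly_fun_lincomb:
  assumes p: "p \<in> poly_fun k" and q: "q \<in> poly_fun k"
  shows "grad UNIV (\<lambda>x. a * p x + b * q x) x = a *\<^sub>R grad UNIV p x + b *\<^sub>R grad UNIV q x"
proof -
  have "((\<lambda>x. a * p x + b * q x) has_derivative (\<lambda>h. (a *\<^sub>R grad UNIV p x + b *\<^sub>R grad UNIV q x) \<bullet> h)) (at x)"
    unfolding inner_add_left inner_scaleR_left
    by (intro has_derivative_add has_derivative_mult_right poly_fun_has_derivative[OF p] poly_fun_has_derivative[OF q])
  then have "frechet_derivative (\<lambda>x. a * p x + b * q x) (at x) = (\<lambda>h. (a *\<^sub>R grad UNIV p x + b *\<^sub>R grad UNIV q x) \<bullet> h)"
    using frechet_derivative_at by metis
  then show ?thesis by (simp add: grad_def[of UNIV "\<lambda>x. a * p x + b * q x"] euclidean_representation)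
qed

lemma norm_add_sq_le: "(norm (u + v))\<^sup>2 \<le> 2 * (norm u)\<^sup>2 + 2 * (norm v)\<^sup>2" for u v :: "'a::real_inner"
proof -
  have "0 \<le> (norm (u - v))\<^sup>2" by simp
  then show ?thesis by (simp add: power2_norm_eq_inner inner_add_left inner_add_right inner_diff_left inner_diff_right inner_commute)
qed

lemma
  assumes T: "compact T" and p: "p \<in> poly_fun k" and q: "q \<in> poly_fun k"
  shows dirichlet_add_le: "dirichlet T (\<lambda>x. p x + q x) \<le> 2 * dirichlet T p + 2 * dirichlet T q"
    and dirichlet_diff_le: "dirichlet T (\<lambda>x. p x - q x) \<le> 2 * dirichlet T p + 2 * dirichlet T q"
proof -
  have main: "dirichlet T (\<lambda>x. 1 * p x + b * q x) \<le> 2 * dirichlet T p + 2 * dirichlet T q" if b: "b = 1 \<or> b = -1" for b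
  proof -
    have pq: "(\<lambda>x. 1 * p x + b * q x) \<in> poly_fun k" by (intro poly_fun_add poly_fun_cmult p q)
    have "dirichlet T (\<lambda>x. 1 * p x + b * q x) \<le> (LINT x:T|lborel. 2 * (norm (grad UNIV p x))\<^sup>2 + 2 * (norm (grad UNIV q x))\<^sup>2)"
      unfolding dirichlet_def
    proof (rule set_integral_mono)
      show "set_integrable lborel T (\<lambda>x. (norm (grad UNIV (\<lambda>x. 1 * p x + b * q x) x))\<^sup>2)"
        by (rule dirichlet_integrable[OF T pq])
      show "set_integrable lborel T (\<lambda>x. 2 * (norm (grad UNIV p x))\<^sup>2 + 2 * (norm (grad UNIV q x))\<^sup>2)"
        by (intro set_integral_add set_integrable_mult_right dirichlet_integrable[OF T p] dirichlet_integrable[OF T q])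
      show "(norm (grad UNIV (\<lambda>x. 1 * p x + b * q x) x))\<^sup>2 \<le> 2 * (norm (grad UNIV p x))\<^sup>2 + 2 * (norm (grad UNIV q x))\<^sup>2" for x
        unfolding grad_poly_fun_lincomb[OF p q]
        using norm_add_sq_le[of "grad UNIV p x" "b *\<^sub>R grad UNIV q x"] b by auto
    qed
    also have "\<dots> = 2 * dirichlet T p + 2 * dirichlet T q"
      unfolding dirichlet_def
      using set_integrable_mult_right[of 2, OF dirichlet_integrable[OF T p]] set_integrable_mult_right[of 2, OF dirichlet_integrable[OF T q]]
      by (simp add: set_integral_add)
    finally show ?thesis .
  qed
  show "dirichlet T (\<lambda>x. p x + q x) \<le> 2 * dirichlet T p + 2 * dirichlet T q" using main[of 1] by simp
  show "dirichlet T (\<lambda>x. p x - q x) \<le> 2 * dirichlet T p + 2 * dirichlet T q" using main[of "-1"] by simp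
qed

text \<open>The first factor bounds the number of shape functions, the second one their Lipschitz
  constants up to \<open>1 / (2 * r)\<close>.\<close>

definition shape_const :: "nat \<Rightarrow> 'a::euclidean_space itself \<Rightarrow> real" where
  "shape_const k _ = real (Suc k) ^ Suc DIM('a) * (real k ^ k * real k)"

lemma shape_const_ge_1:
  assumes "k > 0" shows "1 \<le> shape_const k TYPE('a::euclidean_space)"
proof -
  have "1 \<le> real (Suc k) ^ Suc DIM('a)" by (rule one_le_power) simp
  moreover have "1 \<le> real k ^ k * real k"
    using assms mult_mono[of 1 "real k ^ k" 1 "real k"] by (simp add: one_le_power)
  ultimately show ?thesis
    unfolding shape_const_def using mult_mono[of 1 "real (Suc k) ^ Suc DIM('a)" 1 "real k ^ k * real k"] by simp
qed

text \<open>The constant of \<open>poly_sup_le_L2\<close>, once for each partial derivative.\<close>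

definition diff_const :: "nat \<Rightarrow> real \<Rightarrow> 'a::euclidean_space itself \<Rightarrow> real" where
  "diff_const k \<sigma> _ = real DIM('a) * (4 / unit_ball_vol (real DIM('a)) * (2 * shape_const k TYPE('a) * \<sigma>\<^sup>2) ^ DIM('a))"

section \<open>Inverse estimates on a shape regular simplex\<close>

locale regular_simplex =
  fixes C T :: "'a::euclidean_space set" and z :: 'a and r \<sigma> :: real
  assumes aff_indep: "\<not> affine_dependent C" and card_C: "card C = Suc DIM('a)"
    and T_def: "T = convex hull C" and r_pos: "0 < r" and inner_ball: "cball z r \<subseteq> T"
    and diam_le: "diameter T \<le> \<sigma> * r"
begin

lemma finite_C: "finite C" using aff_indep by (rule aff_independent_finite)
lemma compact_T: "compact T" unfolding T_def using finite_C by (rule finite_imp_compact_convex_hull)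
lemma convex_T: "convex T" by (simp add: T_def)
lemma z_in: "z \<in> T" using inner_ball r_pos by auto
lemma z_interior: "z \<in> interior T"
  using inner_ball r_pos by (meson ball_subset_cball centre_in_ball interior_maximal open_ball subset_iff order_trans)

lemma dist_le_diam: "x \<in> T \<Longrightarrow> y \<in> T \<Longrightarrow> dist x y \<le> diameter T"
  using diameter_bounded_bound compact_imp_bounded[OF compact_T] by blast

lemma r_le_diam: "r \<le> diameter T"
proof -
  obtain b :: 'a where b: "b \<in> Basis" using nonempty_Basis by blast
  then have "z + r *\<^sub>R b \<in> cball z r" using r_pos by (simp add: dist_norm)
  then have "dist z (z + r *\<^sub>R b) \<le> diameter T" using inner_ball z_in by (intro dist_le_diam) auto
  then show ?thesis using b r_pos by (simp add: dist_norm)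
qed

lemma diam_pos: "0 < diameter T" using r_le_diam r_pos by linarith

lemma sigma_ge_1: "1 \<le> \<sigma>"
  using r_le_diam diam_le r_pos by (smt (verit) mult_le_cancel_right1 mult_right_less_imp_less)

lemma r_ge: "diameter T / \<sigma> \<le> r"
  using diam_le sigma_ge_1 by (simp add: divide_le_eq mult.commute)

lemma diam_power: "DIM('a) \<ge> 2 \<Longrightarrow> diameter T ^ DIM('a) = (diameter T)\<^sup>2 * diameter T ^ (DIM('a) - 2)"
  by (metis le_add_diff_inverse power_add)

text \<open>The inverse inequality in nodal form: interpolation expresses \<open>p\<close> by its
  nodal values, and each shape function has a Lipschitz constant of order
  \<open>1 / r\<close>.\<close>

lemma poly_lipschitz:
  assumes k: "k > 0" and p: "p \<in> poly_fun k" and M: "\<And>x. x \<in> lattice_nodes k T \<Longrightarrow> \<bar>p x\<bar> \<le> M"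
    and x: "x \<in> T" and y: "y \<in> T"
  shows "\<bar>p x - p y\<bar> \<le> shape_const k TYPE('a) * M / r * dist x y"
proof -
  let ?I = "multi_index k C" and ?B = "real k ^ k * (real k * (dist x y / (2 * r)))"
  have M': "\<bar>p (lattice_point k C m)\<bar> \<le> M" if "m \<in> ?I" for m
    using M that lattice_nodes_eq[OF aff_indep k] by (simp add: T_def)
  have xy: "x \<in> convex hull C" "y \<in> convex hull C" using x y T_def by auto
  have "\<bar>p x - p y\<bar> = \<bar>\<Sum>m\<in>?I. p (lattice_point k C m) * (shape_fun k C m x - shape_fun k C m y)\<bar>"
    using poly_fun_interpolation[OF aff_indep card_C k p, of x] poly_fun_interpolation[OF aff_indep card_C k p, of y]
    by (simp add: right_diff_distrib sum_subtractf)
  also have "\<dots> \<le> (\<Sum>m\<in>?I. M * ?B)"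
  proof (rule order_trans[OF sum_abs sum_mono])
    fix m assume m: "m \<in> ?I"
    show "\<bar>p (lattice_point k C m) * (shape_fun k C m x - shape_fun k C m y)\<bar> \<le> M * ?B"
      unfolding abs_mult using M'[OF m]
      by (intro mult_mono shape_fun_lipschitz[OF aff_indep k m r_pos inner_ball[unfolded T_def] xy])
        (auto intro: order_trans[OF abs_ge_zero])
  qed
  also have "\<dots> = real (card ?I) * (M * ?B)" by simp
  also have "\<dots> \<le> real (Suc k ^ Suc DIM('a)) * (M * ?B)"
  proof (rule mult_right_mono)
    show "real (card ?I) \<le> real (Suc k ^ Suc DIM('a))"
      using card_multi_index_le[OF finite_C, of k] card_C by (simp only: of_nat_le_iff)
    \<comment> \<open>The node at a vertex exists, so \<open>M\<close> bounds an absolute value and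
      is nonnegative.\<close>
    have "lattice_nodes k T \<noteq> {}"
    proof -
      obtain v where v: "v \<in> C" using card_C by fastforce
      have "(\<lambda>w\<in>C. if w = v then k else 0) \<in> ?I" using v finite_C by (auto simp: multi_index_def)
      then show ?thesis unfolding T_def lattice_nodes_eq[OF aff_indep k] by blast
    qed
    then have "0 \<le> M" using M by (meson abs_ge_zero ex_in_conv order_trans)
    then show "0 \<le> M * ?B" using r_pos by simp
  qed
  also have "\<dots> = (shape_const k TYPE('a) * M / r * dist x y) / 2"
    using r_pos by (simp add: shape_const_def field_simps)
  \<comment> \<open>The factor 1/2 is dropped for a simpler constant; nonnegativity of the
    right-hand side follows from the chain so far.\<close>
  also have "\<dots> \<le> shape_const k TYPE('a) * M / r * dist x y"
  proof -
    have "0 \<le> \<bar>p x - p y\<bar>" by simp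
    then show ?thesis using calculation by linarith
  qed
  finally show ?thesis .
qed

text \<open>At interior points, difference quotients in the direction of the gradient tend to its
  squared norm. Boundary points follow since the bound is a closed condition and \<open>T\<close> is
  the closure of its interior.\<close>

lemma grad_le_lipschitz:
  assumes p: "p \<in> poly_fun k" and lip: "\<And>x y. x \<in> T \<Longrightarrow> y \<in> T \<Longrightarrow> \<bar>p x - p y\<bar> \<le> K * dist x y" and x: "x \<in> T"
  shows "norm (grad UNIV p x) \<le> K"
proof -
  have int: "norm (grad UNIV p x) \<le> K" if x: "x \<in> interior T" for x
  proof (cases "grad UNIV p x = 0")
    case True
    \<comment> \<open>For a vanishing gradient the claim is \<open>0 \<le> K\<close>, which any two
      distinct points of \<open>T\<close> provide.\<close>
    have "\<bar>p (z + r *\<^sub>R (SOME b. b \<in> Basis)) - p z\<bar> \<le> K * r"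
      using lip[of "z + r *\<^sub>R (SOME b. b \<in> Basis)" z] inner_ball r_pos z_in someI_ex[of "\<lambda>b::'a. b \<in> Basis"] nonempty_Basis
      by (auto simp: dist_norm subset_iff)
    then have "0 \<le> K * r" by (meson abs_ge_zero order_trans)
    then show ?thesis using True r_pos by (simp add: zero_le_mult_iff)
  next
    case False
    define g where "g = grad UNIV p x"
    have g: "norm g > 0" using False by (simp add: g_def)
    obtain e where e: "e > 0" "ball x e \<subseteq> T" using x by (meson mem_interior)
    have "((\<lambda>t. p (x + t *\<^sub>R g)) has_derivative (\<lambda>h. grad UNIV p (x + 0 *\<^sub>R g) \<bullet> (h *\<^sub>R g))) (at (0::real))"
      by (rule has_derivative_compose[of "\<lambda>t. x + t *\<^sub>R g", OF _ poly_fun_has_derivative[OF p]])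
        (auto intro!: derivative_eq_intros)
    then have D: "((\<lambda>t. p (x + t *\<^sub>R g)) has_real_derivative g \<bullet> g) (at 0)"
      by (intro has_derivative_imp_has_field_derivative[rotated]) (auto simp: g_def)
    have lim: "((\<lambda>t. \<bar>(p (x + t *\<^sub>R g) - p x) / t\<bar>) \<longlongrightarrow> \<bar>g \<bullet> g\<bar>) (at 0)"
      using tendsto_rabs[OF D[unfolded DERIV_def]] by simp
    have "eventually (\<lambda>t. \<bar>(p (x + t *\<^sub>R g) - p x) / t\<bar> \<le> K * norm g) (at 0)"
      unfolding eventually_at
    proof (intro exI[of _ "e / norm g"] conjI ballI impI)
      fix t :: real assume t: "t \<noteq> 0 \<and> dist t 0 < e / norm g"
      then have "\<bar>t\<bar> * norm g < e" using g by (simp add: field_simps)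
      then have "x + t *\<^sub>R g \<in> T" using e(2) by (auto simp: dist_norm)
      then have "\<bar>p (x + t *\<^sub>R g) - p x\<bar> \<le> K * (\<bar>t\<bar> * norm g)"
        using lip[of "x + t *\<^sub>R g" x] x interior_subset by (force simp: dist_norm)
      then show "\<bar>(p (x + t *\<^sub>R g) - p x) / t\<bar> \<le> K * norm g"
        using t by (simp add: abs_divide divide_le_eq mult_ac)
    qed (use e g in auto)
    then have "\<bar>g \<bullet> g\<bar> \<le> K * norm g" by (intro tendsto_upperbound[OF lim]) auto
    then have "norm g * norm g \<le> K * norm g" by (simp add: dot_square_norm power2_eq_square)
    then show ?thesis using g by (simp add: g_def)
  qed
  have "closed {x. norm (grad UNIV p x) \<le> K}"
    by (intro closed_Collect_le continuous_intros grad_poly_fun_continuous_on[OF p])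
  moreover have "closure (interior T) = T"
    using convex_closure_interior[OF convex_T] z_interior compact_T by (metis closure_closed compact_imp_closed empty_iff)
  ultimately show ?thesis
    using int x closure_minimal[of "interior T" "{x. norm (grad UNIV p x) \<le> K}"] by blast
qed

text \<open>The homothety with centre \<open>x\<close> and ratio \<open>t\<close> maps
  \<open>T\<close> into itself by convexity. So every point of \<open>T\<close>, even a vertex, is
  close to a ball in \<open>T\<close> of comparable size.\<close>

lemma homothetic_ball:
  assumes x: "x \<in> T" and t: "0 < t" "t \<le> 1" and y: "y \<in> cball (x + t *\<^sub>R (z - x)) (t * r)"
  shows "y \<in> T" "dist x y \<le> t * diameter T"
proof -
  define w where "w = x + (1 / t) *\<^sub>R (y - x)"
  have yw: "y = (1 - t) *\<^sub>R x + t *\<^sub>R w" using t by (simp add: w_def algebra_simps)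
  have "z - w = (1 / t) *\<^sub>R ((x + t *\<^sub>R (z - x)) - y)" using t by (simp add: w_def algebra_simps)
  then have "norm (z - w) = norm ((x + t *\<^sub>R (z - x)) - y) / t" using t by simp
  also have "\<dots> \<le> r" using y t by (simp add: dist_norm divide_le_eq mult.commute)
  finally have w: "w \<in> T" using inner_ball by (auto simp: dist_norm)
  then show "y \<in> T" unfolding yw using x t by (intro convexD[OF convex_T]) auto
  have "y - x = t *\<^sub>R (w - x)" unfolding yw by (simp add: algebra_simps)
  then have "norm (y - x) = t * norm (w - x)" using t by simp
  then have "dist x y = t * dist x w" by (simp add: dist_norm norm_minus_commute)
  also have "\<dots> \<le> t * diameter T" using t x w by (intro mult_left_mono dist_le_diam) auto
  finally show "dist x y \<le> t * diameter T" .
qed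

text \<open>Near a maximum point of the absolute value of \<open>p\<close> the Lipschitz bound
  preserves half the maximum on a ball of radius comparable to \<open>diameter T\<close>.\<close>

lemma poly_sup_le_L2:
  assumes k: "k > 0" and p: "p \<in> poly_fun k" and x: "x \<in> T"
  shows "(p x)\<^sup>2 * diameter T ^ DIM('a)
     \<le> 4 / unit_ball_vol (real DIM('a)) * (2 * shape_const k TYPE('a) * \<sigma>\<^sup>2) ^ DIM('a) * (LINT x:T|lborel. (p x)\<^sup>2)"
proof -
  let ?A = "shape_const k TYPE('a)" and ?h = "diameter T" and ?d = "DIM('a)"
  let ?u = "unit_ball_vol (real ?d)"
  have A: "1 \<le> ?A" by (rule shape_const_ge_1[OF k])
  have "continuous_on T (\<lambda>x. \<bar>p x\<bar>)" by (intro continuous_intros poly_fun_continuous_on[OF p])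
  then obtain x1 where x1: "x1 \<in> T" "\<And>y. y \<in> T \<Longrightarrow> \<bar>p y\<bar> \<le> \<bar>p x1\<bar>"
    using continuous_attains_sup[OF compact_T] z_in by (metis empty_iff)
  define M where "M = \<bar>p x1\<bar>"
  have nodes: "lattice_nodes k T \<subseteq> T"
    unfolding T_def lattice_nodes_eq[OF aff_indep k] using lattice_point_in_hull[OF finite_C k] by blast
  have lip: "\<bar>p x - p y\<bar> \<le> ?A * M / r * dist x y" if "x \<in> T" "y \<in> T" for x y
    by (rule poly_lipschitz[OF k p _ that]) (use nodes x1 in \<open>auto simp: M_def\<close>)
  \<comment> \<open>Within distance \<open>s\<close> of \<open>x1\<close> the Lipschitz bound costs
    at most \<open>M / 2\<close>; the ratio \<open>t\<close> places the contracted ball within that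
    distance.\<close>
  define s where "s = r / (2 * ?A)"
  define t where "t = s / ?h"
  have t: "0 < t" "t \<le> 1" "t * ?h = r / (2 * ?A)"
  proof -
    have "s \<le> r / 1" unfolding s_def using A r_pos by (intro divide_left_mono) auto
    then have "s \<le> ?h" using r_le_diam by simp
    then show "t \<le> 1" using diam_pos by (simp add: t_def divide_le_eq)
    show "0 < t" "t * ?h = r / (2 * ?A)" using A r_pos diam_pos by (simp_all add: t_def s_def)
  qed
  define B where "B = cball (x1 + t *\<^sub>R (z - x1)) (t * r)"
  have B: "y \<in> T \<and> \<bar>p y\<bar> \<ge> M / 2" if y: "y \<in> B" for y
  proof -
    have yT: "y \<in> T" and "dist x1 y \<le> r / (2 * ?A)"
      using homothetic_ball[OF x1(1) t(1,2), of y] y t(3) by (auto simp: B_def)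
    then have "?A * M / r * dist x1 y \<le> ?A * M / r * (r / (2 * ?A))"
      using A r_pos by (intro mult_left_mono) (auto simp: M_def)
    also have "\<dots> = M / 2" using A r_pos by simp
    finally have "\<bar>p x1 - p y\<bar> \<le> M / 2" using lip[OF x1(1) yT] by linarith
    then show ?thesis using yT abs_triangle_ineq2[of "p x1" "p y"] by (auto simp: M_def)
  qed
  have int: "set_integrable lborel T (\<lambda>x. (p x)\<^sup>2)"
    unfolding set_integrable_def
    by (intro borel_integrable_compact compact_T continuous_intros poly_fun_continuous_on[OF p])
  have "(M / 2)\<^sup>2 * measure lborel B = (LINT x:B|lborel. (M / 2)\<^sup>2)"
    unfolding B_def by (simp add: set_lebesgue_integral_def emeasure_cball mult.commute)
  also have "\<dots> \<le> (LINT x:T|lborel. (p x)\<^sup>2)"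
    unfolding set_lebesgue_integral_def
  proof (rule integral_mono)
    show "integrable lborel (\<lambda>x. indicator B x *\<^sub>R (M / 2)\<^sup>2)"
      unfolding B_def by (intro integrable_scaleR_left integrable_real_indicator) (auto simp: emeasure_compact_finite[OF compact_cball, simplified])
    show "integrable lborel (\<lambda>x. indicator T x *\<^sub>R (p x)\<^sup>2)" using int by (simp add: set_integrable_def)
    show "indicator B x *\<^sub>R (M / 2)\<^sup>2 \<le> indicator T x *\<^sub>R (p x)\<^sup>2" for x
    proof (cases "x \<in> B")
      case True
      have "(M / 2)\<^sup>2 \<le> \<bar>p x\<bar>\<^sup>2" using B[OF True] by (intro power_mono) (auto simp: M_def)
      then show ?thesis using True B by simp
    qed simp
  qed
  finally have 1: "(M / 2)\<^sup>2 * measure lborel B \<le> (LINT x:T|lborel. (p x)\<^sup>2)" .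
  have mB: "measure lborel B = ?u * (t * r) ^ ?d"
    unfolding B_def using t r_pos by (simp add: content_cball)
  \<comment> \<open>The square of \<open>\<sigma>\<close> appears because the ratio \<open>t\<close>
    and the radius \<open>r\<close> each lose one factor \<open>\<sigma>\<close> against
    \<open>?h\<close>.\<close>
  have "?h \<le> 2 * ?A * \<sigma>\<^sup>2 * (t * r)"
  proof -
    have "?h * ?h \<le> (\<sigma> * r) * (\<sigma> * r)" using diam_le diam_pos by (intro mult_mono) auto
    also have "\<dots> = 2 * ?A * \<sigma>\<^sup>2 * (t * r) * ?h"
      using t(3) A by (simp add: power2_eq_square field_simps)
    finally show ?thesis using diam_pos by simp
  qed
  then have hd: "?h ^ ?d \<le> (2 * ?A * \<sigma>\<^sup>2) ^ ?d * (t * r) ^ ?d"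
    using diam_pos by (subst power_mult_distrib[symmetric]) (intro power_mono, auto)
  have "(p x)\<^sup>2 \<le> M\<^sup>2" using x1(2)[OF x] by (simp add: M_def abs_le_square_iff)
  then have "(p x)\<^sup>2 * ?h ^ ?d \<le> M\<^sup>2 * ((2 * ?A * \<sigma>\<^sup>2) ^ ?d * (t * r) ^ ?d)"
    using hd diam_pos by (intro mult_mono) auto
  also have "\<dots> = 4 / ?u * (2 * ?A * \<sigma>\<^sup>2) ^ ?d * ((M / 2)\<^sup>2 * (?u * (t * r) ^ ?d))"
  proof -
    have "?u > 0" by (rule unit_ball_vol_pos) simp
    then have "?u \<noteq> 0" by linarith
    then show ?thesis by (simp add: power2_eq_square field_simps)
  qed
  also have "\<dots> \<le> 4 / ?u * (2 * ?A * \<sigma>\<^sup>2) ^ ?d * (LINT x:T|lborel. (p x)\<^sup>2)"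
    using 1 A mB by (intro mult_left_mono) auto
  finally show ?thesis .
qed

text \<open>Partial derivatives are polynomials, so the sup estimate applies to them, and the mean
  value inequality passes to differences. The power of the diameter makes both sides scale
  alike.\<close>

lemma poly_diff_le_dirichlet:
  assumes d: "DIM('a) \<ge> 2" and k: "k > 0" and p: "p \<in> poly_fun k" and x: "x \<in> T" and y: "y \<in> T"
  shows "(p x - p y)\<^sup>2 * diameter T ^ (DIM('a) - 2)
     \<le> diff_const k \<sigma> TYPE('a) * dirichlet T p"
proof -
  let ?h = "diameter T" and ?d = "DIM('a)"
  define K where "K = 4 / unit_ball_vol (real ?d) * (2 * shape_const k TYPE('a) * \<sigma>\<^sup>2) ^ ?d"
  have K: "0 \<le> K" using shape_const_ge_1[OF k, where 'a = 'a] by (simp add: K_def)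
  define G where "G = real ?d * K * dirichlet T p / ?h ^ ?d"
  have G0: "0 \<le> G" using K dirichlet_nonneg[of T p] diam_pos by (simp add: G_def)
  have grad: "(norm (grad UNIV p w))\<^sup>2 \<le> G" if w: "w \<in> T" for w
  proof -
    have "(grad UNIV p w \<bullet> b)\<^sup>2 * ?h ^ ?d \<le> K * dirichlet T p" if b: "b \<in> Basis" for b
    proof -
      have "(LINT x:T|lborel. (grad UNIV p x \<bullet> b)\<^sup>2) \<le> dirichlet T p"
        unfolding dirichlet_def
      proof (rule set_integral_mono)
        show "set_integrable lborel T (\<lambda>x. (grad UNIV p x \<bullet> b)\<^sup>2)"
          unfolding set_integrable_def
          by (intro borel_integrable_compact compact_T continuous_intros grad_poly_fun_continuous_on[OF p])
        show "set_integrable lborel T (\<lambda>x. (norm (grad UNIV p x))\<^sup>2)" by (rule dirichlet_integrable[OF compact_T p])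
        show "(grad UNIV p x \<bullet> b)\<^sup>2 \<le> (norm (grad UNIV p x))\<^sup>2" for x
          using power_mono[OF Basis_le_norm[OF b, of "grad UNIV p x"] abs_ge_zero, of 2] by simp
      qed
      then show ?thesis
        using poly_sup_le_L2[OF k poly_fun_grad[OF p b] w] K unfolding K_def[symmetric]
        by (meson mult_left_mono order_trans)
    qed
    then have "(\<Sum>b\<in>Basis. (grad UNIV p w \<bullet> b)\<^sup>2 * ?h ^ ?d) \<le> (\<Sum>b\<in>(Basis::'a set). K * dirichlet T p)"
      by (rule sum_mono)
    moreover have "(norm (grad UNIV p w))\<^sup>2 = (\<Sum>b\<in>Basis. (grad UNIV p w \<bullet> b)\<^sup>2)"
      by (subst power2_norm_eq_inner, subst euclidean_inner) (simp add: power2_eq_square)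
    ultimately have "(norm (grad UNIV p w))\<^sup>2 * ?h ^ ?d \<le> real ?d * (K * dirichlet T p)"
      by (simp add: sum_distrib_right)
    then show ?thesis using diam_pos by (simp add: G_def pos_le_divide_eq mult.assoc)
  qed
  have "norm (p x - p y) \<le> sqrt G * norm (x - y)"
  proof (rule differentiable_bound[OF convex_T _ _ x y])
    fix w assume w: "w \<in> T"
    show "(p has_derivative (\<lambda>h. grad UNIV p w \<bullet> h)) (at w within T)"
      using poly_fun_has_derivative[OF p] has_derivative_at_withinI by blast
    show "onorm (\<lambda>h. grad UNIV p w \<bullet> h) \<le> sqrt G"
    proof (rule onorm_bound)
      fix h :: 'a
      have "norm (grad UNIV p w) \<le> sqrt G" using grad[OF w] by (simp add: real_le_rsqrt)
      then have "norm (grad UNIV p w) * norm h \<le> sqrt G * norm h" by (rule mult_right_mono) simp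
      then show "norm (grad UNIV p w \<bullet> h) \<le> sqrt G * norm h" using Cauchy_Schwarz_ineq2[of "grad UNIV p w" h] by simp
    qed (use G0 in simp)
  qed
  also have "\<dots> \<le> sqrt G * ?h" using dist_le_diam[OF x y] G0 by (intro mult_left_mono) (auto simp: dist_norm)
  finally have "\<bar>p x - p y\<bar>\<^sup>2 \<le> (sqrt G * ?h)\<^sup>2" by (intro power_mono) auto
  then have "(p x - p y)\<^sup>2 \<le> G * ?h\<^sup>2" using G0 by (simp add: power_mult_distrib)
  then have "(p x - p y)\<^sup>2 * ?h ^ (?d - 2) \<le> G * ?h\<^sup>2 * ?h ^ (?d - 2)"
    using diam_pos by (intro mult_right_mono) auto
  also have "\<dots> = G * ?h ^ ?d" by (simp only: diam_power[OF d] mult.assoc)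
  also have "\<dots> = real ?d * K * dirichlet T p" using diam_pos by (simp add: G_def)
  finally show ?thesis by (simp add: K_def diff_const_def)
qed

text \<open>The gradient is of order \<open>M / r\<close> by the nodal Lipschitz bound, and
  \<open>T\<close> fits into a ball of radius \<open>diameter T\<close>.\<close>

lemma dirichlet_le_nodal:
  assumes d: "DIM('a) \<ge> 2" and k: "k > 0" and p: "p \<in> poly_fun k" and M: "\<And>x. x \<in> lattice_nodes k T \<Longrightarrow> \<bar>p x\<bar> \<le> M"
  shows "dirichlet T p \<le> (shape_const k TYPE('a) * \<sigma>)\<^sup>2 * unit_ball_vol (real DIM('a)) * (diameter T ^ (DIM('a) - 2) * M\<^sup>2)"
proof -
  let ?h = "diameter T" and ?d = "DIM('a)" and ?A = "shape_const k TYPE('a)"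
  define K where "K = ?A * M / r"
  have lip: "\<bar>p x - p y\<bar> \<le> K * dist x y" if "x \<in> T" "y \<in> T" for x y
    unfolding K_def by (rule poly_lipschitz[OF k p M that])
  have gr: "(norm (grad UNIV p x))\<^sup>2 \<le> K\<^sup>2" if "x \<in> T" for x
    using grad_le_lipschitz[OF p lip that] by (intro power_mono) auto
  have fin: "emeasure lborel T < \<infinity>" using compact_T emeasure_compact_finite by blast
  have TB: "T \<subseteq> cball z ?h" using dist_le_diam[OF z_in] by auto
  have Tb: "T \<in> sets lborel" using compact_T by (simp add: borel_compact)
  have "dirichlet T p \<le> (LINT x:T|lborel. K\<^sup>2)"
    unfolding dirichlet_def
  proof (rule set_integral_mono)
    show "set_integrable lborel T (\<lambda>x. (norm (grad UNIV p x))\<^sup>2)" by (rule dirichlet_integrable[OF compact_T p])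
    show "set_integrable lborel T (\<lambda>x. K\<^sup>2)"
      unfolding set_integrable_def using fin Tb by (intro integrable_scaleR_left integrable_real_indicator) auto
  qed (rule gr)
  also have "\<dots> = K\<^sup>2 * measure lborel T" using Tb by (simp add: set_lebesgue_integral_def mult.commute)
  also have "\<dots> \<le> K\<^sup>2 * (unit_ball_vol (real ?d) * ?h ^ ?d)"
  proof (rule mult_left_mono)
    have "measure lborel T \<le> measure lborel (cball z ?h)"
      using Tb TB by (intro measure_mono_fmeasurable) (auto simp: fmeasurable_def emeasure_cball diam_pos less_imp_le)
    also have "\<dots> = unit_ball_vol (real ?d) * ?h ^ ?d" using diam_pos by (simp add: content_cball)
    finally show "measure lborel T \<le> unit_ball_vol (real ?d) * ?h ^ ?d" .
  qed simp
  also have "\<dots> = (K * ?h)\<^sup>2 * (unit_ball_vol (real ?d) * ?h ^ (?d - 2))"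
  proof -
    show ?thesis by (simp only: diam_power[OF d] power_mult_distrib mult_ac)
  qed
  also have "\<dots> \<le> (?A * \<sigma> * M)\<^sup>2 * (unit_ball_vol (real ?d) * ?h ^ (?d - 2))"
  proof (rule mult_right_mono)
    have "\<bar>K * ?h\<bar> \<le> \<bar>?A * \<sigma> * M\<bar>"
    proof -
      have "\<bar>K * ?h\<bar> = \<bar>?A * M\<bar> * (?h / r)" using diam_pos r_pos by (simp add: K_def abs_mult)
      also have "\<dots> \<le> \<bar>?A * M\<bar> * \<sigma>" using diam_le r_pos by (intro mult_left_mono) (auto simp: divide_le_eq)
      also have "\<dots> = \<bar>?A * \<sigma> * M\<bar>" using sigma_ge_1 by (simp add: abs_mult)
      finally show ?thesis .
    qed
    then show "(K * ?h)\<^sup>2 \<le> (?A * \<sigma> * M)\<^sup>2" by (simp add: abs_le_square_iff)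
  qed (use diam_pos in auto)
  finally show ?thesis by (simp add: power_mult_distrib mult_ac)
qed

end

section \<open>The nodal basis\<close>

abbreviation verts :: "'a::euclidean_space set \<Rightarrow> 'a set" where
  "verts T \<equiv> {v. v extreme_point_of T}"

section \<open>Elements and their common faces\<close>

locale mesh =
  fixes \<Omega> :: "'a::euclidean_space set" and \<T> :: "'a set set" and \<sigma> :: real
  assumes dim: "DIM('a) \<ge> 2" and domain: "polygonal_domain \<Omega>" and simplicial: "simplicial_mesh \<Omega> \<T>"
    and shape_reg: "\<And>T. T \<in> \<T> \<Longrightarrow> \<exists>x r. 0 < r \<and> cball x r \<subseteq> T \<and> diameter T \<le> \<sigma> * r"
begin

lemma finite_mesh: "finite \<T>"
  using simplicial by (auto simp: simplicial_mesh_def triangulation_def)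

lemma Union_mesh: "\<Union>\<T> = closure \<Omega>"
  using simplicial by (simp add: simplicial_mesh_def)

lemma open_domain: "open \<Omega>" and interior_closure_domain: "interior (closure \<Omega>) = \<Omega>" and bounded_domain: "bounded \<Omega>"
  using domain by (auto simp: polygonal_domain_def)

lemma element:
  assumes "T \<in> \<T>"
  shows verts_indep: "\<not> affine_dependent (verts T)" and card_verts: "card (verts T) = Suc DIM('a)"
    and hull_verts: "convex hull (verts T) = T"
proof -
  have "int DIM('a) simplex T" using simplicial assms by (simp add: simplicial_mesh_def)
  then obtain C where C: "\<not> affine_dependent C" "int (card C) = int DIM('a) + 1" "T = convex hull C"
    unfolding simplex_def by blast
  then have "verts T = C" using extreme_point_of_convex_hull_affine_independent[OF C(1)] by auto
  then show "\<not> affine_dependent (verts T)" "card (verts T) = Suc DIM('a)" "convex hull (verts T) = T"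
    using C by auto
qed

lemma regular_element:
  assumes "T \<in> \<T>" obtains z r where "regular_simplex (verts T) T z r \<sigma>"
proof -
  obtain z r where "0 < r" "cball z r \<subseteq> T" "diameter T \<le> \<sigma> * r" using shape_reg[OF assms] by blast
  then have "regular_simplex (verts T) T z r \<sigma>"
    using element[OF assms] by unfold_locales auto
  then show thesis by (rule that)
qed

lemma finite_verts: "T \<in> \<T> \<Longrightarrow> finite (verts T)"
  using verts_indep aff_independent_finite by blast

lemma verts_in: "v extreme_point_of T \<Longrightarrow> v \<in> T"
  by (simp add: extreme_point_of_def)

lemma compact_element: "T \<in> \<T> \<Longrightarrow> compact T"
  by (metis finite_verts hull_verts finite_imp_compact_convex_hull)

lemma closed_element: "T \<in> \<T> \<Longrightarrow> closed T"
  using compact_element compact_imp_closed by blast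

lemma convex_element: "T \<in> \<T> \<Longrightarrow> convex T"
  by (metis hull_verts convex_convex_hull)

lemma diam_element_pos: "T \<in> \<T> \<Longrightarrow> 0 < diameter T"
  by (meson regular_element regular_simplex.diam_pos)

lemma interior_element_nonempty: "T \<in> \<T> \<Longrightarrow> interior T \<noteq> {}"
proof -
  assume "T \<in> \<T>"
  then obtain z r where "regular_simplex (verts T) T z r \<sigma>" by (rule regular_element)
  then show "interior T \<noteq> {}" using regular_simplex.z_interior by blast
qed

lemma closure_interior_element: "T \<in> \<T> \<Longrightarrow> closure (interior T) = T"
  using convex_closure_interior[OF convex_element] interior_element_nonempty closed_element by (metis closure_closed)

text \<open>The intersection is a face of both elements, so its extreme points are extreme in both
  of them and the vertices spanning it are the shared ones.\<close>

lemma inter_element: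
  assumes "T \<in> \<T>" "T' \<in> \<T>"
  shows "T \<inter> T' = convex hull (verts T \<inter> verts T')"
proof -
  have f: "(T \<inter> T') face_of T" "(T \<inter> T') face_of T'"
    using simplicial assms unfolding simplicial_mesh_def triangulation_def by (blast, metis Int_commute)
  obtain c where c: "c \<subseteq> verts T" "T \<inter> T' = convex hull c"
    using f(1) face_of_convex_hull_affine_independent[OF verts_indep[OF assms(1)]] hull_verts[OF assms(1)] by metis
  have "\<not> affine_dependent c" using c(1) verts_indep[OF assms(1)] affine_dependent_subset by blast
  then have ext: "v extreme_point_of (T \<inter> T') \<longleftrightarrow> v \<in> c" for v
    unfolding c(2) by (rule extreme_point_of_convex_hull_affine_independent)
  have "v \<in> c \<longleftrightarrow> v \<in> verts T \<inter> verts T'" for v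
  proof -
    have "v extreme_point_of (T \<inter> T') \<longleftrightarrow> v extreme_point_of T \<and> v \<in> T \<inter> T'"
      "v extreme_point_of (T \<inter> T') \<longleftrightarrow> v extreme_point_of T' \<and> v \<in> T \<inter> T'"
      using extreme_point_of_face[OF f(1)] extreme_point_of_face[OF f(2)] by auto
    then show ?thesis using ext[of v] verts_in by auto
  qed
  then have "c = verts T \<inter> verts T'" by blast
  then show ?thesis using c(2) by simp
qed

lemma inter_face: "T \<in> \<T> \<Longrightarrow> T' \<in> \<T> \<Longrightarrow> (T \<inter> T') face_of T"
  using simplicial unfolding simplicial_mesh_def triangulation_def by blast

text \<open>A proper face misses the interior. If \<open>T \<inter> T'\<close> were all of
  \<open>T\<close>, then \<open>T\<close> would be a proper face of \<open>T'\<close> with interior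
  points in the interior of \<open>T'\<close>.\<close>

lemma interior_disjoint:
  assumes "T \<in> \<T>" "T' \<in> \<T>" "T \<noteq> T'" shows "interior T \<inter> T' = {}"
proof (rule ccontr)
  assume ne: "interior T \<inter> T' \<noteq> {}"
  have "T \<inter> T' = T"
  proof (rule ccontr)
    assume "T \<inter> T' \<noteq> T"
    then have "T \<inter> T' \<inter> interior T = {}" using face_of_disjoint_interior[OF inter_face[OF assms(1,2)]] by blast
    then show False using ne interior_subset by blast
  qed
  then have sub: "T \<subseteq> T'" by blast
  then have "T face_of T'" using inter_face[OF assms(2,1)] by (simp add: Int_absorb1)
  then have "T \<inter> interior T' = {}" using face_of_disjoint_interior assms(3) by blast
  moreover have "interior T \<subseteq> interior T'" using sub by (rule interior_mono)
  ultimately show False using interior_element_nonempty[OF assms(1)] interior_subset by blast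
qed

text \<open>A common point is a combination of common vertices, so its coordinates do not depend on
  the element; this makes \<open>hat\<close> independent of the element chosen.\<close>

lemma bary_consistent:
  assumes T: "T \<in> \<T>" "T' \<in> \<T>" and x: "x \<in> T" "x \<in> T'" and v: "v extreme_point_of T"
  shows "bary (verts T) v x = (if v extreme_point_of T' then bary (verts T') v x else 0)"
proof -
  let ?c = "verts T \<inter> verts T'"
  have fin: "finite ?c" using finite_verts[OF T(1)] by blast
  have "x \<in> convex hull ?c" using inter_element[OF T] x by auto
  then obtain u where u: "sum u ?c = 1" "x = (\<Sum>v\<in>?c. u v *\<^sub>R v)"
    unfolding convex_hull_finite[OF fin] by auto
  define w where "w v = (if v \<in> ?c then u v else 0)" for v
  have comb: "bary (verts S) v x = w v" if S: "S \<in> \<T>" "?c \<subseteq> verts S" "v \<in> verts S" for S v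
  proof -
    have "sum w (verts S) = sum u ?c" "(\<Sum>v\<in>verts S. w v *\<^sub>R v) = (\<Sum>v\<in>?c. u v *\<^sub>R v)"
      using S finite_verts[OF S(1)] by (auto simp: w_def split: if_splits intro!: sum.mono_neutral_cong_right)
    then show ?thesis using bary_combination[OF verts_indep[OF S(1)] S(3), of w] u by simp
  qed
  show ?thesis using comb[OF T(1), of v] comb[OF T(2), of v] v by (auto simp: w_def)
qed

section \<open>Hat functions\<close>

text \<open>Piecewise linear nodal functions of all vertices, also those on the boundary of the
  domain. They act as global barycentric coordinates, whatever the degree \<open>k\<close>.\<close>

definition hat :: "'a \<Rightarrow> 'a \<Rightarrow> real" where
  "hat v x = (if \<exists>T\<in>\<T>. x \<in> T \<and> v extreme_point_of T
     then bary (verts (SOME T. T \<in> \<T> \<and> x \<in> T \<and> v extreme_point_of T)) v x else 0)"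

lemma hat_eq:
  assumes T: "T \<in> \<T>" "x \<in> T"
  shows "hat v x = (if v extreme_point_of T then bary (verts T) v x else 0)"
proof (cases "\<exists>T\<in>\<T>. x \<in> T \<and> v extreme_point_of T")
  case True
  define S where "S = (SOME T. T \<in> \<T> \<and> x \<in> T \<and> v extreme_point_of T)"
  have S: "S \<in> \<T>" "x \<in> S" "v extreme_point_of S"
    using True someI_ex[of "\<lambda>T. T \<in> \<T> \<and> x \<in> T \<and> v extreme_point_of T"] unfolding S_def by blast+
  have "hat v x = bary (verts S) v x" using True by (simp add: hat_def S_def)
  then show ?thesis using bary_consistent[OF S(1) T(1) S(2) T(2) S(3)] by simp
next
  case False
  then show ?thesis using T by (auto simp: hat_def)
qed

lemma hat_outside: "x \<notin> closure \<Omega> \<Longrightarrow> hat v x = 0"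
  using Union_mesh by (auto simp: hat_def)

lemma hat_nonneg: "0 \<le> hat v x"
proof (cases "x \<in> closure \<Omega>")
  case True
  then obtain T where T: "T \<in> \<T>" "x \<in> T" using Union_mesh by auto
  then show ?thesis using bary_nonneg[OF verts_indep[OF T(1)], of x v] hull_verts[OF T(1)] by (simp add: hat_eq[OF T])
qed (simp add: hat_outside)

lemma hat_posD: "0 < hat v x \<Longrightarrow> T \<in> \<T> \<Longrightarrow> x \<in> T \<Longrightarrow> v extreme_point_of T"
  using hat_eq[of T x v] by (auto split: if_splits)

lemma sum_hat:
  assumes T: "T \<in> \<T>" "x \<in> T" shows "(\<Sum>v\<in>verts T. hat v x) = 1"
  using bary_sum[OF verts_indep[OF T(1)], of x] hull_verts[OF T(1)] T by (simp add: hat_eq[OF T])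

lemma hat_vertex: "T \<in> \<T> \<Longrightarrow> w extreme_point_of T \<Longrightarrow> hat v w = (if v = w then 1 else 0)"
  using bary_vertex[OF verts_indep, of T v w] hat_eq[OF _ verts_in, of T w v] by auto

lemma neighbourhood:
  assumes "x \<in> \<Omega>"
  obtains e where "e > 0" "ball x e \<subseteq> \<Omega>" "ball x e \<subseteq> \<Union>{T\<in>\<T>. x \<in> T}"
proof -
  have "closed (\<Union>{T\<in>\<T>. x \<notin> T})" using finite_mesh closed_element by (intro closed_Union) auto
  then have "open (\<Omega> - \<Union>{T\<in>\<T>. x \<notin> T})" using open_domain by (rule open_Diff[rotated])
  moreover have "x \<in> \<Omega> - \<Union>{T\<in>\<T>. x \<notin> T}" using assms by auto
  ultimately obtain e where e: "e > 0" "ball x e \<subseteq> \<Omega> - \<Union>{T\<in>\<T>. x \<notin> T}" by (meson openE)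
  have "y \<in> \<Union>{T\<in>\<T>. x \<in> T}" if "y \<in> ball x e" for y
  proof -
    have "y \<in> \<Union>\<T>" using that e closure_subset Union_mesh by blast
    then show ?thesis using that e by blast
  qed
  then show thesis using e by (intro that[of e]) auto
qed

text \<open>An open neighbourhood of a point on the segment from \<open>x\<close> to \<open>j\<close> close to \<open>j\<close> is contracted
  to a neighbourhood of \<open>x\<close> by a homothety centred in the smallest face that contains \<open>x\<close>.\<close>

lemma in_domain_of_support:
  assumes T: "T \<in> \<T>" and j: "j \<in> T" "j \<in> \<Omega>" and x: "x \<in> T"
    and supp: "\<And>v. 0 < hat v j \<Longrightarrow> 0 < hat v x"
  shows "x \<in> \<Omega>"
proof (cases "x = j")
  case False
  have ind: "\<not> affine_dependent (verts T)" and fin: "finite (verts T)" and hull: "convex hull (verts T) = T"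
    using element[OF T] finite_verts[OF T] by auto
  have bj: "bary (verts T) v j = hat v j" "bary (verts T) v x = hat v x" if "v \<in> verts T" for v
    using hat_eq[OF T j(1)] hat_eq[OF T x] that by auto
  define P where "P = {v \<in> verts T. 0 < hat v j}"
  have P: "finite P" "P \<noteq> {}"
  proof -
    show "P \<noteq> {}"
    proof
      assume "P = {}"
      then have "hat v j = 0" if "v \<in> verts T" for v using that hat_nonneg[of v j] by (force simp: P_def)
      then show False using sum_hat[OF T j(1)] by simp
    qed
  qed (use fin in \<open>simp add: P_def\<close>)
  define \<eta> where "\<eta> = Min ((\<lambda>v. hat v x) ` P)"
  have \<eta>: "\<eta> > 0" "\<And>v. v \<in> P \<Longrightarrow> \<eta> \<le> hat v x"
    using P supp by (auto simp: \<eta>_def P_def)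
  \<comment> \<open>The segment from \<open>j\<close> is prolonged slightly beyond \<open>x\<close>.
    This can reduce only coordinates that are positive at \<open>j\<close>, by at most
    \<open>\<eta>\<close>, and these are at least \<open>\<eta>\<close> at \<open>x\<close>.\<close>
  define p where "p = x - \<eta> *\<^sub>R (j - x)"
  have "p \<in> T"
  proof -
    define u where "u v = (1 + \<eta>) * bary (verts T) v x - \<eta> * bary (verts T) v j" for v
    have "0 \<le> u v" if v: "v \<in> verts T" for v
    proof (cases "v \<in> P")
      case True
      have "\<eta> * bary (verts T) v j \<le> \<eta> * 1"
        using \<eta>(1) bary_le_1[OF ind _ v, of j] j hull by (intro mult_left_mono) auto
      moreover have "\<eta> \<le> bary (verts T) v x" using \<eta>(2)[OF True] bj v by simp
      moreover have "0 \<le> \<eta> * bary (verts T) v x" using \<eta>(1) hat_nonneg bj v by simp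
      ultimately show ?thesis unfolding u_def distrib_right by linarith
    next
      case False
      then have "bary (verts T) v j = 0" using hat_nonneg[of v j] bj v by (force simp: P_def)
      then show ?thesis using \<eta>(1) hat_nonneg[of v x] bj v by (simp add: u_def)
    qed
    moreover have "sum u (verts T) = 1"
      using bary_sum[OF ind, of x] bary_sum[OF ind, of j] x j hull
      by (simp add: u_def sum_subtractf flip: sum_distrib_left)
    moreover have "(\<Sum>v\<in>verts T. u v *\<^sub>R v) = p"
    proof -
      have "(\<Sum>v\<in>verts T. u v *\<^sub>R v) = (1 + \<eta>) *\<^sub>R (\<Sum>v\<in>verts T. bary (verts T) v x *\<^sub>R v) - \<eta> *\<^sub>R (\<Sum>v\<in>verts T. bary (verts T) v j *\<^sub>R v)"
        by (simp add: u_def scaleR_diff_left sum_subtractf scaleR_sum_right)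
      then show ?thesis using bary_sum_vertices[OF ind, of x] bary_sum_vertices[OF ind, of j] x j hull
        by (simp add: p_def algebra_simps)
    qed
    ultimately have "p \<in> convex hull (verts T)" unfolding convex_hull_finite[OF fin] by blast
    then show ?thesis using hull by simp
  qed
  obtain e where e: "e > 0" "ball j e \<subseteq> \<Omega>" using open_domain j(2) by (meson openE)
  define s where "s = max (1/2) (1 - e / (2 * norm (j - x)))"
  have nj: "norm (j - x) > 0" using False by simp
  have s: "0 < s" "s < 1" "(1 - s) * norm (j - x) < e"
  proof -
    have "(1 - s) * norm (j - x) \<le> e / (2 * norm (j - x)) * norm (j - x)"
      by (intro mult_right_mono) (auto simp: s_def)
    then show "(1 - s) * norm (j - x) < e" using nj e by simp
  qed (use nj e in \<open>auto simp: s_def\<close>)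
  \<comment> \<open>A point of the segment so close to \<open>j\<close> that it lies in the open set
    \<open>\<Omega>\<close>; a whole ball around it is covered by the elements containing
    it.\<close>
  define xs where "xs = x + s *\<^sub>R (j - x)"
  have "j - xs = (1 - s) *\<^sub>R (j - x)" by (simp add: xs_def algebra_simps)
  then have "xs \<in> \<Omega>" using e s by (auto simp: dist_norm)
  have seg: "xs \<in> open_segment x j"
    using False s by (auto simp: in_segment xs_def algebra_simps intro!: exI[of _ s])
  have pj: "p \<noteq> j"
  proof
    assume "p = j"
    then have "(1 + \<eta>) *\<^sub>R (x - j) = 0" by (simp add: p_def algebra_simps)
    then show False using False \<eta>(1) by simp
  qed
  have "x = (1 - \<eta> / (1 + \<eta>)) *\<^sub>R p + (\<eta> / (1 + \<eta>)) *\<^sub>R j"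
  proof -
    have c: "(1 + \<eta>) * (1 - \<eta> / (1 + \<eta>)) = 1" "(1 + \<eta>) * (\<eta> / (1 + \<eta>)) = \<eta>" using \<eta>(1) by (auto simp: field_simps)
    have "(1 + \<eta>) *\<^sub>R ((1 - \<eta> / (1 + \<eta>)) *\<^sub>R p + (\<eta> / (1 + \<eta>)) *\<^sub>R j) = 1 *\<^sub>R p + \<eta> *\<^sub>R j"
      by (simp only: scaleR_add_right scaleR_scaleR c)
    also have "\<dots> = (1 + \<eta>) *\<^sub>R x" by (simp add: p_def algebra_simps)
    finally show ?thesis using \<eta>(1) by simp
  qed
  then have seg2: "x \<in> open_segment p j"
    using pj \<eta>(1) by (auto simp: in_segment intro!: exI[of _ "\<eta> / (1 + \<eta>)"])
  obtain e' where e': "e' > 0" "ball xs e' \<subseteq> \<Union>{T\<in>\<T>. xs \<in> T}" using neighbourhood[OF \<open>xs \<in> \<Omega>\<close>] by metis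
  \<comment> \<open>The homothety with centre \<open>p\<close> and ratio \<open>\<tau>\<close> takes
    \<open>xs\<close> to \<open>x\<close>, and thus the ball around \<open>xs\<close> to one around
    \<open>x\<close>.\<close>
  define \<tau> where "\<tau> = \<eta> / (\<eta> + s)"
  have \<tau>: "0 < \<tau>" "\<tau> < 1" using \<eta>(1) s by (auto simp: \<tau>_def)
  have x_eq: "x = (1 - \<tau>) *\<^sub>R p + \<tau> *\<^sub>R xs"
  proof -
    have "xs - p = (\<eta> + s) *\<^sub>R (j - x)" by (simp add: xs_def p_def algebra_simps)
    then have "\<tau> *\<^sub>R (xs - p) = \<eta> *\<^sub>R (j - x)" using \<eta>(1) s by (simp add: \<tau>_def)
    then show ?thesis by (simp add: p_def algebra_simps)
  qed
  have "ball x (\<tau> * e') \<subseteq> closure \<Omega>"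
  proof
    fix y assume y: "y \<in> ball x (\<tau> * e')"
    define y' where "y' = xs + (1 / \<tau>) *\<^sub>R (y - x)"
    have "dist xs y' = dist x y / \<tau>" using \<tau> by (simp add: y'_def dist_norm norm_minus_commute)
    then have "y' \<in> ball xs e'" using y \<tau> by (simp add: divide_less_eq mult.commute)
    then obtain T' where T': "T' \<in> \<T>" "xs \<in> T'" "y' \<in> T'" using e'(2) by blast
    \<comment> \<open>The face property is used twice: \<open>xs\<close> lies between
      \<open>x\<close> and \<open>j\<close>, so both of these are in \<open>T'\<close>; then
      \<open>x\<close> lies between \<open>p\<close> and \<open>j\<close>, so \<open>p\<close> is in
      \<open>T'\<close> too.\<close>
    have face: "(T \<inter> T') face_of T" by (rule inter_face[OF T T'(1)])
    have xsT: "xs \<in> T \<inter> T'" using seg T' convex_element[OF T] x j by (metis IntI convex_contains_open_segment subsetD)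
    have "x \<in> T \<inter> T'" "j \<in> T \<inter> T'" using face_ofD[OF face seg x j(1) xsT] by auto
    then have "p \<in> T'" using face_ofD[OF face seg2 \<open>p \<in> T\<close> j(1)] by auto
    then have "(1 - \<tau>) *\<^sub>R p + \<tau> *\<^sub>R y' \<in> T'" using T' \<tau> by (intro convexD[OF convex_element]) auto
    moreover have "(1 - \<tau>) *\<^sub>R p + \<tau> *\<^sub>R y' = y"
      using \<tau> x_eq by (simp add: y'_def scaleR_add_right algebra_simps)
    ultimately show "y \<in> closure \<Omega>" using T'(1) Union_mesh by blast
  qed
  then have "ball x (\<tau> * e') \<subseteq> \<Omega>" using interior_maximal[OF _ open_ball] interior_closure_domain by metis
  then show ?thesis using \<tau> e' by (auto simp: subset_iff)
qed (use j in simp)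

text \<open>At a vertex only its own hat function is positive, so the support condition of
  \<open>in_domain_of_support\<close> becomes \<open>0 < hat v y\<close>.\<close>

lemma vertex_in_domain_imp:
  assumes "0 < hat v y" "v \<in> \<Omega>" shows "y \<in> \<Omega>"
proof -
  have "y \<in> closure \<Omega>" using assms hat_outside[of y v] by auto
  then obtain T where T: "T \<in> \<T>" "y \<in> T" using Union_mesh by auto
  have v: "v extreme_point_of T" by (rule hat_posD[OF assms(1) T])
  show ?thesis
  proof (rule in_domain_of_support[OF T(1) verts_in[OF v] assms(2) T(2)])
    fix w assume "0 < hat w v"
    then have "w = v" using hat_vertex[OF T(1) v, of w] by (auto split: if_splits)
    then show "0 < hat w y" using assms by simp
  qed
qed

section \<open>The finite element space and its nodal basis\<close>

lemma V_h_add: "f \<in> V_h k \<Omega> \<T> \<Longrightarrow> g \<in> V_h k \<Omega> \<T> \<Longrightarrow> (\<lambda>x. f x + g x) \<in> V_h k \<Omega> \<T>"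
  unfolding V_h_def
  apply (safe intro!: continuous_on_add)
   apply simp
  by (metis (no_types, lifting) poly_fun_add)

lemma V_h_cmult: "f \<in> V_h k \<Omega> \<T> \<Longrightarrow> (\<lambda>x. c * f x) \<in> V_h k \<Omega> \<T>"
  unfolding V_h_def
  apply (safe intro!: continuous_on_mult_left)
   apply simp
  by (metis (no_types, lifting) poly_fun_cmult)

lemma V_h_0: "(\<lambda>x. 0) \<in> V_h k \<Omega> \<T>"
  unfolding V_h_def by (auto intro!: bexI[OF _ poly_fun_0])

lemma V_h_sum: "(\<And>i. i \<in> I \<Longrightarrow> f i \<in> V_h k \<Omega> \<T>) \<Longrightarrow> (\<lambda>x. \<Sum>i\<in>I. f i x) \<in> V_h k \<Omega> \<T>"
  by (induction I rule: infinite_finite_induct) (auto intro: V_h_0 V_h_add)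

lemma V_h_diff: "f \<in> V_h k \<Omega> \<T> \<Longrightarrow> g \<in> V_h k \<Omega> \<T> \<Longrightarrow> (\<lambda>x. f x - g x) \<in> V_h k \<Omega> \<T>"
  using V_h_add[OF _ V_h_cmult[of g k "-1"], of f] by simp

lemma V_h_polyD: "f \<in> V_h k \<Omega> \<T> \<Longrightarrow> T \<in> \<T> \<Longrightarrow> \<exists>p\<in>poly_fun k. \<forall>x\<in>T. f x = p x"
  and V_h_outside: "f \<in> V_h k \<Omega> \<T> \<Longrightarrow> x \<notin> \<Omega> \<Longrightarrow> f x = 0"
  by (auto simp: V_h_def)

lemma V_hI:
  assumes poly: "\<And>T. T \<in> \<T> \<Longrightarrow> \<exists>p\<in>poly_fun k. \<forall>x\<in>T. f x = p x" and out: "\<And>x. x \<notin> \<Omega> \<Longrightarrow> f x = 0"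
  shows "f \<in> V_h k \<Omega> \<T>"
proof -
  have "continuous_on T f" if T: "T \<in> \<T>" for T
  proof -
    obtain p where "p \<in> poly_fun k" "\<forall>x\<in>T. f x = p x" using poly[OF T] by blast
    then show ?thesis using poly_fun_continuous_on[of p k T] continuous_on_cong by metis
  qed
  then have "continuous_on (\<Union>\<T>) f"
    using finite_mesh closed_element by (intro continuous_on_closed_Union[of \<T> "\<lambda>x. x", simplified]) auto
  then show ?thesis using poly out Union_mesh by (auto simp: V_h_def)
qed

lemma V_h_continuous_on: "f \<in> V_h k \<Omega> \<T> \<Longrightarrow> continuous_on UNIV f"
proof -
  assume f: "f \<in> V_h k \<Omega> \<T>"
  have "continuous_on (- \<Omega>) f" using V_h_outside[OF f] by (subst continuous_on_cong[OF refl, of _ _ "\<lambda>_. 0"]) auto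
  moreover have "continuous_on (closure \<Omega>) f" using f by (simp add: V_h_def)
  ultimately have "continuous_on (- \<Omega> \<union> closure \<Omega>) f" using open_domain by (intro continuous_on_closed_Un) auto
  moreover have "- \<Omega> \<union> closure \<Omega> = UNIV" using closure_subset by blast
  ultimately show ?thesis by simp
qed

lemma lattice_nodes_element: "T \<in> \<T> \<Longrightarrow> k > 0 \<Longrightarrow> lattice_nodes k T = lattice_point k (verts T) ` multi_index k (verts T)"
  using lattice_nodes_eq[OF verts_indep, of T k] hull_verts by simp

lemma lattice_nodes_subset: "T \<in> \<T> \<Longrightarrow> k > 0 \<Longrightarrow> lattice_nodes k T \<subseteq> T"
  using lattice_nodes_element[of T k] lattice_point_in_hull[OF finite_verts, of T k] hull_verts by force

lemma hat_lattice_point: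
  assumes "T \<in> \<T>" "k > 0" "m \<in> multi_index k (verts T)"
  shows "hat v (lattice_point k (verts T) m) = (if v extreme_point_of T then real (m v) / real k else 0)"
proof -
  have "lattice_point k (verts T) m \<in> T" using lattice_point_in_hull[OF finite_verts[OF assms(1)] assms(2,3)] hull_verts[OF assms(1)] by simp
  then show ?thesis using hat_eq[OF assms(1)] bary_lattice_point[OF verts_indep[OF assms(1)] _ assms(2,3)] by auto
qed

lemma finite_nodes: "k > 0 \<Longrightarrow> finite (nodes k \<Omega> \<T>)"
  unfolding nodes_def using finite_mesh lattice_nodes_element finite_multi_index[OF finite_verts] by auto

lemma vertex_node: "T \<in> \<T> \<Longrightarrow> k > 0 \<Longrightarrow> v extreme_point_of T \<Longrightarrow> v \<in> \<Omega> \<Longrightarrow> v \<in> nodes k \<Omega> \<T>"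
proof -
  assume T: "T \<in> \<T>" and k: "k > 0" and v: "v extreme_point_of T" and "v \<in> \<Omega>"
  have fin: "finite (verts T)" by (rule finite_verts[OF T])
  have "(\<lambda>w\<in>verts T. if w = v then k else 0) \<in> multi_index k (verts T)" using v fin by (auto simp: multi_index_def)
  moreover have "lattice_point k (verts T) (\<lambda>w\<in>verts T. if w = v then k else 0) = v"
  proof -
    have "lattice_point k (verts T) (\<lambda>w\<in>verts T. if w = v then k else 0) = (\<Sum>w\<in>verts T. if w = v then w else 0)"
      unfolding lattice_point_def using k by (intro sum.cong) auto
    then show ?thesis using v fin by (simp add: sum.delta)
  qed
  ultimately have "v \<in> lattice_nodes k T" unfolding lattice_nodes_element[OF T k] by (metis imageI)
  then show ?thesis using T \<open>v \<in> \<Omega>\<close> by (auto simp: nodes_def)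
qed

text \<open>Lattice points of \<open>T\<close> outside \<open>\<Omega>\<close> carry the value 0 by
  the boundary condition, so the nodes in \<open>\<Omega>\<close> fix the interpolation
  polynomial.\<close>

lemma V_h_eq_0:
  assumes k: "k > 0" and f: "f \<in> V_h k \<Omega> \<T>" and T: "T \<in> \<T>" and 0: "\<And>z. z \<in> nodes k \<Omega> \<T> \<Longrightarrow> z \<in> T \<Longrightarrow> f z = 0"
    and x: "x \<in> T"
  shows "f x = 0"
proof -
  obtain p where p: "p \<in> poly_fun k" "\<forall>x\<in>T. f x = p x" using V_h_polyD[OF f T] by blast
  have "p (lattice_point k (verts T) m) = 0" if m: "m \<in> multi_index k (verts T)" for m
  proof -
    have z: "lattice_point k (verts T) m \<in> lattice_nodes k T" using m by (simp add: lattice_nodes_element[OF T k])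
    then have zT: "lattice_point k (verts T) m \<in> T" using lattice_nodes_subset[OF T k] by blast
    have "f (lattice_point k (verts T) m) = 0"
      using 0[OF _ zT] V_h_outside[OF f, of "lattice_point k (verts T) m"] z T by (auto simp: nodes_def)
    then show ?thesis using p zT by simp
  qed
  then have "p x = 0" using poly_fun_interpolation[OF verts_indep[OF T] card_verts[OF T] k p(1), of x] by simp
  then show ?thesis using p x by simp
qed

text \<open>The shape function of one element containing \<open>j\<close>, with hat functions in
  place of barycentric coordinates, is a formula for the whole domain. On elements lacking a vertex
  that carries \<open>j\<close> a factor vanishes. Where the product is nonzero, all coordinates
  carried by \<open>j\<close> are positive, which places the point in
  \<open>\<Omega>\<close>.\<close>

lemma nodal_function_exists:
  assumes k: "k > 0" and j: "j \<in> nodes k \<Omega> \<T>"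
  shows "\<exists>v. v \<in> V_h k \<Omega> \<T> \<and> (\<forall>z\<in>nodes k \<Omega> \<T>. v z = (if z = j then 1 else 0))"
proof -
  obtain T0 where T0: "T0 \<in> \<T>" "j \<in> lattice_nodes k T0" and j\<Omega>: "j \<in> \<Omega>" using j by (auto simp: nodes_def)
  then obtain m where m: "m \<in> multi_index k (verts T0)" "j = lattice_point k (verts T0) m"
    using lattice_nodes_element[OF _ k] by blast
  have finV: "finite (verts T0)" by (rule finite_verts[OF T0(1)])
  have msum: "sum m (verts T0) = k" using m(1) by (simp add: multi_index_def)
  have hatj: "hat v j = (if v extreme_point_of T0 then real (m v) / real k else 0)" for v
    unfolding m(2) by (rule hat_lattice_point[OF T0(1) k m(1)])
  define f where "f x = (\<Prod>v\<in>verts T0. \<Prod>l<m v. (real k * hat v x - real l) / (real (m v) - real l))" for x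
  have fnz: "0 < hat v x" if fx: "f x \<noteq> 0" and v: "v \<in> verts T0" "m v > 0" for v x
  proof (rule ccontr)
    assume "\<not> 0 < hat v x"
    then have "hat v x = 0" using hat_nonneg[of v x] by linarith
    then have "(\<Prod>l<m v. (real k * hat v x - real l) / (real (m v) - real l)) = 0"
      using v(2) by (intro prod_zero) (auto intro!: bexI[of _ 0])
    then have "f x = 0" unfolding f_def using v(1) finV by (intro prod_zero) auto
    then show False using fx by simp
  qed
  have supp: "\<exists>v\<in>verts T0. m v > 0"
  proof (rule ccontr)
    assume "\<not> ?thesis"
    then have "sum m (verts T0) = 0" by simp
    then show False using msum k by simp
  qed
  have "f \<in> V_h k \<Omega> \<T>"
  proof (rule V_hI)
    fix T assume T: "T \<in> \<T>"
    show "\<exists>p\<in>poly_fun k. \<forall>x\<in>T. f x = p x"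
    proof (cases "\<forall>v\<in>verts T0. m v > 0 \<longrightarrow> v extreme_point_of T")
      case True
      \<comment> \<open>On \<open>T\<close> each hat function is affine or 0, so the product has
        degree at most \<open>sum m (verts T0)\<close>, which is \<open>k\<close>.\<close>
      define g where "g v = (if v extreme_point_of T then bary (verts T) v else (\<lambda>x. 0))" for v
      define q where "q x = (\<Prod>v\<in>verts T0. \<Prod>l<m v. (real k * g v x - real l) / (real (m v) - real l))" for x
      have factor: "(\<lambda>x. (real k * g v x - real l) / (real (m v) - real l)) \<in> poly_fun 1" for v l
      proof -
        obtain a c where ac: "g v = (\<lambda>x. a \<bullet> x + c)"
        proof (cases "v extreme_point_of T")
          case True
          then show ?thesis using bary_affine[OF verts_indep[OF T], of v] that by (auto simp: g_def)
        next
          case False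
          then show ?thesis using that[of 0 0] by (simp add: g_def)
        qed
        have "(\<lambda>x. (1 / (real (m v) - real l)) * (real k * (a \<bullet> x + c) - real l)) \<in> poly_fun 1"
          using poly_fun_affine[of a c] by (intro poly_fun_cmult poly_fun_diff poly_fun_const) simp
        then show ?thesis unfolding ac by simp
      qed
      have "(\<lambda>x. \<Prod>v\<in>verts T0. \<Prod>l<m v. (real k * g v x - real l) / (real (m v) - real l)) \<in> poly_fun (\<Sum>v\<in>verts T0. \<Sum>l<m v. 1)"
        by (intro poly_fun_prod factor)
      then have A: "q \<in> poly_fun k" using msum by (simp add: q_def[abs_def])
      have "\<forall>x\<in>T. f x = q x"
        unfolding f_def q_def by (intro ballI prod.cong refl) (simp add: g_def hat_eq[OF T])
      then show ?thesis using A by blast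
    next
      case False
      then obtain v where v: "v \<in> verts T0" "m v > 0" "\<not> v extreme_point_of T" by blast
      have "f x = 0" if "x \<in> T" for x using fnz[OF _ v(1,2), of x] hat_eq[OF T that, of v] v(3) by auto
      then show ?thesis by (intro bexI[OF _ poly_fun_0]) auto
    qed
  next
    fix x assume x: "x \<notin> \<Omega>"
    show "f x = 0"
    proof (rule ccontr)
      assume fx: "f x \<noteq> 0"
      obtain v where "v \<in> verts T0" "m v > 0" using supp by blast
      then have "x \<in> closure \<Omega>" using fnz[OF fx] hat_outside by force
      then obtain T where T: "T \<in> \<T>" "x \<in> T" using Union_mesh by auto
      have hp: "0 < hat w j \<Longrightarrow> 0 < hat w x" for w
        using fnz[OF fx, of w] hatj[of w] k by (auto split: if_splits simp: zero_less_divide_iff)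
      \<comment> \<open>All vertices that carry \<open>j\<close> belong to \<open>T\<close> as well,
        so \<open>j\<close> lies in the common face.\<close>
      have "j \<in> T"
      proof -
        have jT0: "j \<in> T0" using T0 lattice_nodes_subset[OF _ k] by blast
        have "bary (verts T0) w j = 0" if "w \<in> verts T0 - verts T0 \<inter> verts T" for w
        proof (rule ccontr)
          assume "bary (verts T0) w j \<noteq> 0"
          then have "0 < hat w j" using hat_eq[OF T0(1) jT0, of w] that hat_nonneg[of w j] by auto
          then show False using hat_posD[OF hp T] that by auto
        qed
        then have "j \<in> convex hull (verts T0 \<inter> verts T)"
          using bary_face_iff[OF verts_indep[OF T0(1)], of "verts T0 \<inter> verts T" j] jT0 hull_verts[OF T0(1)] by auto
        then show ?thesis using hull_mono[of "verts T0 \<inter> verts T" "verts T" convex] hull_verts[OF T(1)] by auto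
      qed
      then have "x \<in> \<Omega>" using in_domain_of_support[OF T(1) _ j\<Omega> T(2) hp] by blast
      then show False using x by blast
    qed
  qed
  moreover have "f z = (if z = j then 1 else 0)" if z: "z \<in> nodes k \<Omega> \<T>" for z
  proof (cases "z = j")
    case True
    have "(\<Prod>l<m v. (real k * hat v j - real l) / (real (m v) - real l)) = 1" if "v \<in> verts T0" for v
      using k that by (intro prod.neutral) (auto simp: hatj)
    then have "f j = 1" unfolding f_def by (intro prod.neutral) auto
    then show ?thesis using True by simp
  next
    case False
    obtain T1 where T1: "T1 \<in> \<T>" "z \<in> lattice_nodes k T1" using z by (auto simp: nodes_def)
    then obtain n where n: "n \<in> multi_index k (verts T1)" "z = lattice_point k (verts T1) n"
      using lattice_nodes_element[OF _ k] by blast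
    define N where "N v = (if v extreme_point_of T1 then n v else 0)" for v
    have hatz: "real k * hat v z = real (N v)" for v
      unfolding n(2) using hat_lattice_point[OF T1(1) k n(1)] k by (simp add: N_def)
    \<comment> \<open>Both multi-indices, extended by 0 to the union of the vertex sets, have sum
      \<open>k\<close>. Domination of one by the other would make them equal and force
      \<open>z = j\<close>.\<close>
    have "\<exists>v\<in>verts T0. N v < m v"
    proof (rule ccontr)
      assume "\<not> ?thesis"
      then have ge: "m v \<le> N v" if "v \<in> verts T0" for v using that by force
      define M where "M v = (if v extreme_point_of T0 then m v else 0)" for v
      let ?U = "verts T0 \<union> verts T1"
      have finU: "finite ?U" using finV finite_verts[OF T1(1)] by blast
      have MN: "M v \<le> N v" for v using ge by (auto simp: M_def)
      have sM: "sum M ?U = k" using msum finU by (subst sum.mono_neutral_cong_right[of ?U "verts T0" M m]) (auto simp: M_def)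
      have "sum n (verts T1) = k" using n(1) by (simp add: multi_index_def)
      then have sN: "sum N ?U = k" using finU by (subst sum.mono_neutral_cong_right[of ?U "verts T1" N n]) (auto simp: N_def)
      have eq: "M v = N v" if v: "v \<in> ?U" for v
      proof (rule ccontr)
        assume "M v \<noteq> N v"
        then have "M v < N v" using MN[of v] by simp
        then have "sum M ?U < sum N ?U" using finU MN v by (intro sum_strict_mono_ex1) auto
        then show False using sM sN by simp
      qed
      have "j = (\<Sum>v\<in>?U. (real (M v) / real k) *\<^sub>R v)"
        unfolding m(2) lattice_point_def using finU by (intro sum.mono_neutral_cong_left) (auto simp: M_def)
      also have "\<dots> = (\<Sum>v\<in>?U. (real (N v) / real k) *\<^sub>R v)" using eq by simp
      also have "\<dots> = z"
        unfolding n(2) lattice_point_def using finU by (intro sum.mono_neutral_cong_right) (auto simp: N_def)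
      finally show False using False by simp
    qed
    then obtain v where v: "v \<in> verts T0" "N v < m v" by blast
    have "(\<Prod>l<m v. (real k * hat v z - real l) / (real (m v) - real l)) = 0"
      using v finV by (intro prod_zero) (auto simp: hatz intro!: bexI[of _ "N v"])
    then have "f z = 0" unfolding f_def using v finV by (intro prod_zero) auto
    then show ?thesis using False by simp
  qed
  ultimately show ?thesis by blast
qed

text \<open>Existence and uniqueness give meaning to the definite description in
  \<open>nodal_basis\<close>.\<close>

lemma
  assumes k: "k > 0" and j: "j \<in> nodes k \<Omega> \<T>"
  shows nodal_basis_V_h: "nodal_basis k \<Omega> \<T> j \<in> V_h k \<Omega> \<T>"
    and nodal_basis_node: "z \<in> nodes k \<Omega> \<T> \<Longrightarrow> nodal_basis k \<Omega> \<T> j z = (if z = j then 1 else 0)"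
proof -
  have "\<exists>!v. v \<in> V_h k \<Omega> \<T> \<and> (\<forall>z\<in>nodes k \<Omega> \<T>. v z = (if z = j then 1 else 0))"
  proof (rule ex_ex1I[OF nodal_function_exists[OF k j]])
    fix v w assume v: "v \<in> V_h k \<Omega> \<T> \<and> (\<forall>z\<in>nodes k \<Omega> \<T>. v z = (if z = j then 1 else 0))"
      and w: "w \<in> V_h k \<Omega> \<T> \<and> (\<forall>z\<in>nodes k \<Omega> \<T>. w z = (if z = j then 1 else 0))"
    have diff: "(\<lambda>x. v x - w x) \<in> V_h k \<Omega> \<T>" using v w V_h_diff by blast
    show "v = w"
    proof
      fix x
      show "v x = w x"
      proof (cases "x \<in> closure \<Omega>")
        case True
        then obtain T where "T \<in> \<T>" "x \<in> T" using Union_mesh by auto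
        then show ?thesis using V_h_eq_0[OF k diff, of T x] v w by simp
      next
        case False
        then have "x \<notin> \<Omega>" using closure_subset by blast
        then show ?thesis using V_h_outside v w by metis
      qed
    qed
  qed
  from theI'[OF this] show "nodal_basis k \<Omega> \<T> j \<in> V_h k \<Omega> \<T>"
    and "z \<in> nodes k \<Omega> \<T> \<Longrightarrow> nodal_basis k \<Omega> \<T> j z = (if z = j then 1 else 0)"
    by (auto simp: nodal_basis_def)
qed

end

section \<open>Elements near the interface\<close>

text \<open>\<open>\<sigma> ^ d\<close> is the volume ratio of two balls whose radii have ratio
  \<open>\<sigma>\<close>: it limits how many disjoint copies of the smaller fit into the
  larger.\<close>

definition overlap_bound :: "real \<Rightarrow> nat \<Rightarrow> nat" where
  "overlap_bound \<sigma> d = nat \<lceil>\<sigma> ^ d\<rceil>"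

text \<open>One factor \<open>\<sigma>\<close> for each step of a walk through the elements at a
  vertex, whose number is at most \<open>overlap_bound\<close>.\<close>

definition size_ratio :: "real \<Rightarrow> nat \<Rightarrow> real" where
  "size_ratio \<sigma> d = \<sigma> ^ overlap_bound \<sigma> d"

context regular_simplex
begin

text \<open>Along the edge the coordinate of \<open>v\<close> falls from 1 to 0 with slope at most
  \<open>1 / (2 * r)\<close>.\<close>

lemma edge_length: "v \<in> C \<Longrightarrow> w \<in> C \<Longrightarrow> v \<noteq> w \<Longrightarrow> 2 * r \<le> dist v w"
  using bary_lipschitz[OF aff_indep _ r_pos inner_ball[unfolded T_def], of v v w] r_pos
    bary_vertex[OF aff_indep, of v v] bary_vertex[OF aff_indep, of v w] by (simp add: divide_simps)

end

context mesh
begin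

lemma sigma_ge_1: "T \<in> \<T> \<Longrightarrow> 1 \<le> \<sigma>"
  by (meson regular_element regular_simplex.sigma_ge_1)

lemma size_ratio_ge_1: "T \<in> \<T> \<Longrightarrow> 1 \<le> size_ratio \<sigma> d"
  unfolding size_ratio_def using sigma_ge_1 by (simp add: one_le_power)

text \<open>Close to \<open>v\<close> each element containing \<open>v\<close> occupies a fixed fraction of a ball.\<close>

lemma card_elements_at_point:
  "card {T \<in> \<T>. v \<in> T} \<le> overlap_bound \<sigma> DIM('a)"
proof (cases "{T \<in> \<T>. v \<in> T} = {}")
  case False
  define S where "S = {T \<in> \<T>. v \<in> T}"
  have S: "finite S" "S \<noteq> {}" "\<And>T. T \<in> S \<Longrightarrow> T \<in> \<T>" "\<And>T. T \<in> S \<Longrightarrow> v \<in> T"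
    using False finite_mesh by (auto simp: S_def)
  have "\<forall>T\<in>S. \<exists>z r. regular_simplex (verts T) T z r \<sigma>" using S(3) regular_element by metis
  then obtain z r where zr: "\<And>T. T \<in> S \<Longrightarrow> regular_simplex (verts T) T (z T) (r T) \<sigma>" by metis
  have \<sigma>: "1 \<le> \<sigma>" using S sigma_ge_1 by blast
  \<comment> \<open>With the least diameter at \<open>v\<close> as common size, contraction towards
    \<open>v\<close> by \<open>t T\<close> gives each element a copy of diameter
    \<open>\<epsilon>\<close> with an inscribed ball of radius at least
    \<open>\<epsilon> / \<sigma>\<close>.\<close>
  define \<epsilon> where "\<epsilon> = Min (diameter ` S)"
  have \<epsilon>: "\<epsilon> > 0" "\<And>T. T \<in> S \<Longrightarrow> \<epsilon> \<le> diameter T"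
    using S diam_element_pos by (auto simp: \<epsilon>_def)
  define t where "t T = \<epsilon> / diameter T" for T :: "'a set"
  have t: "0 < t T" "t T \<le> 1" "t T * diameter T = \<epsilon>" if "T \<in> S" for T
    using \<epsilon> that diam_element_pos[OF S(3)[OF that]] by (auto simp: t_def)
  define B where "B T = ball (v + t T *\<^sub>R (z T - v)) (t T * r T)" for T
  let ?u = "unit_ball_vol (real DIM('a))"
  have B: "B T \<subseteq> interior T" "B T \<subseteq> cball v \<epsilon>" "?u * (\<epsilon> / \<sigma>) ^ DIM('a) \<le> measure lborel (B T)" if T: "T \<in> S" for T
  proof -
    interpret regular_simplex "verts T" T "z T" "r T" \<sigma> by (rule zr[OF T])
    note tT = t[OF T]
    have *: "y \<in> T \<and> dist v y \<le> \<epsilon>" if "y \<in> B T" for y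
      using homothetic_ball[OF S(4)[OF T] tT(1,2), of y] that tT(3) by (auto simp: B_def)
    show "B T \<subseteq> interior T" using * by (intro interior_maximal) (auto simp: B_def)
    show "B T \<subseteq> cball v \<epsilon>" using * by auto
    have "\<epsilon> / \<sigma> = t T * (diameter T / \<sigma>)" using tT by simp
    also have "\<dots> \<le> t T * r T" using r_ge tT by (intro mult_left_mono) auto
    finally have "(\<epsilon> / \<sigma>) ^ DIM('a) \<le> (t T * r T) ^ DIM('a)" using \<epsilon>(1) \<sigma> by (intro power_mono) auto
    then show "?u * (\<epsilon> / \<sigma>) ^ DIM('a) \<le> measure lborel (B T)"
      unfolding B_def using tT r_pos by (simp add: content_ball mult_left_mono)
  qed
  have disj: "disjoint_family_on B S"
    unfolding disjoint_family_on_def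
  proof (intro ballI impI)
    fix T T' assume "T \<in> S" "T' \<in> S" "T \<noteq> T'"
    then show "B T \<inter> B T' = {}"
      using interior_disjoint[of T T'] B(1)[of T] B(1)[of T'] S(3) interior_subset[of T'] by blast
  qed
  have "real (card S) * (?u * (\<epsilon> / \<sigma>) ^ DIM('a)) = (\<Sum>T\<in>S. ?u * (\<epsilon> / \<sigma>) ^ DIM('a))" by simp
  also have "\<dots> \<le> (\<Sum>T\<in>S. measure lborel (B T))" by (intro sum_mono B)
  also have "\<dots> = measure lborel (\<Union>T\<in>S. B T)"
  proof (rule measure_finite_Union[symmetric, OF S(1) _ disj])
    show "B ` S \<subseteq> sets lborel" by (auto simp: B_def)
    show "emeasure lborel (B T) \<noteq> \<infinity>" if "T \<in> S" for T
      using emeasure_mono[OF B(2)[OF that], of lborel] emeasure_compact_finite[OF compact_cball, of v \<epsilon>] by auto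
  qed
  also have "\<dots> \<le> measure lborel (cball v \<epsilon>)"
    using B(2) S(1) emeasure_compact_finite[OF compact_cball, of v \<epsilon>]
    by (intro measure_mono_fmeasurable) (auto simp: B_def fmeasurable_def)
  also have "\<dots> = ?u * \<epsilon> ^ DIM('a)" using \<epsilon>(1) by (simp add: content_cball)
  also have "\<dots> = \<sigma> ^ DIM('a) * (?u * (\<epsilon> / \<sigma>) ^ DIM('a))" using \<sigma> by (simp add: power_divide)
  finally have "real (card S) \<le> \<sigma> ^ DIM('a)" using \<epsilon>(1) \<sigma> by (subst (asm) mult_le_cancel_right_pos) auto
  then show ?thesis unfolding S_def[symmetric] overlap_bound_def by linarith
next
  case True
  show ?thesis unfolding True by simp
qed

text \<open>Small spheres around an interior vertex are connected, so that the elements at the vertex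
  cannot be split into two groups without a common edge.\<close>

lemma common_edge:
  assumes v: "v \<in> \<Omega>" and A: "A \<subseteq> {T\<in>\<T>. v extreme_point_of T}" "A \<noteq> {}" "A \<noteq> {T\<in>\<T>. v extreme_point_of T}"
    and all: "\<And>T. T \<in> \<T> \<Longrightarrow> v \<in> T \<Longrightarrow> v extreme_point_of T"
  obtains T T' w where "T \<in> A" "T' \<in> \<T>" "v extreme_point_of T'" "T' \<notin> A" "w \<noteq> v" "w extreme_point_of T" "w extreme_point_of T'"
proof -
  define S where "S = {T\<in>\<T>. v extreme_point_of T}"
  have S: "finite S" "\<And>T. T \<in> S \<Longrightarrow> T \<in> \<T>" "\<And>T. T \<in> S \<Longrightarrow> v \<in> T" using finite_mesh verts_in by (auto simp: S_def)
  obtain e where e: "e > 0" "ball v e \<subseteq> \<Union>{T\<in>\<T>. v \<in> T}" using neighbourhood[OF v] by metis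
  have "\<exists>w\<in>T. w \<noteq> v" if T: "T \<in> S" for T
  proof -
    have "card (verts T) = Suc DIM('a)" using card_verts S(2)[OF T] by blast
    then have "\<not> verts T \<subseteq> {v}" using dim card_mono[of "{v}" "verts T"] by auto
    then show ?thesis using verts_in by blast
  qed
  then obtain w where w: "\<And>T. T \<in> S \<Longrightarrow> w T \<in> T \<and> w T \<noteq> v" by metis
  \<comment> \<open>Small enough for the sphere to lie in the union of the elements at
    \<open>v\<close> and to meet each of them.\<close>
  define \<epsilon> where "\<epsilon> = Min (insert (e / 2) ((\<lambda>T. dist v (w T)) ` S))"
  have \<epsilon>: "\<epsilon> > 0" using S(1) w e(1) by (auto simp: \<epsilon>_def)
  have "\<epsilon> \<le> e / 2" unfolding \<epsilon>_def by (rule Min_le) (use S(1) in auto)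
  moreover have "\<epsilon> \<le> dist v (w T)" if "T \<in> S" for T
    unfolding \<epsilon>_def by (rule Min_le) (use S(1) that in auto)
  ultimately have \<epsilon>_le: "\<epsilon> \<le> e / 2" "\<And>T. T \<in> S \<Longrightarrow> \<epsilon> \<le> dist v (w T)" by auto
  have hits: "sphere v \<epsilon> \<inter> T \<noteq> {}" if T: "T \<in> S" for T
  proof -
    define p where "p = v + (\<epsilon> / dist v (w T)) *\<^sub>R (w T - v)"
    have d: "dist v (w T) > 0" "\<epsilon> / dist v (w T) \<le> 1" "0 \<le> \<epsilon> / dist v (w T)" using w[OF T] \<epsilon> \<epsilon>_le(2)[OF T] by auto
    have "dist v p = \<epsilon>" using d \<epsilon> by (simp add: p_def dist_norm norm_minus_commute)
    moreover have "p = (1 - \<epsilon> / dist v (w T)) *\<^sub>R v + (\<epsilon> / dist v (w T)) *\<^sub>R w T" by (simp add: p_def algebra_simps)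
    then have "p \<in> T" using d w[OF T] S(3)[OF T] convexD[OF convex_element[OF S(2)[OF T]], of v "w T"] by simp
    ultimately show ?thesis by auto
  qed
  have AS: "A \<subseteq> S" "A \<noteq> S" using A by (auto simp: S_def)
  have cl: "closed (\<Union>A)" "closed (\<Union>(S - A))"
    using AS S(1,2) closed_element by (auto intro!: closed_Union finite_subset[OF AS(1) S(1)])
  have "sphere v \<epsilon> \<subseteq> \<Union>A \<union> \<Union>(S - A)"
  proof
    fix p assume "p \<in> sphere v \<epsilon>"
    then have "p \<in> ball v e" using \<epsilon>_le(1) e(1) by auto
    then obtain T where "T \<in> \<T>" "v \<in> T" "p \<in> T" using e(2) by blast
    then have "T \<in> S" using all by (simp add: S_def)
    then show "p \<in> \<Union>A \<union> \<Union>(S - A)" using \<open>p \<in> T\<close> by blast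
  qed
  moreover have "sphere v \<epsilon> \<inter> \<Union>A \<noteq> {}" "sphere v \<epsilon> \<inter> \<Union>(S - A) \<noteq> {}" using hits A(2) AS by blast+
  ultimately have "\<Union>A \<inter> \<Union>(S - A) \<inter> sphere v \<epsilon> \<noteq> {}"
    using connected_closedD[OF connected_sphere[OF dim, of v \<epsilon>] _ _ cl] by blast
  then obtain p where p': "p \<in> \<Union>A" "p \<in> \<Union>(S - A)" "p \<in> sphere v \<epsilon>" by blast
  then obtain T T' where p: "p \<in> T" "p \<in> T'" "T \<in> A" "T' \<in> S - A" "dist v p = \<epsilon>" by auto
  have TT: "T \<in> \<T>" "T' \<in> \<T>" using p AS S(2) by auto
  \<comment> \<open>As \<open>p\<close> differs from \<open>v\<close>, the common face is more than
    the point \<open>v\<close> and has a second vertex.\<close>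
  have "p \<in> convex hull (verts T \<inter> verts T')" using inter_element[OF TT] p by blast
  moreover have "p \<noteq> v" using p \<epsilon> by auto
  ultimately have "\<not> verts T \<inter> verts T' \<subseteq> {v}"
    using hull_mono[of "verts T \<inter> verts T'" "{v}" convex] by auto
  then obtain w' where "w' \<in> verts T \<inter> verts T'" "w' \<noteq> v" by blast
  then show thesis using that[of T T' w'] p TT by (auto simp: S_def)
qed

text \<open>Elements with a common edge differ in size by at most a factor \<open>\<sigma>\<close>.
  The sets \<open>A n\<close> of elements reached within the factor \<open>\<sigma> ^ n\<close> grow
  by \<open>common_edge\<close> until they contain all elements at \<open>v\<close>.\<close>

lemma adjacent_diameter_le:
  assumes T: "T \<in> \<T>" "T' \<in> \<T>" and v: "v extreme_point_of T" "v extreme_point_of T'" and "v \<in> \<Omega>"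
  shows "diameter T \<le> size_ratio \<sigma> DIM('a) * diameter T'"
proof -
  define S where "S = {T\<in>\<T>. v extreme_point_of T}"
  have fin: "finite S" using finite_mesh by (simp add: S_def)
  have \<sigma>: "1 \<le> \<sigma>" using sigma_ge_1[OF T(1)] .
  have vertex: "v extreme_point_of U" if U: "U \<in> \<T>" "v \<in> U" for U
  proof -
    have "0 < hat v v" using hat_vertex[OF T(1) v(1), of v] by simp
    then show ?thesis by (rule hat_posD[OF _ U])
  qed
  have edge: "diameter U \<le> \<sigma> * diameter U'"
    if U: "U \<in> \<T>" "U' \<in> \<T>" and ab: "a \<noteq> b" "a extreme_point_of U" "b extreme_point_of U" "a extreme_point_of U'" "b extreme_point_of U'"
    for U U' a b
  proof -
    obtain z r where R: "regular_simplex (verts U) U z r \<sigma>" using regular_element[OF U(1)] .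
    obtain z' r' where R': "regular_simplex (verts U') U' z' r' \<sigma>" using regular_element[OF U(2)] .
    have "r \<le> 2 * r" using regular_simplex.r_pos[OF R] by simp
    also have "2 * r \<le> dist a b" using regular_simplex.edge_length[OF R, of a b] ab by simp
    also have "\<dots> \<le> diameter U'" using ab verts_in by (intro regular_simplex.dist_le_diam[OF R']) auto
    finally have "\<sigma> * r \<le> \<sigma> * diameter U'" using \<sigma> by (intro mult_left_mono) auto
    then show ?thesis using regular_simplex.diam_le[OF R] by linarith
  qed
  define A where "A n = {U\<in>S. diameter T \<le> \<sigma> ^ n * diameter U}" for n
  have TS: "T \<in> S" "T' \<in> S" using T v by (auto simp: S_def)
  have "A n = S \<or> n < card (A n)" for n
  proof (induction n)
    case 0
    have "T \<in> A 0" using TS by (simp add: A_def)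
    then show ?case using fin by (auto simp: A_def card_gt_0_iff)
  next
    case (Suc n)
    have sub: "A n \<subseteq> A (Suc n)"
    proof
      fix U assume U: "U \<in> A n"
      then have "0 < diameter U" using diam_element_pos by (auto simp: A_def S_def)
      then have "\<sigma> ^ n * diameter U \<le> \<sigma> ^ Suc n * diameter U" using \<sigma> by (intro mult_right_mono power_increasing) auto
      then show "U \<in> A (Suc n)" using U by (auto simp: A_def)
    qed
    have AS: "A (Suc n) \<subseteq> S" by (auto simp: A_def)
    show ?case
    proof (cases "A n = S")
      case True
      then show ?thesis using sub AS by blast
    next
      case False
      then have lt: "n < card (A n)" using Suc by blast
      have "A n \<noteq> {}" using lt by auto
      moreover have "A n \<subseteq> {T\<in>\<T>. v extreme_point_of T}" "A n \<noteq> {T\<in>\<T>. v extreme_point_of T}"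
        using False by (auto simp: A_def S_def)
      ultimately have "A n \<subseteq> {T\<in>\<T>. v extreme_point_of T}" "A n \<noteq> {}" "A n \<noteq> {T\<in>\<T>. v extreme_point_of T}"
        by auto
      from common_edge[OF \<open>v \<in> \<Omega>\<close> this vertex]
      obtain U U' w where UU: "U \<in> A n" "U' \<in> \<T>" "v extreme_point_of U'" "U' \<notin> A n" "w \<noteq> v" "w extreme_point_of U" "w extreme_point_of U'"
        by metis
      have "diameter U \<le> \<sigma> * diameter U'"
        using UU by (intro edge[of U U' w v]) (auto simp: A_def S_def)
      then have "\<sigma> ^ n * diameter U \<le> \<sigma> ^ n * (\<sigma> * diameter U')" using \<sigma> by (intro mult_left_mono) auto
      then have "U' \<in> A (Suc n)" using UU by (auto simp: A_def S_def mult_ac)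
      then have "A n \<subset> A (Suc n)" using sub UU(4) by blast
      then have "card (A n) < card (A (Suc n))" using fin AS by (intro psubset_card_mono finite_subset[OF AS])
      then show ?thesis using lt by simp
    qed
  qed
  \<comment> \<open>A subset of \<open>S\<close> cannot have more than \<open>card S\<close>
    members, so the second alternative is ruled out.\<close>
  from this[of "card S"] have "A (card S) = S"
    using card_mono[OF fin, of "A (card S)"] by (auto simp: A_def)
  then have "diameter T \<le> \<sigma> ^ card S * diameter T'" using TS by (auto simp: A_def)
  also have "\<dots> \<le> \<sigma> ^ overlap_bound \<sigma> DIM('a) * diameter T'"
  proof (intro mult_right_mono power_increasing)
    have "card S \<le> card {T\<in>\<T>. v \<in> T}" using finite_mesh verts_in by (intro card_mono) (auto simp: S_def)
    then show "card S \<le> overlap_bound \<sigma> DIM('a)" using card_elements_at_point[of v] by simp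
  qed (use \<sigma> diam_element_pos[OF T(2)] in auto)
  finally show ?thesis by (simp add: size_ratio_def)
qed

text \<open>Sum of the slopes of \<open>d + 1\<close> hat functions; each is at most
  \<open>1 / (2 * r)\<close> on an element whose inscribed radius \<open>r\<close> is at least
  \<open>diameter T\<close> divided by \<open>\<sigma>\<close> and the size ratio.\<close>

definition star_lipschitz :: "'a set \<Rightarrow> real" where
  "star_lipschitz T = real (Suc DIM('a)) * \<sigma> * size_ratio \<sigma> DIM('a) / (2 * diameter T)"

text \<open>The sum of the hat functions of the vertices of \<open>T\<close> is \<open>1\<close> on \<open>T\<close>, vanishes off the elements around
  \<open>T\<close>, and its slope is of order \<open>1 / diameter T\<close>.\<close>

lemma star_of_interior_element:
  assumes T: "T \<in> \<T>" "T \<subseteq> \<Omega>" and x: "x \<in> T" and y: "star_lipschitz T * dist x y < 1"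
  obtains v where "v extreme_point_of T" "0 < hat v y"
proof -
  define H where "H w = (\<Sum>v\<in>verts T. hat v w)" for w
  define M where "M = star_lipschitz T"
  have \<sigma>: "1 \<le> \<sigma>" by (rule sigma_ge_1[OF T(1)])
  have sr: "1 \<le> size_ratio \<sigma> DIM('a)" by (rule size_ratio_ge_1[OF T(1)])
  have hT: "0 < diameter T" by (rule diam_element_pos[OF T(1)])
  have M0: "0 \<le> M" unfolding M_def star_lipschitz_def using \<sigma> sr hT by simp
  have lip_el: "\<bar>H a - H b\<bar> \<le> M * dist a b" if T': "T' \<in> \<T>" and ab: "a \<in> T'" "b \<in> T'" for T' a b
  proof -
    obtain z r where R: "regular_simplex (verts T') T' z r \<sigma>" using regular_element[OF T'] .
    have each: "\<bar>hat v a - hat v b\<bar> \<le> \<sigma> * size_ratio \<sigma> DIM('a) / (2 * diameter T) * dist a b" if v: "v \<in> verts T" for v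
    proof (cases "v extreme_point_of T'")
      case True
      have v\<Omega>: "v \<in> \<Omega>" using v T(2) verts_in by blast
      have "diameter T \<le> size_ratio \<sigma> DIM('a) * diameter T'"
        using adjacent_diameter_le[OF T(1) T' _ True v\<Omega>] v by simp
      also have "\<dots> \<le> size_ratio \<sigma> DIM('a) * (\<sigma> * r)"
        using regular_simplex.diam_le[OF R] sr by (intro mult_left_mono) auto
      finally have le: "diameter T \<le> size_ratio \<sigma> DIM('a) * (\<sigma> * r)" .
      have r: "0 < r" by (rule regular_simplex.r_pos[OF R])
      have "\<bar>hat v a - hat v b\<bar> = \<bar>bary (verts T') v a - bary (verts T') v b\<bar>"
        using True by (simp add: hat_eq[OF T' ab(1)] hat_eq[OF T' ab(2)])
      also have "\<dots> \<le> dist a b / (2 * r)"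
        using True regular_simplex.inner_ball[OF R] hull_verts[OF T'] by (intro bary_lipschitz[OF verts_indep[OF T'] _ r]) auto
      also have "\<dots> = 1 / (2 * r) * dist a b" by simp
      also have "\<dots> \<le> \<sigma> * size_ratio \<sigma> DIM('a) / (2 * diameter T) * dist a b"
        using le r hT by (intro mult_right_mono) (auto simp: field_simps)
      finally show ?thesis .
    next
      case False
      then show ?thesis using hT \<sigma> sr by (simp add: hat_eq[OF T' ab(1)] hat_eq[OF T' ab(2)])
    qed
    have "\<bar>H a - H b\<bar> = \<bar>\<Sum>v\<in>verts T. hat v a - hat v b\<bar>" by (simp add: H_def sum_subtractf)
    also have "\<dots> \<le> (\<Sum>v\<in>verts T. \<sigma> * size_ratio \<sigma> DIM('a) / (2 * diameter T) * dist a b)"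
      by (intro order_trans[OF sum_abs] sum_mono each)
    also have "\<dots> = M * dist a b" using card_verts[OF T(1)] by (simp add: M_def star_lipschitz_def)
    finally show ?thesis .
  qed
  have H_out: "H w = 0" if "w \<notin> \<Omega>" for w
    unfolding H_def
  proof (intro sum.neutral ballI)
    fix v assume "v \<in> verts T"
    then have "v \<in> \<Omega>" using T(2) verts_in by blast
    then show "hat v w = 0" using vertex_in_domain_imp[of v w] that hat_nonneg[of v w] by force
  qed
  define c where "c t = x + t *\<^sub>R (y - x)" for t :: real
  \<comment> \<open>The segment from \<open>x\<close> to \<open>y\<close> may leave the domain. The
    preimages of the elements and of \<open>- \<Omega>\<close> are closed and cover it, and
    \<open>H\<close> is Lipschitz on each of them, being 0 off \<open>\<Omega>\<close>.\<close>
  have "(M * dist x y)-lipschitz_on {0..1} (\<lambda>t. H (c t))"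
  proof (rule lipschitz_on_closed_Union[of "insert (- \<Omega>) \<T>" _ "\<lambda>S. c -` S"])
    fix S assume S: "S \<in> insert (- \<Omega>) \<T>"
    have dist_c: "dist (c s) (c t) = \<bar>s - t\<bar> * dist x y" for s t
      by (simp add: c_def dist_norm norm_minus_commute flip: scaleR_diff_left)
    show "(M * dist x y)-lipschitz_on (c -` S) (\<lambda>t. H (c t))"
    proof (rule lipschitz_onI)
      fix s t assume st: "s \<in> c -` S" "t \<in> c -` S"
      have "\<bar>H (c s) - H (c t)\<bar> \<le> M * dist (c s) (c t)"
      proof (cases "S \<in> \<T>")
        case True
        then show ?thesis using lip_el st by simp
      next
        case False
        then show ?thesis using S st H_out M0 by auto
      qed
      then show "dist (H (c s)) (H (c t)) \<le> M * dist x y * dist s t" by (simp add: dist_c dist_real_def mult_ac)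
    qed (use M0 in simp)
    have "closed S" using S closed_element open_domain by auto
    moreover have "continuous_on UNIV c" unfolding c_def by (intro continuous_intros)
    ultimately show "closed (c -` S)" by (rule closed_vimage)
  next
    show "{0..1} \<subseteq> (\<Union>S\<in>insert (- \<Omega>) \<T>. c -` S)"
    proof
      fix t
      show "t \<in> (\<Union>S\<in>insert (- \<Omega>) \<T>. c -` S)"
      proof (cases "c t \<in> \<Omega>")
        case True
        then have "c t \<in> \<Union>\<T>" using closure_subset Union_mesh by blast
        then show ?thesis by auto
      qed auto
    qed
  qed (use finite_mesh M0 in auto)
  then have "dist (H (c 1)) (H (c 0)) \<le> M * dist x y * dist (1::real) 0" by (rule lipschitz_onD) auto
  then have "\<bar>H y - H x\<bar> < 1" using y by (simp add: c_def M_def dist_real_def)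
  moreover have "H x = 1" unfolding H_def by (rule sum_hat[OF T(1) x])
  ultimately have "H y > 0" by linarith
  then obtain v where "v \<in> verts T" "0 < hat v y" unfolding H_def by (metis sum_nonpos not_less)
  then show thesis using that by blast
qed

end

section \<open>Energies of finite element functions on elements\<close>

definition elem_energy :: "'a::euclidean_space set \<Rightarrow> ('a \<Rightarrow> real) \<Rightarrow> real" where
  "elem_energy T f = (LINT x:T|lborel. (norm (grad T f x))\<^sup>2)"

lemma grad_norm_sq_eq: "grad_norm_sq S f = (\<Sum>T\<in>S. elem_energy T f)"
  by (simp add: grad_norm_sq_def elem_energy_def)

locale cut_mesh_setting = mesh \<Omega> \<T> \<sigma> for \<Omega> :: "'a::euclidean_space set" and \<T> \<sigma> +
  fixes D :: "nat \<Rightarrow> 'a set" and k :: nat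
  assumes part: "partitioning \<Omega> D" and smooth: "smooth_interface \<Omega> D" and k: "k > 0"
    and nodes_off: "nodes k \<Omega> \<T> \<inter> interface D = {}"
begin

lemma elem_energy_eq:
  assumes T: "T \<in> \<T>" and p: "p \<in> poly_fun k" and eq: "\<And>x. x \<in> T \<Longrightarrow> f x = p x"
  shows "elem_energy T f = dirichlet T p"
proof -
  obtain z where z: "z \<in> interior T" using interior_element_nonempty[OF T] by blast
  have "grad T f x = grad UNIV p x" if "x \<in> T" for x
    using grad_eq_grad_poly[OF convex_element[OF T] that z p] eq by blast
  then show ?thesis
    unfolding elem_energy_def dirichlet_def
    using closed_element[OF T] by (intro set_lebesgue_integral_cong) auto
qed

lemma elem_energy_nonneg: "0 \<le> elem_energy T f"
  unfolding elem_energy_def set_lebesgue_integral_def by (intro integral_nonneg_AE AE_I2) simp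

lemma elem_energy_cong:
  assumes "T \<in> \<T>" "g \<in> V_h k \<Omega> \<T>" "\<And>x. x \<in> T \<Longrightarrow> f x = g x"
  shows "elem_energy T f = elem_energy T g"
proof -
  obtain p where "p \<in> poly_fun k" "\<forall>x\<in>T. g x = p x" using V_h_polyD assms by blast
  then show ?thesis using elem_energy_eq[OF assms(1), of p] assms(3) by metis
qed

lemma
  assumes T: "T \<in> \<T>" and f: "f \<in> V_h k \<Omega> \<T>" and g: "g \<in> V_h k \<Omega> \<T>"
  shows elem_energy_add_le: "elem_energy T (\<lambda>x. f x + g x) \<le> 2 * elem_energy T f + 2 * elem_energy T g"
    and elem_energy_diff_le: "elem_energy T (\<lambda>x. f x - g x) \<le> 2 * elem_energy T f + 2 * elem_energy T g"
proof -
  obtain p where p: "p \<in> poly_fun k" "\<And>x. x \<in> T \<Longrightarrow> f x = p x" using V_h_polyD[OF f T] by blast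
  obtain q where q: "q \<in> poly_fun k" "\<And>x. x \<in> T \<Longrightarrow> g x = q x" using V_h_polyD[OF g T] by blast
  have "elem_energy T (\<lambda>x. f x + g x) = dirichlet T (\<lambda>x. p x + q x)"
    by (rule elem_energy_eq[OF T poly_fun_add[OF p(1) q(1)]]) (simp add: p q)
  moreover have "elem_energy T (\<lambda>x. f x - g x) = dirichlet T (\<lambda>x. p x - q x)"
    by (rule elem_energy_eq[OF T poly_fun_diff[OF p(1) q(1)]]) (simp add: p q)
  ultimately show "elem_energy T (\<lambda>x. f x + g x) \<le> 2 * elem_energy T f + 2 * elem_energy T g"
    "elem_energy T (\<lambda>x. f x - g x) \<le> 2 * elem_energy T f + 2 * elem_energy T g"
    using elem_energy_eq[OF T p(1) p(2)] elem_energy_eq[OF T q(1) q(2)]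
      dirichlet_add_le[OF compact_element[OF T] p(1) q(1)] dirichlet_diff_le[OF compact_element[OF T] p(1) q(1)] by simp_all
qed

lemma V_h_diff_le_energy:
  assumes T: "T \<in> \<T>" and f: "f \<in> V_h k \<Omega> \<T>" and xy: "x \<in> T" "y \<in> T"
  shows "(f x - f y)\<^sup>2 * diameter T ^ (DIM('a) - 2)
     \<le> diff_const k \<sigma> TYPE('a) * elem_energy T f"
proof -
  obtain z r where R: "regular_simplex (verts T) T z r \<sigma>" using regular_element[OF T] .
  obtain p where p: "p \<in> poly_fun k" "\<And>x. x \<in> T \<Longrightarrow> f x = p x" using V_h_polyD[OF f T] by blast
  show ?thesis
    using regular_simplex.poly_diff_le_dirichlet[OF R dim k p(1) xy] elem_energy_eq[OF T p(1) p(2)] p(2) xy by simp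
qed

text \<open>Lattice points off \<open>\<Omega>\<close> are no nodes but carry the value 0, whence
  the condition \<open>0 \<le> M\<close>.\<close>

lemma energy_le_nodal:
  assumes T: "T \<in> \<T>" and f: "f \<in> V_h k \<Omega> \<T>" and M: "\<And>x. x \<in> nodes k \<Omega> \<T> \<Longrightarrow> x \<in> T \<Longrightarrow> \<bar>f x\<bar> \<le> M" "0 \<le> M"
  shows "elem_energy T f \<le> (shape_const k TYPE('a) * \<sigma>)\<^sup>2 * unit_ball_vol (real DIM('a)) * (diameter T ^ (DIM('a) - 2) * M\<^sup>2)"
proof -
  obtain z r where R: "regular_simplex (verts T) T z r \<sigma>" using regular_element[OF T] .
  obtain p where p: "p \<in> poly_fun k" "\<And>x. x \<in> T \<Longrightarrow> f x = p x" using V_h_polyD[OF f T] by blast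
  have "\<bar>p x\<bar> \<le> M" if x: "x \<in> lattice_nodes k T" for x
  proof -
    have xT: "x \<in> T" using lattice_nodes_subset[OF T k] x by blast
    then have "\<bar>f x\<bar> \<le> M"
      using M V_h_outside[OF f, of x] T x by (cases "x \<in> \<Omega>") (auto simp: nodes_def)
    then show ?thesis using p(2)[OF xT] by simp
  qed
  then show ?thesis
    using regular_simplex.dirichlet_le_nodal[OF R dim k p(1)] elem_energy_eq[OF T p(1) p(2)] by simp
qed

section \<open>Position of elements and nodes relative to the interface\<close>

lemma part_D: "i \<in> {1, 2} \<Longrightarrow> open (D i)" "D 1 \<inter> D 2 = {}" "D 1 \<union> D 2 = \<Omega> - interface D"
  using part by (auto simp: partitioning_def)

lemma closed_interface: "closed (interface D)" by (simp add: interface_def closed_Int)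

lemma compact_interface: "compact (interface D)"
proof -
  have "D 1 \<subseteq> \<Omega>" using part_D by blast
  then have "bounded (interface D)" unfolding interface_def
    using bounded_domain by (meson bounded_closure bounded_subset inf_le1)
  then show ?thesis using closed_interface compact_eq_bounded_closed by blast
qed

lemma interior_element_subset: "T \<in> \<T> \<Longrightarrow> interior T \<subseteq> \<Omega>"
proof -
  assume "T \<in> \<T>"
  then have "T \<subseteq> closure \<Omega>" using Union_mesh by blast
  then show ?thesis using interior_mono interior_closure_domain by metis
qed

text \<open>The interior is connected and covered by the disjoint open sets \<open>D 1\<close> and
  \<open>D 2\<close>, so one of them contains it.\<close>

lemma uncut_element:
  assumes T: "T \<in> \<T>" "T \<notin> cut_mesh \<T> D"
  obtains i where "i \<in> {1, 2}" "interior T \<subseteq> D i" "T \<subseteq> closure (D i)"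
proof -
  have "interior T \<inter> interface D = {}" using T by (auto simp: cut_mesh_def)
  then have sub: "interior T \<subseteq> D 1 \<union> D 2" using interior_element_subset[OF T(1)] part_D(3) by blast
  have "connected (interior T)" using convex_element[OF T(1)] by (simp add: convex_connected)
  then have "D 1 \<inter> interior T = {} \<or> D 2 \<inter> interior T = {}"
    using part_D sub by (intro connectedD) auto
  then have "interior T \<subseteq> D 1 \<or> interior T \<subseteq> D 2" using sub by blast
  then show thesis
  proof
    assume *: "interior T \<subseteq> D 1"
    then have "T \<subseteq> closure (D 1)" using closure_mono[OF *] closure_interior_element[OF T(1)] by simp
    then show thesis using that[of 1] * by simp
  next
    assume *: "interior T \<subseteq> D 2"
    then have "T \<subseteq> closure (D 2)" using closure_mono[OF *] closure_interior_element[OF T(1)] by simp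
    then show thesis using that[of 2] * by simp
  qed
qed

text \<open>Otherwise uncut elements on both sides of the interface meet in \<open>y\<close>; they share the node \<open>v\<close>, which
  would be a point of the interface.\<close>

lemma interface_point_in_cut_element:
  assumes y: "y \<in> interface D" "0 < hat v y" and v: "v \<in> \<Omega>"
  obtains T where "T \<in> cut_mesh \<T> D" "y \<in> T" "v extreme_point_of T"
proof (rule ccontr)
  note result = that
  assume no: "\<not> thesis"
  have y\<Omega>: "y \<in> \<Omega>" by (rule vertex_in_domain_imp[OF y(2) v])
  have vert: "v extreme_point_of T" if "T \<in> \<T>" "y \<in> T" for T using hat_posD[OF y(2) that] .
  have uncut: "T \<notin> cut_mesh \<T> D" if "T \<in> \<T>" "y \<in> T" for T using no result[OF _ that(2) vert[OF that]] by blast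
  obtain e where e: "e > 0" "ball y e \<subseteq> \<Union>{T\<in>\<T>. y \<in> T}" using neighbourhood[OF y\<Omega>] by metis
  have ex: "v \<in> closure (D i)" if i: "i \<in> {1, 2}" for i
  proof -
    have "y \<in> closure (D i)" using y(1) i by (auto simp: interface_def)
    then obtain q where q: "q \<in> D i" "dist q y < e" using e(1) by (meson closure_approachable)
    then have "q \<in> ball y e" by (simp add: dist_commute)
    then obtain T where T: "T \<in> \<T>" "y \<in> T" "q \<in> T" using e(2) by blast
    have "q \<in> closure (interior T)" using closure_interior_element[OF T(1)] T(3) by simp
    then have "D i \<inter> interior T \<noteq> {}" using part_D(1)[OF i] q(1) open_Int_closure_eq_empty by blast
    moreover obtain l where l: "l \<in> {1, 2}" "interior T \<subseteq> D l" "T \<subseteq> closure (D l)"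
      using uncut_element[OF T(1) uncut[OF T(1,2)]] by metis
    ultimately have "l = i" using i part_D(2) by auto
    then show ?thesis using l(3) verts_in[OF vert[OF T(1,2)]] by blast
  qed
  have "v \<in> interface D" using ex[of 1] ex[of 2] by (simp add: interface_def)
  obtain T where T: "T \<in> \<T>" "y \<in> T" using y\<Omega> closure_subset Union_mesh by blast
  have "v \<in> nodes k \<Omega> \<T>" by (rule vertex_node[OF T(1) k vert[OF T] v])
  then show False using nodes_off \<open>v \<in> interface D\<close> by blast
qed

lemma cut_mesh_subset: "cut_mesh \<T> D \<subseteq> \<T>" by (auto simp: cut_mesh_def)

lemma cut_in_ex_mesh:
  assumes "T \<in> cut_mesh \<T> D" "i \<in> {1, 2}" shows "T \<in> ex_mesh \<T> (D i)"
proof -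
  have T: "T \<in> \<T>" "interior T \<inter> interface D \<noteq> {}" using assms(1) by (auto simp: cut_mesh_def)
  then have "interior T \<inter> closure (D i) \<noteq> {}" using assms(2) by (auto simp: interface_def)
  then have "interior T \<inter> D i \<noteq> {}" using open_Int_closure_eq_empty by blast
  then show ?thesis using T(1) interior_subset by (auto simp: ex_mesh_def)
qed

text \<open>The element lies in the closure of a single subdomain, which must be \<open>D i\<close>;
  a node, being off the interface, cannot lie in the other, open one.\<close>

lemma uncut_nodes:
  assumes T: "T \<in> ex_mesh \<T> (D i)" "T \<notin> cut_mesh \<T> D" and i: "i \<in> {1, 2}"
    and z: "z \<in> nodes k \<Omega> \<T>" "z \<in> T"
  shows "z \<in> D i"
proof -
  have TT: "T \<in> \<T>" "T \<inter> D i \<noteq> {}" using T(1) by (auto simp: ex_mesh_def)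
  obtain l where l: "l \<in> {1, 2}" "interior T \<subseteq> D l" "T \<subseteq> closure (D l)" using uncut_element[OF TT(1) T(2)] by metis
  have "closure (interior T) \<inter> D i \<noteq> {}" using closure_interior_element[OF TT(1)] TT(2) by simp
  then have "interior T \<inter> D i \<noteq> {}" using part_D(1)[OF i] open_Int_closure_eq_empty by blast
  then have li: "l = i" using l i part_D(2) by auto
  have "z \<in> \<Omega>" using z by (simp add: nodes_def)
  then have "z \<in> D 1 \<union> D 2" using part_D(3) nodes_off z(1) by blast
  then obtain j where j: "j \<in> {1, 2}" "z \<in> D j" by auto
  have "j = l"
  proof (rule ccontr)
    assume "j \<noteq> l"
    then have "D l \<inter> D j = {}" using j(1) l(1) part_D(2) by auto
    then have "closure (D l) \<inter> D j = {}"
      using open_Int_closure_eq_empty[OF part_D(1)[OF j(1)], of "D l"] by blast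
    then show False using l(3) z(2) j(2) by blast
  qed
  then show ?thesis using j li by simp
qed

section \<open>Integrals over the interface\<close>

abbreviation "\<Gamma>_measure A \<equiv> measure (surf :: 'a measure) A"

lemma emeasure_surf: "A \<in> sets borel \<Longrightarrow> emeasure (surf :: 'a measure) A = hausdorff_outer (DIM('a) - 1) A"
  using emeasure_hausdorff_measure[of "DIM('a) - 1" A] dim by simp

lemma emeasure_surf_finite:
  assumes "A \<in> sets borel" "A \<subseteq> interface D" shows "emeasure (surf :: 'a measure) A < \<infinity>"
  using hausdorff_outer_interface_finite[OF dim smooth compact_interface]
    hausdorff_outer_mono[OF assms(2), of "DIM('a) - 1"] emeasure_surf[OF assms(1)] by (simp add: le_less_trans)

text \<open>Continuity gives boundedness on a compact set of finite measure. Integrability matters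
  because the integral of a non-integrable function is 0 by convention, which would ruin
  comparisons.\<close>

lemma surf_integrable:
  assumes "f \<in> V_h k \<Omega> \<T>" "T \<in> \<T>"
  shows "set_integrable surf (T \<inter> interface D) (\<lambda>x. f x * f x)"
proof -
  have c: "compact (T \<inter> interface D)" using compact_element[OF assms(2)] closed_interface by blast
  have cont: "continuous_on UNIV (\<lambda>x. f x * f x)" using V_h_continuous_on[OF assms(1)] by (intro continuous_intros)
  have "compact ((\<lambda>x. f x * f x) ` (T \<inter> interface D))"
    by (rule compact_continuous_image[OF continuous_on_subset[OF cont] c]) simp
  then have "bounded ((\<lambda>x. f x * f x) ` (T \<inter> interface D))" by (rule compact_imp_bounded)
  then obtain B where B: "\<And>x. x \<in> T \<inter> interface D \<Longrightarrow> norm (f x * f x) \<le> B" unfolding bounded_iff by blast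
  have S: "T \<inter> interface D \<in> sets borel" using c by (simp add: borel_compact)
  show ?thesis unfolding set_integrable_def
  proof (rule integrableI_bounded_set[where A = "T \<inter> interface D" and B = B])
    have "(\<lambda>x. f x * f x) \<in> borel_measurable borel" using cont by (rule borel_measurable_continuous_onI)
    then have "(\<lambda>x. indicat_real (T \<inter> interface D) x *\<^sub>R (f x * f x)) \<in> borel_measurable borel"
      by (intro borel_measurable_scaleR borel_measurable_indicator S)
    then show "(\<lambda>x. indicat_real (T \<inter> interface D) x *\<^sub>R (f x * f x)) \<in> borel_measurable surf"
      by (subst measurable_cong_sets[OF sets_hausdorff_measure refl])
    show "emeasure surf (T \<inter> interface D) < \<infinity>" by (rule emeasure_surf_finite[OF S]) simp
    show "AE x in surf. x \<in> T \<inter> interface D \<longrightarrow> norm (indicat_real (T \<inter> interface D) x *\<^sub>R (f x * f x)) \<le> B" using B by auto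
  qed (use S in auto)
qed

section \<open>Control of values on cut elements\<close>

definition adjacent :: "'a set \<Rightarrow> 'a set \<Rightarrow> bool" where
  "adjacent T T' \<longleftrightarrow> (\<exists>v. v extreme_point_of T \<and> v extreme_point_of T')"

lemma card_adjacent:
  assumes "T \<in> \<T>"
  shows "card {T' \<in> \<T>. adjacent T' T} \<le> Suc DIM('a) * overlap_bound \<sigma> DIM('a)"
proof -
  have "{T' \<in> \<T>. adjacent T' T} \<subseteq> (\<Union>v\<in>verts T. {T' \<in> \<T>. v \<in> T'})" using verts_in by (auto simp: adjacent_def)
  then have "card {T' \<in> \<T>. adjacent T' T} \<le> card (\<Union>v\<in>verts T. {T' \<in> \<T>. v \<in> T'})"
    using finite_verts[OF assms] finite_mesh by (intro card_mono) auto
  also have "\<dots> \<le> (\<Sum>v\<in>verts T. card {T' \<in> \<T>. v \<in> T'})" by (rule card_UN_le[OF finite_verts[OF assms]])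
  also have "\<dots> \<le> (\<Sum>v\<in>verts T. overlap_bound \<sigma> DIM('a))" by (intro sum_mono card_elements_at_point)
  finally show ?thesis using card_verts[OF assms] by simp
qed

lemma adjacent_sym: "adjacent T T' \<longleftrightarrow> adjacent T' T" by (auto simp: adjacent_def)

lemma overlap_bound_pos: "T \<in> \<T> \<Longrightarrow> 0 < overlap_bound \<sigma> DIM('a)"
  unfolding overlap_bound_def using sigma_ge_1[of T] one_le_power[of \<sigma> "DIM('a)"] by linarith

lemma diam_element_le: "T \<in> \<T> \<Longrightarrow> diameter T \<le> diameter (closure \<Omega>)"
  using Union_mesh bounded_domain by (intro diameter_subset) auto

definition cut_energy :: "('a \<Rightarrow> real) \<Rightarrow> 'a set \<Rightarrow> real" where
  "cut_energy f T = elem_energy T f + inverse (diameter T) * (LINT x:T \<inter> interface D|surf. f x * f x)"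

lemma interface_integral_nonneg: "0 \<le> (LINT x:S|surf. f x * f x)" for f :: "'a \<Rightarrow> real"
  unfolding set_lebesgue_integral_def by (intro integral_nonneg_AE AE_I2) (simp add: indicator_def)

lemma cut_energy_ge: "T \<in> \<T> \<Longrightarrow> elem_energy T f \<le> cut_energy f T" and cut_energy_nonneg: "T \<in> \<T> \<Longrightarrow> 0 \<le> cut_energy f T"
  unfolding cut_energy_def using elem_energy_nonneg[of T f] interface_integral_nonneg[of "T \<inter> interface D" f] diam_element_pos[of T]
  by auto

text \<open>A pigeonhole argument: the part of the interface in a ball around a point of
  \<open>T\<close> has large measure and is covered by the cut elements sharing a vertex with
  \<open>T\<close>. Their number is bounded, so one of them holds a fixed share.\<close>

lemma large_interface_neighbour:
  assumes \<epsilon>: "0 < \<epsilon>" and ball: "\<And>x \<rho>. x \<in> interface D \<Longrightarrow> 0 < \<rho> \<Longrightarrow> \<rho> \<le> \<epsilon> \<Longrightarrow> ball x \<rho> \<subseteq> \<Omega> \<Longrightarrow>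
           ennreal (\<epsilon> * \<rho> ^ (DIM('a) - 1)) \<le> hausdorff_outer (DIM('a) - 1) (interface D \<inter> ball x \<rho>)"
    and c: "0 < c" "c * (real (Suc DIM('a)) * \<sigma> * size_ratio \<sigma> DIM('a)) \<le> 1" "c * diameter (closure \<Omega>) \<le> \<epsilon>"
    and T: "T \<in> cut_mesh \<T> D" "T \<subseteq> \<Omega>"
  obtains T' where "T' \<in> cut_mesh \<T> D" "adjacent T T'"
    "\<epsilon> * (c * diameter T) ^ (DIM('a) - 1) \<le> real (Suc DIM('a) * overlap_bound \<sigma> DIM('a)) * \<Gamma>_measure (T' \<inter> interface D)"
proof -
  let ?m = "DIM('a) - 1"
  have TM: "T \<in> \<T>" using T(1) cut_mesh_subset by blast
  have h: "0 < diameter T" by (rule diam_element_pos[OF TM])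
  obtain x where x: "x \<in> interior T" "x \<in> interface D" using T(1) by (auto simp: cut_mesh_def)
  have xT: "x \<in> T" using x(1) interior_subset by blast
  \<comment> \<open>Of the two upper bounds on \<open>c\<close>, one keeps the ball in the star of
    \<open>T\<close>; the other, by way of the diameter of the domain, keeps the radius below
    \<open>\<epsilon>\<close>.\<close>
  define \<rho> where "\<rho> = c * diameter T"
  have \<rho>: "0 < \<rho>" "\<rho> \<le> \<epsilon>"
  proof -
    show "0 < \<rho>" using c h by (simp add: \<rho>_def)
    have "\<rho> \<le> c * diameter (closure \<Omega>)" unfolding \<rho>_def using c diam_element_le[OF TM] by (intro mult_left_mono) auto
    then show "\<rho> \<le> \<epsilon>" using c by linarith
  qed
  have star: "\<exists>v. v extreme_point_of T \<and> 0 < hat v y" if y: "y \<in> ball x \<rho>" for y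
  proof -
    have sl: "0 < star_lipschitz T" unfolding star_lipschitz_def
      using h sigma_ge_1[OF TM] size_ratio_ge_1[OF TM, of "DIM('a)"] by simp
    have "star_lipschitz T * dist x y < star_lipschitz T * \<rho>" using y sl by simp
    also have "\<dots> = c * (real (Suc DIM('a)) * \<sigma> * size_ratio \<sigma> DIM('a)) / 2"
      using h by (simp add: star_lipschitz_def \<rho>_def)
    also have "\<dots> < 1" using c(2) by simp
    finally show ?thesis using star_of_interior_element[OF TM T(2) xT, of y] by blast
  qed
  have vO: "v \<in> \<Omega>" if "v extreme_point_of T" for v using that T(2) verts_in by blast
  have sub: "ball x \<rho> \<subseteq> \<Omega>" using star vertex_in_domain_imp vO by blast
  define N where "N = {T' \<in> cut_mesh \<T> D. adjacent T' T}"
  have finN: "finite N" by (rule finite_subset[OF _ finite_mesh]) (use cut_mesh_subset in \<open>auto simp: N_def\<close>)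
  have cardN: "card N \<le> Suc DIM('a) * overlap_bound \<sigma> DIM('a)"
  proof -
    have "card N \<le> card {T' \<in> \<T>. adjacent T' T}" using finite_mesh cut_mesh_subset by (intro card_mono) (auto simp: N_def)
    then show ?thesis using card_adjacent[OF TM] by simp
  qed
  have cover: "interface D \<inter> ball x \<rho> \<subseteq> (\<Union>T'\<in>N. T' \<inter> interface D)"
  proof
    fix y assume y: "y \<in> interface D \<inter> ball x \<rho>"
    then obtain v where v: "v extreme_point_of T" "0 < hat v y" using star by blast
    obtain T' where "T' \<in> cut_mesh \<T> D" "y \<in> T'" "v extreme_point_of T'"
      using interface_point_in_cut_element[of y v] y v(2) vO[OF v(1)] by blast
    then show "y \<in> (\<Union>T'\<in>N. T' \<inter> interface D)" using y v(1) by (auto simp: N_def adjacent_def)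
  qed
  have bor: "T' \<inter> interface D \<in> sets borel" if "T' \<in> N" for T'
    using that closed_element closed_interface cut_mesh_subset by (auto simp: N_def intro!: borel_closed)
  have borU: "(\<Union>T'\<in>N. T' \<inter> interface D) \<in> sets borel" using bor finN by blast
  have borB: "interface D \<inter> ball x \<rho> \<in> sets borel" using closed_interface by (simp add: borel_closed sets.Int)
  have "ennreal (\<epsilon> * \<rho> ^ ?m) \<le> emeasure (surf :: 'a measure) (interface D \<inter> ball x \<rho>)"
    unfolding emeasure_surf[OF borB] by (rule ball[OF x(2) \<rho> sub])
  also have "\<dots> \<le> emeasure (surf :: 'a measure) (\<Union>T'\<in>N. T' \<inter> interface D)"
    using cover borU by (intro emeasure_mono) auto
  also have "\<dots> = ennreal (\<Gamma>_measure (\<Union>T'\<in>N. T' \<inter> interface D))"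
    using emeasure_surf_finite[OF borU] by (intro emeasure_eq_ennreal_measure) auto
  finally have "\<epsilon> * \<rho> ^ ?m \<le> \<Gamma>_measure (\<Union>T'\<in>N. T' \<inter> interface D)"
    by (simp add: measure_nonneg)
  also have "\<dots> \<le> (\<Sum>T'\<in>N. \<Gamma>_measure (T' \<inter> interface D))"
    using bor by (intro measure_UNION_le finN) auto
  finally have sum: "\<epsilon> * \<rho> ^ ?m \<le> (\<Sum>T'\<in>N. \<Gamma>_measure (T' \<inter> interface D))" .
  have pos: "0 < \<epsilon> * \<rho> ^ ?m" using \<epsilon> \<rho> by simp
  then have "N \<noteq> {}" using sum by auto
  define R where "R = Max ((\<lambda>T'. \<Gamma>_measure (T' \<inter> interface D)) ` N)"
  obtain T' where T': "T' \<in> N" "R = \<Gamma>_measure (T' \<inter> interface D)"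
    using Max_in[of "(\<lambda>T'. \<Gamma>_measure (T' \<inter> interface D)) ` N"] finN \<open>N \<noteq> {}\<close> unfolding R_def by blast
  have "(\<Sum>T'\<in>N. \<Gamma>_measure (T' \<inter> interface D)) \<le> (\<Sum>T'\<in>N. R)"
    unfolding R_def using finN by (intro sum_mono Max_ge) auto
  also have "\<dots> \<le> real (Suc DIM('a) * overlap_bound \<sigma> DIM('a)) * R"
  proof -
    have "0 \<le> R" unfolding T'(2) by simp
    moreover have "real (card N) \<le> real (Suc DIM('a) * overlap_bound \<sigma> DIM('a))"
      using cardN by (simp only: of_nat_le_iff)
    ultimately show ?thesis by (simp only: sum_constant) (rule mult_right_mono)
  qed
  finally have "\<epsilon> * \<rho> ^ ?m \<le> real (Suc DIM('a) * overlap_bound \<sigma> DIM('a)) * R" using sum by linarith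
  then show thesis using that[of T'] T' adjacent_sym by (auto simp: N_def \<rho>_def)
qed

lemma diff_const_nonneg: "0 \<le> diff_const k \<sigma> TYPE('a)"
  unfolding diff_const_def using shape_const_ge_1[OF k, where 'a = 'a] by simp

text \<open>\<open>f\<close> vanishes at some point of \<open>T\<close>, so its oscillation controls
  its values.\<close>

lemma value_le_cut_energy_boundary:
  assumes f: "f \<in> V_h k \<Omega> \<T>" and T: "T \<in> \<T>" "\<not> T \<subseteq> \<Omega>" and x: "x \<in> T"
  shows "(f x)\<^sup>2 * diameter T ^ (DIM('a) - 2) \<le> diff_const k \<sigma> TYPE('a) * cut_energy f T"
proof -
  obtain y where y: "y \<in> T" "y \<notin> \<Omega>" using T(2) by blast
  have "(f x - f y)\<^sup>2 * diameter T ^ (DIM('a) - 2) \<le> diff_const k \<sigma> TYPE('a) * elem_energy T f"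
    by (rule V_h_diff_le_energy[OF T(1) f x y(1)])
  also have "\<dots> \<le> diff_const k \<sigma> TYPE('a) * cut_energy f T"
    by (intro mult_left_mono cut_energy_ge[OF T(1)] diff_const_nonneg)
  finally show ?thesis using V_h_outside[OF f y(2)] by simp
qed

text \<open>\<open>f x\<close> is compared with \<open>f y\<close>, for \<open>y\<close> on the
  interface in \<open>T'\<close>, by way of a common vertex; integration over \<open>y\<close>
  brings in the interface term. So it is \<open>T'\<close>, not \<open>T\<close>, that must hold
  enough of the interface.\<close>

lemma value_le_cut_energy_interior:
  assumes f: "f \<in> V_h k \<Omega> \<T>" and T: "T \<in> \<T>" "T \<subseteq> \<Omega>" and T': "T' \<in> \<T>" "adjacent T T'" and x: "x \<in> T"
    and c: "0 < c" and \<mu>: "c * diameter T ^ (DIM('a) - 1) \<le> \<Gamma>_measure (T' \<inter> interface D)"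
  shows "(f x)\<^sup>2 * diameter T ^ (DIM('a) - 2)
    \<le> (3 * diff_const k \<sigma> TYPE('a) + 3 * size_ratio \<sigma> DIM('a) ^ (DIM('a) - 2) * diff_const k \<sigma> TYPE('a) + 3 * size_ratio \<sigma> DIM('a) / c)
       * (cut_energy f T + cut_energy f T')"
proof -
  let ?h = "diameter T" and ?h' = "diameter T'" and ?\<Lambda> = "size_ratio \<sigma> DIM('a)" and ?n = "DIM('a) - 2"
  let ?A = "T' \<inter> interface D"
  define J where "J = (LINT y:?A|surf. f y * f y)"
  obtain v where v: "v extreme_point_of T" "v extreme_point_of T'" using T'(2) by (auto simp: adjacent_def)
  have v\<Omega>: "v \<in> \<Omega>" using v(1) T(2) verts_in by blast
  have h: "0 < ?h" "0 < ?h'" using diam_element_pos T(1) T'(1) by auto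
  have hh: "?h \<le> ?\<Lambda> * ?h'" "?h' \<le> ?\<Lambda> * ?h"
    using adjacent_diameter_le[OF T(1) T'(1) v v\<Omega>] adjacent_diameter_le[OF T'(1) T(1) v(2,1) v\<Omega>] by auto
  have \<Lambda>: "1 \<le> ?\<Lambda>" by (rule size_ratio_ge_1[OF T(1)])
  \<comment> \<open>What the energies of \<open>T\<close> and \<open>T'\<close> leave of the
    weighted square of \<open>f x\<close>; it does not depend on \<open>y\<close> and can be
    integrated over \<open>?A\<close>.\<close>
  define Z where "Z = (f x)\<^sup>2 * ?h ^ ?n - 3 * diff_const k \<sigma> TYPE('a) * elem_energy T f - 3 * ?\<Lambda> ^ ?n * diff_const k \<sigma> TYPE('a) * elem_energy T' f"
  have point: "Z \<le> 3 * ?h ^ ?n * (f y * f y)" if y: "y \<in> ?A" for y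
  proof -
    have 1: "(f x - f v)\<^sup>2 * ?h ^ ?n \<le> diff_const k \<sigma> TYPE('a) * elem_energy T f"
      by (rule V_h_diff_le_energy[OF T(1) f x verts_in[OF v(1)]])
    have "(f v - f y)\<^sup>2 * ?h ^ ?n \<le> (f v - f y)\<^sup>2 * (?\<Lambda> * ?h') ^ ?n"
      using hh(1) h by (intro mult_left_mono power_mono) auto
    also have "\<dots> = ?\<Lambda> ^ ?n * ((f v - f y)\<^sup>2 * ?h' ^ ?n)" by (simp add: power_mult_distrib)
    also have "\<dots> \<le> ?\<Lambda> ^ ?n * (diff_const k \<sigma> TYPE('a) * elem_energy T' f)"
      using \<Lambda> verts_in[OF v(2)] y
      by (intro mult_left_mono V_h_diff_le_energy[OF T'(1) f]) auto
    finally have 2: "(f v - f y)\<^sup>2 * ?h ^ ?n \<le> ?\<Lambda> ^ ?n * (diff_const k \<sigma> TYPE('a) * elem_energy T' f)" .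
    have "(f x)\<^sup>2 \<le> 3 * (f x - f v)\<^sup>2 + 3 * (f v - f y)\<^sup>2 + 3 * (f y)\<^sup>2"
    proof -
      define a b c where "a = f x - f v" "b = f v - f y" "c = f y"
      have "0 \<le> (a - b)\<^sup>2 + (b - c)\<^sup>2 + (a - c)\<^sup>2" by simp
      then have "(a + b + c)\<^sup>2 \<le> 3 * a\<^sup>2 + 3 * b\<^sup>2 + 3 * c\<^sup>2" by (simp add: power2_eq_square algebra_simps)
      then show ?thesis by (simp add: a_b_c_def)
    qed
    then have "(f x)\<^sup>2 * ?h ^ ?n \<le> (3 * (f x - f v)\<^sup>2 + 3 * (f v - f y)\<^sup>2 + 3 * (f y)\<^sup>2) * ?h ^ ?n"
      using h by (intro mult_right_mono) auto
    also have "\<dots> = 3 * ((f x - f v)\<^sup>2 * ?h ^ ?n) + 3 * ((f v - f y)\<^sup>2 * ?h ^ ?n) + 3 * ?h ^ ?n * (f y * f y)"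
      by (simp add: power2_eq_square algebra_simps)
    finally show ?thesis using 1 2 by (simp add: Z_def)
  qed
  have A: "?A \<in> sets borel" using closed_element[OF T'(1)] closed_interface by (intro borel_closed) auto
  have finA: "emeasure (surf :: 'a measure) ?A < \<infinity>" by (rule emeasure_surf_finite[OF A]) simp
  have "\<Gamma>_measure ?A * Z = (LINT y:?A|surf. Z)"
    using A finA by (simp add: set_lebesgue_integral_def mult.commute)
  also have "\<dots> \<le> (LINT y:?A|surf. 3 * ?h ^ ?n * (f y * f y))"
  proof (rule set_integral_mono[OF _ _ point])
    show "set_integrable surf ?A (\<lambda>y. Z)"
      unfolding set_integrable_def using finA A by (intro integrable_scaleR_left integrable_real_indicator) auto
    show "set_integrable surf ?A (\<lambda>y. 3 * ?h ^ ?n * (f y * f y))"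
      by (intro set_integrable_mult_right surf_integrable[OF f T'(1)])
  qed
  also have "\<dots> = 3 * ?h ^ ?n * J" by (simp add: J_def)
  finally have \<mu>Z: "\<Gamma>_measure ?A * Z \<le> 3 * ?h ^ ?n * J" .
  have J0: "0 \<le> J" unfolding J_def by (rule interface_integral_nonneg)
  have Z_le: "Z \<le> 3 * ?\<Lambda> / c * (inverse ?h' * J)"
  proof (cases "Z \<le> 0")
    case True
    have "0 \<le> 3 * ?\<Lambda> / c * (inverse ?h' * J)" using \<Lambda> c h J0 by simp
    then show ?thesis using True by linarith
  next
    case False
    \<comment> \<open>For positive \<open>Z\<close> the measure may be replaced by its lower bound;
      the weight \<open>?h ^ ?n\<close> then cancels and leaves one factor \<open>?h\<close>,
      matching the scaling of the interface term.\<close>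
    have "c * ?h ^ (DIM('a) - 1) * Z \<le> \<Gamma>_measure ?A * Z" using \<mu> False by (intro mult_right_mono) auto
    then have "c * ?h ^ (DIM('a) - 1) * Z \<le> 3 * ?h ^ ?n * J" using \<mu>Z by linarith
    moreover have "?h ^ (DIM('a) - 1) = ?h * ?h ^ ?n" using dim by (metis Suc_diff_le Suc_1 diff_Suc_Suc power_Suc)
    ultimately have "?h ^ ?n * (c * ?h * Z) \<le> ?h ^ ?n * (3 * J)" by (simp add: mult_ac)
    then have "c * ?h * Z \<le> 3 * J" using h by simp
    then have "Z \<le> 3 * J / (c * ?h)" using c h by (simp add: pos_le_divide_eq mult.commute)
    also have "\<dots> \<le> 3 * ?\<Lambda> / c * (inverse ?h' * J)"
    proof -
      have "inverse ?h \<le> ?\<Lambda> * inverse ?h'" using hh(2) h by (simp add: field_simps)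
      then have "3 * J / c * inverse ?h \<le> 3 * J / c * (?\<Lambda> * inverse ?h')" using J0 c by (intro mult_left_mono) auto
      then show ?thesis using h c by (simp add: field_simps)
    qed
    finally show ?thesis .
  qed
  define a where "a = 3 * diff_const k \<sigma> TYPE('a)"
  define b where "b = 3 * ?\<Lambda> ^ ?n * diff_const k \<sigma> TYPE('a)"
  define d where "d = 3 * ?\<Lambda> / c"
  have abd: "0 \<le> a" "0 \<le> b" "0 \<le> d" using diff_const_nonneg \<Lambda> c by (auto simp: a_def b_def d_def)
  have E: "0 \<le> cut_energy f T" "0 \<le> cut_energy f T'" "elem_energy T f \<le> cut_energy f T"
      "elem_energy T' f + inverse ?h' * J = cut_energy f T'" "0 \<le> elem_energy T' f" "0 \<le> inverse ?h' * J"
    using cut_energy_nonneg cut_energy_ge T(1) T'(1) elem_energy_nonneg J0 h by (auto simp: cut_energy_def J_def)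
  have "(f x)\<^sup>2 * ?h ^ ?n \<le> a * elem_energy T f + b * elem_energy T' f + d * (inverse ?h' * J)"
    using Z_le by (simp add: Z_def a_def b_def d_def)
  also have "\<dots> \<le> a * (cut_energy f T + cut_energy f T') + b * (cut_energy f T + cut_energy f T') + d * (cut_energy f T + cut_energy f T')"
    using E abd by (intro add_mono mult_left_mono) auto
  also have "\<dots> = (a + b + d) * (cut_energy f T + cut_energy f T')" by (simp add: algebra_simps)
  finally show ?thesis by (simp add: a_def b_def d_def)
qed

lemma h_inner_eq: "h_inner D \<T> f f = (\<Sum>T\<in>cut_mesh \<T> D. inverse (diameter T) * (LINT x:T \<inter> interface D|surf. f x * f x))"
  by (simp add: h_inner_def)

text \<open>Each element serves as neighbour \<open>T'\<close> at most as often as it has adjacent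
  elements; interchanging the double sum turns this count into the factor.\<close>

lemma sum_values_le_cut_energy:
  assumes f: "f \<in> V_h k \<Omega> \<T>" and x: "\<And>T. T \<in> cut_mesh \<T> D \<Longrightarrow> x T \<in> T" and "0 \<le> K"
    and loc: "\<And>T. T \<in> cut_mesh \<T> D \<Longrightarrow> \<exists>T'\<in>cut_mesh \<T> D. adjacent T T' \<and>
      (f (x T))\<^sup>2 * diameter T ^ (DIM('a) - 2) \<le> K * (cut_energy f T + cut_energy f T')"
  shows "(\<Sum>T\<in>cut_mesh \<T> D. (f (x T))\<^sup>2 * diameter T ^ (DIM('a) - 2))
    \<le> K * (1 + real (Suc DIM('a) * overlap_bound \<sigma> DIM('a))) * (\<Sum>T\<in>cut_mesh \<T> D. cut_energy f T)"
proof -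
  let ?C = "cut_mesh \<T> D" and ?N = "Suc DIM('a) * overlap_bound \<sigma> DIM('a)"
  have fin: "finite ?C" using finite_mesh cut_mesh_subset finite_subset by blast
  have E0: "0 \<le> cut_energy f T" if "T \<in> ?C" for T using that cut_energy_nonneg cut_mesh_subset by blast
  have "(\<Sum>T\<in>?C. (f (x T))\<^sup>2 * diameter T ^ (DIM('a) - 2))
     \<le> (\<Sum>T\<in>?C. K * (cut_energy f T + (\<Sum>T'\<in>{T'\<in>?C. adjacent T T'}. cut_energy f T')))"
  proof (rule sum_mono)
    fix T assume T: "T \<in> ?C"
    obtain T' where T': "T' \<in> ?C" "adjacent T T'" "(f (x T))\<^sup>2 * diameter T ^ (DIM('a) - 2) \<le> K * (cut_energy f T + cut_energy f T')"
      using loc[OF T] by blast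
    have "cut_energy f T' \<le> (\<Sum>T'\<in>{T'\<in>?C. adjacent T T'}. cut_energy f T')"
      using T' fin E0 by (intro member_le_sum) auto
    then have "K * (cut_energy f T + cut_energy f T') \<le> K * (cut_energy f T + (\<Sum>T'\<in>{T'\<in>?C. adjacent T T'}. cut_energy f T'))"
      using \<open>0 \<le> K\<close> by (intro mult_left_mono) auto
    then show "(f (x T))\<^sup>2 * diameter T ^ (DIM('a) - 2) \<le> K * (cut_energy f T + (\<Sum>T'\<in>{T'\<in>?C. adjacent T T'}. cut_energy f T'))"
      using T'(3) by linarith
  qed
  also have "\<dots> = K * ((\<Sum>T\<in>?C. cut_energy f T) + (\<Sum>T\<in>?C. \<Sum>T'\<in>{T'\<in>?C. adjacent T T'}. cut_energy f T'))"
    by (simp add: sum_distrib_left[symmetric] sum.distrib)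
  also have "(\<Sum>T\<in>?C. \<Sum>T'\<in>{T'\<in>?C. adjacent T T'}. cut_energy f T') = (\<Sum>T'\<in>?C. \<Sum>T\<in>{T\<in>?C. adjacent T T'}. cut_energy f T')"
    by (rule sum.swap_restrict[OF fin fin])
  also have "K * ((\<Sum>T\<in>?C. cut_energy f T) + \<dots>) \<le> K * ((\<Sum>T\<in>?C. cut_energy f T) + real ?N * (\<Sum>T'\<in>?C. cut_energy f T'))"
  proof (intro mult_left_mono add_left_mono \<open>0 \<le> K\<close>)
    have "(\<Sum>T'\<in>?C. \<Sum>T\<in>{T\<in>?C. adjacent T T'}. cut_energy f T') \<le> (\<Sum>T'\<in>?C. real ?N * cut_energy f T')"
    proof (rule sum_mono)
      fix T' assume T': "T' \<in> ?C"
      have "card {T\<in>?C. adjacent T T'} \<le> card {T\<in>\<T>. adjacent T T'}" using finite_mesh cut_mesh_subset by (intro card_mono) auto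
      also have "\<dots> \<le> ?N" using card_adjacent T' cut_mesh_subset by blast
      finally have "real (card {T\<in>?C. adjacent T T'}) \<le> real ?N" by (simp only: of_nat_le_iff)
      then show "(\<Sum>T\<in>{T\<in>?C. adjacent T T'}. cut_energy f T') \<le> real ?N * cut_energy f T'"
        using E0[OF T'] by (simp only: sum_constant) (rule mult_right_mono)
    qed
    then show "(\<Sum>T'\<in>?C. \<Sum>T\<in>{T\<in>?C. adjacent T T'}. cut_energy f T') \<le> real ?N * (\<Sum>T'\<in>?C. cut_energy f T')"
      by (simp only: sum_distrib_left)
  qed
  also have "\<dots> = K * (1 + real ?N) * (\<Sum>T\<in>?C. cut_energy f T)" by (simp add: algebra_simps)
  finally show ?thesis .
qed

end

section \<open>Norms of the splitting\<close>

context cut_mesh_setting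
begin

text \<open>\<open>b\<close> is the share from the pigeonhole argument, and \<open>K\<close> adds
  the constants for elements reaching the boundary and for those inside \<open>\<Omega>\<close>.
  None of them refers to the mesh.\<close>

lemma values_le_cut_energy:
  assumes \<epsilon>: "0 < \<epsilon>" and ball: "\<And>x \<rho>. x \<in> interface D \<Longrightarrow> 0 < \<rho> \<Longrightarrow> \<rho> \<le> \<epsilon> \<Longrightarrow> ball x \<rho> \<subseteq> \<Omega> \<Longrightarrow>
           ennreal (\<epsilon> * \<rho> ^ (DIM('a) - 1)) \<le> hausdorff_outer (DIM('a) - 1) (interface D \<inter> ball x \<rho>)"
    and c: "0 < c" "c * (real (Suc DIM('a)) * \<sigma> * size_ratio \<sigma> DIM('a)) \<le> 1" "c * diameter (closure \<Omega>) \<le> \<epsilon>"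
    and b: "b = \<epsilon> * c ^ (DIM('a) - 1) / real (Suc DIM('a) * overlap_bound \<sigma> DIM('a))"
    and K: "K = diff_const k \<sigma> TYPE('a) + (3 * diff_const k \<sigma> TYPE('a) + 3 * size_ratio \<sigma> DIM('a) ^ (DIM('a) - 2) * diff_const k \<sigma> TYPE('a) + 3 * size_ratio \<sigma> DIM('a) / b)"
    and f: "f \<in> V_h k \<Omega> \<T>" and x: "\<And>T. T \<in> cut_mesh \<T> D \<Longrightarrow> x T \<in> T"
  shows "(\<Sum>T\<in>cut_mesh \<T> D. (f (x T))\<^sup>2 * diameter T ^ (DIM('a) - 2))
    \<le> K * (1 + real (Suc DIM('a) * overlap_bound \<sigma> DIM('a))) * (\<Sum>T\<in>cut_mesh \<T> D. cut_energy f T)"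
proof (cases "cut_mesh \<T> D = {}")
  case False
  \<comment> \<open>The existence of an element gives \<open>\<sigma> \<ge> 1\<close>, on which the
    signs of the constants rest.\<close>
  then obtain T0 where T0: "T0 \<in> \<T>" using cut_mesh_subset by blast
  let ?N = "real (Suc DIM('a) * overlap_bound \<sigma> DIM('a))"
  have N: "0 < ?N" using overlap_bound_pos[OF T0] by (simp only: of_nat_0_less_iff) simp
  have b0: "0 < b" unfolding b using \<epsilon> c(1) N by (intro divide_pos_pos mult_pos_pos zero_less_power)
  have sr: "1 \<le> size_ratio \<sigma> DIM('a)" by (rule size_ratio_ge_1[OF T0])
  define K' where "K' = 3 * diff_const k \<sigma> TYPE('a) + 3 * size_ratio \<sigma> DIM('a) ^ (DIM('a) - 2) * diff_const k \<sigma> TYPE('a) + 3 * size_ratio \<sigma> DIM('a) / b"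
  have K'0: "0 \<le> K'" unfolding K'_def using diff_const_nonneg sr b0 by (intro add_nonneg_nonneg mult_nonneg_nonneg divide_nonneg_nonneg) auto
  have KK: "K = diff_const k \<sigma> TYPE('a) + K'" "0 \<le> K" using K K'0 diff_const_nonneg by (auto simp: K'_def)
  show ?thesis
  proof (rule sum_values_le_cut_energy[OF f x KK(2)])
    fix T assume T: "T \<in> cut_mesh \<T> D"
    then have TM: "T \<in> \<T>" using cut_mesh_subset by blast
    show "\<exists>T'\<in>cut_mesh \<T> D. adjacent T T' \<and> (f (x T))\<^sup>2 * diameter T ^ (DIM('a) - 2) \<le> K * (cut_energy f T + cut_energy f T')"
    proof (cases "T \<subseteq> \<Omega>")
      case True
      obtain T' where T': "T' \<in> cut_mesh \<T> D" "adjacent T T'"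
        "\<epsilon> * (c * diameter T) ^ (DIM('a) - 1) \<le> ?N * \<Gamma>_measure (T' \<inter> interface D)"
        by (rule large_interface_neighbour[OF \<epsilon> ball c T True])
      have T'M: "T' \<in> \<T>" using T'(1) cut_mesh_subset by blast
      have "b * diameter T ^ (DIM('a) - 1) = \<epsilon> * (c * diameter T) ^ (DIM('a) - 1) / ?N"
        by (simp only: b power_mult_distrib) simp
      also have "\<dots> \<le> \<Gamma>_measure (T' \<inter> interface D)" using T'(3) N by (simp only: pos_divide_le_eq mult.commute)
      finally have "(f (x T))\<^sup>2 * diameter T ^ (DIM('a) - 2) \<le> K' * (cut_energy f T + cut_energy f T')"
        unfolding K'_def by (rule value_le_cut_energy_interior[OF f TM True T'M T'(2) x[OF T] b0])
      also have "\<dots> \<le> K * (cut_energy f T + cut_energy f T')"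
        using KK diff_const_nonneg cut_energy_nonneg[OF TM] cut_energy_nonneg[OF T'M] by (intro mult_right_mono) auto
      finally show ?thesis using T' by blast
    next
      case False
      have "(f (x T))\<^sup>2 * diameter T ^ (DIM('a) - 2) \<le> diff_const k \<sigma> TYPE('a) * cut_energy f T"
        by (rule value_le_cut_energy_boundary[OF f TM False x[OF T]])
      also have "\<dots> \<le> K * (cut_energy f T + cut_energy f T)"
        using KK K'0 diff_const_nonneg cut_energy_nonneg[OF TM] by (intro mult_mono) auto
      finally have "(f (x T))\<^sup>2 * diameter T ^ (DIM('a) - 2) \<le> K * (cut_energy f T + cut_energy f T)" .
      moreover have "adjacent T T"
      proof -
        have "verts T \<noteq> {}" using card_verts[OF TM] by (metis card.empty nat.distinct(1))
        then show ?thesis by (auto simp: adjacent_def)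
      qed
      ultimately show ?thesis using T by blast
    qed
  qed
qed simp

section \<open>The cut components as finite element functions\<close>

lemma finite_cut_nodes: "finite (cut_nodes k \<Omega> D \<T>)"
  unfolding cut_nodes_def using finite_nodes[OF k] by blast

text \<open>The image under \<open>Q\<close> before restriction to the cut elements. It lies in
  \<open>V_h\<close>, where the estimates above apply, and agrees with \<open>Q\<close> on the
  elements of \<open>ex_mesh \<T> (D i)\<close>.\<close>

definition cut_part :: "('a \<Rightarrow> real) \<Rightarrow> nat \<Rightarrow> 'a \<Rightarrow> real" where
  "cut_part c i x = (\<Sum>j\<in>cut_nodes k \<Omega> D \<T> - D i. c j * nodal_basis k \<Omega> \<T> j x)"

lemma cut_part_V_h: "cut_part c i \<in> V_h k \<Omega> \<T>"
  unfolding cut_part_def[abs_def]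
  by (intro V_h_sum V_h_cmult nodal_basis_V_h[OF k]) (auto simp: cut_nodes_def)

lemma sum_nodal_basis_node:
  assumes z: "z \<in> nodes k \<Omega> \<T>" and S: "S \<subseteq> cut_nodes k \<Omega> D \<T>"
  shows "(\<Sum>j\<in>S. c j * nodal_basis k \<Omega> \<T> j z) = (if z \<in> S then c z else 0)"
proof -
  have "(\<Sum>j\<in>S. c j * nodal_basis k \<Omega> \<T> j z) = (\<Sum>j\<in>S. if j = z then c j else 0)"
    using nodal_basis_node[OF k _ z] S by (intro sum.cong) (auto simp: cut_nodes_def)
  then show ?thesis using finite_subset[OF S finite_cut_nodes] by (simp add: sum.delta)
qed

lemma cut_part_node:
  "z \<in> nodes k \<Omega> \<T> \<Longrightarrow> cut_part c i z = (if z \<in> cut_nodes k \<Omega> D \<T> \<and> z \<notin> D i then c z else 0)"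
  unfolding cut_part_def by (subst sum_nodal_basis_node) auto

lemma sum_cut_basis:
  "(\<Sum>j\<in>S. c j * cut_basis k \<Omega> D \<T> j x) = restr (\<Union>(cut_mesh \<T> D)) (\<lambda>x. \<Sum>j\<in>S. c j * nodal_basis k \<Omega> \<T> j x) x"
  by (simp add: cut_basis_def restr_def)

text \<open>The coefficients are the values at the nodes, so the definite description in
  \<open>Q\<close> has a unique solution.\<close>

lemma Q_eq:
  assumes u: "u = (\<lambda>x. \<Sum>j\<in>cut_nodes k \<Omega> D \<T>. c j * cut_basis k \<Omega> D \<T> j x)"
  shows "Q k \<Omega> D \<T> i u = restr (\<Union>(cut_mesh \<T> D)) (cut_part c i)"
proof -
  let ?N = "cut_nodes k \<Omega> D \<T>"
  have coeff: "c' z = u z" if "u = (\<lambda>x. \<Sum>j\<in>?N. c' j * cut_basis k \<Omega> D \<T> j x)" "z \<in> ?N" for c' z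
    using that sum_nodal_basis_node[of z ?N c'] by (simp add: sum_cut_basis restr_def cut_nodes_def)
  have "Q k \<Omega> D \<T> i u = (\<lambda>x. \<Sum>j\<in>?N - D i. c j * cut_basis k \<Omega> D \<T> j x)"
    unfolding Q_def
  proof (rule the_equality)
    show "\<exists>c'. u = (\<lambda>x. \<Sum>j\<in>?N. c' j * cut_basis k \<Omega> D \<T> j x) \<and>
       (\<lambda>x. \<Sum>j\<in>?N - D i. c j * cut_basis k \<Omega> D \<T> j x) = (\<lambda>x. \<Sum>j\<in>?N - D i. c' j * cut_basis k \<Omega> D \<T> j x)"
      using u by blast
    fix w assume "\<exists>c'. u = (\<lambda>x. \<Sum>j\<in>?N. c' j * cut_basis k \<Omega> D \<T> j x) \<and> w = (\<lambda>x. \<Sum>j\<in>?N - D i. c' j * cut_basis k \<Omega> D \<T> j x)"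
    then obtain c' where c': "u = (\<lambda>x. \<Sum>j\<in>?N. c' j * cut_basis k \<Omega> D \<T> j x)" "w = (\<lambda>x. \<Sum>j\<in>?N - D i. c' j * cut_basis k \<Omega> D \<T> j x)"
      by blast
    have "c' j = c j" if "j \<in> ?N" for j using coeff[OF c'(1) that] coeff[OF u that] by simp
    then show "w = (\<lambda>x. \<Sum>j\<in>?N - D i. c j * cut_basis k \<Omega> D \<T> j x)" unfolding c'(2) by simp
  qed
  then show ?thesis by (simp add: sum_cut_basis cut_part_def[abs_def])
qed

text \<open>So \<open>Q\<^sub>i u\<close>, which is extended by zero off the cut elements, is polynomial on each element of
  \<open>\<Omega>\<^sub>i\<^sub>,\<^sub>h\<^sup>e\<^sup>x\<close>, its boundary included.\<close>

lemma cut_part_uncut: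
  assumes "T \<in> ex_mesh \<T> (D i)" "T \<notin> cut_mesh \<T> D" "i \<in> {1, 2}" "x \<in> T"
  shows "cut_part c i x = 0"
proof (rule V_h_eq_0[OF k cut_part_V_h _ _ assms(4)])
  show "T \<in> \<T>" using assms(1) by (simp add: ex_mesh_def)
  fix z assume "z \<in> nodes k \<Omega> \<T>" "z \<in> T"
  then show "cut_part c i z = 0" using uncut_nodes[OF assms(1-3)] cut_part_node by simp
qed

lemma Q_on_ex_mesh:
  assumes u: "u = (\<lambda>x. \<Sum>j\<in>cut_nodes k \<Omega> D \<T>. c j * cut_basis k \<Omega> D \<T> j x)"
    and "T \<in> ex_mesh \<T> (D i)" "i \<in> {1, 2}" "x \<in> T"
  shows "Q k \<Omega> D \<T> i u x = cut_part c i x"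
proof (cases "T \<in> cut_mesh \<T> D")
  case True
  then show ?thesis using assms(4) by (auto simp: Q_eq[OF u] restr_def)
next
  case False
  then show ?thesis using cut_part_uncut[OF assms(2) False assms(3,4)] by (auto simp: Q_eq[OF u] restr_def)
qed

lemma ex_mesh_subset: "ex_mesh \<T> S \<subseteq> \<T>" by (auto simp: ex_mesh_def)

text \<open>Both quantities reduce to the same sum over members of \<open>V_h\<close>, since
  \<open>u0\<close> cancels in the jump. This links the given norm equivalence to the
  b-norm.\<close>

lemma b_norm_sq_eq:
  assumes u: "u = (\<lambda>x. \<Sum>j\<in>cut_nodes k \<Omega> D \<T>. c j * cut_basis k \<Omega> D \<T> j x)" and u0: "u0 \<in> V_h k \<Omega> \<T>"
    and W: "W = (\<lambda>x. cut_part c 1 x - cut_part c 2 x)"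
  shows "b_norm_sq k \<Omega> D \<T> (u0, u)
    = (\<Sum>i\<in>{1, 2}. \<Sum>T\<in>ex_mesh \<T> (D i). elem_energy T (\<lambda>x. u0 x + cut_part c i x)) + h_inner D \<T> W W"
    and "cut_norm_sq D \<T> (L k \<Omega> D \<T> (u0, u))
    = (\<Sum>i\<in>{1, 2}. \<Sum>T\<in>ex_mesh \<T> (D i). elem_energy T (\<lambda>x. u0 x + cut_part c i x)) + h_inner D \<T> W W"
proof -
  have E: "elem_energy T (\<lambda>x. u0 x + Q k \<Omega> D \<T> i u x) = elem_energy T (\<lambda>x. u0 x + cut_part c i x)"
    "elem_energy T (L k \<Omega> D \<T> (u0, u) i) = elem_energy T (\<lambda>x. u0 x + cut_part c i x)"
    if i: "i \<in> {1, 2}" and T: "T \<in> ex_mesh \<T> (D i)" for i T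
  proof -
    have TM: "T \<in> \<T>" using T ex_mesh_subset by blast
    have V: "(\<lambda>x. u0 x + cut_part c i x) \<in> V_h k \<Omega> \<T>" by (intro V_h_add u0 cut_part_V_h)
    show "elem_energy T (\<lambda>x. u0 x + Q k \<Omega> D \<T> i u x) = elem_energy T (\<lambda>x. u0 x + cut_part c i x)"
      by (rule elem_energy_cong[OF TM V]) (simp add: Q_on_ex_mesh[OF u T i])
    have "L k \<Omega> D \<T> (u0, u) i x = u0 x + cut_part c i x" if x: "x \<in> T" for x
    proof -
      have "x \<in> \<Union>(ex_mesh \<T> (D i))" using T x by blast
      then show ?thesis by (simp only: L_def restr_def fst_conv snd_conv if_True Q_on_ex_mesh[OF u T i x])
    qed
    then show "elem_energy T (L k \<Omega> D \<T> (u0, u) i) = elem_energy T (\<lambda>x. u0 x + cut_part c i x)"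
      by (rule elem_energy_cong[OF TM V])
  qed
  have cong: "h_inner D \<T> f f = h_inner D \<T> W W" if f: "\<And>T x. T \<in> cut_mesh \<T> D \<Longrightarrow> x \<in> T \<Longrightarrow> f x = W x" for f
    unfolding h_inner_def
  proof (intro sum.cong refl arg_cong2[where f = "(*)"])
    fix T assume T: "T \<in> cut_mesh \<T> D"
    have "T \<inter> interface D \<in> sets surf"
    proof -
      have "T \<in> \<T>" using T cut_mesh_subset by blast
      then have "closed (T \<inter> interface D)" using closed_element closed_interface by blast
      then show ?thesis by (simp add: borel_closed)
    qed
    then show "(LINT x:T \<inter> interface D|surf. f x * f x) = (LINT x:T \<inter> interface D|surf. W x * W x)"
      using f[OF T] by (intro set_lebesgue_integral_cong) auto
  qed
  show "b_norm_sq k \<Omega> D \<T> (u0, u)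
    = (\<Sum>i\<in>{1, 2}. \<Sum>T\<in>ex_mesh \<T> (D i). elem_energy T (\<lambda>x. u0 x + cut_part c i x)) + h_inner D \<T> W W"
    unfolding b_norm_sq_def Let_def grad_norm_sq_eq fst_conv snd_conv
  proof (intro arg_cong2[where f = "(+)"] sum.cong refl E cong)
    fix T x assume "T \<in> cut_mesh \<T> D" "x \<in> T"
    then show "Q k \<Omega> D \<T> 1 u x - Q k \<Omega> D \<T> 2 u x = W x"
      by (simp add: W Q_on_ex_mesh[OF u cut_in_ex_mesh[of T]])
  qed
  show "cut_norm_sq D \<T> (L k \<Omega> D \<T> (u0, u))
    = (\<Sum>i\<in>{1, 2}. \<Sum>T\<in>ex_mesh \<T> (D i). elem_energy T (\<lambda>x. u0 x + cut_part c i x)) + h_inner D \<T> W W"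
    unfolding cut_norm_sq_def grad_norm_sq_eq
  proof (intro arg_cong2[where f = "(+)"] sum.cong refl E cong)
    fix T x assume T: "T \<in> cut_mesh \<T> D" "x \<in> T"
    have "x \<in> \<Union>(ex_mesh \<T> (D 1))" "x \<in> \<Union>(ex_mesh \<T> (D 2))" using cut_in_ex_mesh[OF T(1)] T(2) by blast+
    then show "jump (L k \<Omega> D \<T> (u0, u)) x = W x"
      using T by (simp add: jump_def L_def restr_def W Q_on_ex_mesh[OF u cut_in_ex_mesh[of T]])
  qed
qed

lemma V_hatE:
  assumes "u \<in> V_hat k \<Omega> D \<T>"
  obtains u0 w c where "u = (u0, w)" "u0 \<in> V_h k \<Omega> \<T>" "w = (\<lambda>x. \<Sum>j\<in>cut_nodes k \<Omega> D \<T>. c j * cut_basis k \<Omega> D \<T> j x)"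
  using assms by (cases u) (auto simp: V_hat_def V_cut_def)

lemma P0_V_hat: "u \<in> V_hat k \<Omega> D \<T> \<Longrightarrow> P0 u \<in> V_hat k \<Omega> D \<T>"
  by (auto simp: V_hat_def V_cut_def P0_def intro!: exI[of _ "\<lambda>_. 0"])

lemma P1_V_hat: "u \<in> V_hat k \<Omega> D \<T> \<Longrightarrow> P1 u \<in> V_hat k \<Omega> D \<T>"
  by (auto simp: V_hat_def P1_def V_h_0)

lemma cut_norm_sq_L:
  assumes "u \<in> V_hat k \<Omega> D \<T>" shows "cut_norm_sq D \<T> (L k \<Omega> D \<T> u) = b_norm_sq k \<Omega> D \<T> u"
proof -
  obtain u0 w c where "u = (u0, w)" "u0 \<in> V_h k \<Omega> \<T>" "w = (\<lambda>x. \<Sum>j\<in>cut_nodes k \<Omega> D \<T>. c j * cut_basis k \<Omega> D \<T> j x)"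
    by (rule V_hatE[OF assms])
  then show ?thesis using b_norm_sq_eq[of w c u0, OF _ _ refl] by simp
qed

text \<open>\<open>Z\<close>, \<open>S\<close> and \<open>A\<close> are the gradient parts of
  \<open>P0 u\<close>, \<open>P1 u\<close> and \<open>u\<close>; the interface term \<open>J\<close>
  is common to \<open>P1 u\<close> and \<open>u\<close>. Everything hinges on a bound for
  \<open>S\<close>.\<close>

lemma b_norm_splitting:
  assumes K: "0 \<le> K" and vals: "\<And>f x. f \<in> V_h k \<Omega> \<T> \<Longrightarrow> (\<And>T. T \<in> cut_mesh \<T> D \<Longrightarrow> x T \<in> T) \<Longrightarrow>
      (\<Sum>T\<in>cut_mesh \<T> D. (f (x T))\<^sup>2 * diameter T ^ (DIM('a) - 2)) \<le> K * (\<Sum>T\<in>cut_mesh \<T> D. cut_energy f T)"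
    and B: "B = (shape_const k TYPE('a) * \<sigma>)\<^sup>2 * unit_ball_vol (real DIM('a))"
    and u: "u \<in> V_hat k \<Omega> D \<T>"
  shows "b_norm_sq k \<Omega> D \<T> u \<le> 2 * (b_norm_sq k \<Omega> D \<T> (P0 u) + b_norm_sq k \<Omega> D \<T> (P1 u))"
    and "b_norm_sq k \<Omega> D \<T> (P0 u) + b_norm_sq k \<Omega> D \<T> (P1 u) \<le> (2 + 12 * B * K) * b_norm_sq k \<Omega> D \<T> u"
proof -
  obtain u0 w c where u': "u = (u0, w)" and u0: "u0 \<in> V_h k \<Omega> \<T>" and w: "w = (\<lambda>x. \<Sum>j\<in>cut_nodes k \<Omega> D \<T>. c j * cut_basis k \<Omega> D \<T> j x)"
    by (rule V_hatE[OF u])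
  let ?E = "\<lambda>f. \<Sum>i\<in>{1, 2::nat}. \<Sum>T\<in>ex_mesh \<T> (D i). elem_energy T (f i)"
  let ?C = "cut_mesh \<T> D"
  define W where "W = (\<lambda>x. cut_part c 1 x - cut_part c 2 x)"
  define J where "J = h_inner D \<T> W W"
  define A where "A = ?E (\<lambda>i x. u0 x + cut_part c i x)"
  define S where "S = ?E (\<lambda>i. cut_part c i)"
  define Z where "Z = ?E (\<lambda>i. u0)"
  note VW = cut_part_V_h[of c]
  have finex: "finite (ex_mesh \<T> S)" "finite ?C" for S using finite_mesh ex_mesh_subset cut_mesh_subset finite_subset by blast+
  have bu: "b_norm_sq k \<Omega> D \<T> u = A + J"
    unfolding u' A_def J_def by (rule b_norm_sq_eq(1)[OF w u0 W_def])
  have zero: "(\<lambda>x. 0) = (\<lambda>x. \<Sum>j\<in>cut_nodes k \<Omega> D \<T>. (\<lambda>_. 0) j * cut_basis k \<Omega> D \<T> j x)" by simp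
  have cp0: "cut_part (\<lambda>_. 0) i x = 0" for i x by (simp add: cut_part_def)
  have b0: "b_norm_sq k \<Omega> D \<T> (P0 u) = Z"
  proof -
    have "b_norm_sq k \<Omega> D \<T> (u0, \<lambda>x. 0) = ?E (\<lambda>i x. u0 x + cut_part (\<lambda>_. 0) i x)
        + h_inner D \<T> (\<lambda>x. cut_part (\<lambda>_. 0) 1 x - cut_part (\<lambda>_. 0) 2 x) (\<lambda>x. cut_part (\<lambda>_. 0) 1 x - cut_part (\<lambda>_. 0) 2 x)"
      by (rule b_norm_sq_eq(1)[OF zero u0 refl])
    then show ?thesis by (simp add: u' P0_def cp0 h_inner_def Z_def)
  qed
  have b1: "b_norm_sq k \<Omega> D \<T> (P1 u) = S + J"
  proof -
    have "b_norm_sq k \<Omega> D \<T> (\<lambda>x. 0, w) = ?E (\<lambda>i x. 0 + cut_part c i x) + h_inner D \<T> W W"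
      by (rule b_norm_sq_eq(1)[OF w V_h_0 W_def])
    then show ?thesis by (simp add: u' P1_def S_def J_def)
  qed
  have J0: "0 \<le> J"
    unfolding J_def h_inner_eq
    using interface_integral_nonneg diam_element_pos cut_mesh_subset by (intro sum_nonneg mult_nonneg_nonneg) (auto simp: less_imp_le subset_iff)
  have "A \<le> ?E (\<lambda>i. u0) * 2 + ?E (\<lambda>i. cut_part c i) * 2"
    unfolding A_def sum_distrib_right sum.distrib[symmetric]
    by (intro sum_mono) (use elem_energy_add_le[OF _ u0 VW] ex_mesh_subset in \<open>force simp: mult.commute\<close>)
  then have A_le: "A \<le> 2 * Z + 2 * S" by (simp add: Z_def S_def)
  show "b_norm_sq k \<Omega> D \<T> u \<le> 2 * (b_norm_sq k \<Omega> D \<T> (P0 u) + b_norm_sq k \<Omega> D \<T> (P1 u))"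
    unfolding bu b0 b1 using A_le J0 by simp
  have "Z \<le> ?E (\<lambda>i x. u0 x + cut_part c i x) * 2 + ?E (\<lambda>i. cut_part c i) * 2"
    unfolding Z_def sum_distrib_right sum.distrib[symmetric]
  proof (intro sum_mono)
    fix i T assume "T \<in> ex_mesh \<T> (D i)"
    then have "T \<in> \<T>" using ex_mesh_subset by blast
    from elem_energy_diff_le[OF this V_h_add[OF u0 VW[of i]] VW[of i]]
    show "elem_energy T u0 \<le> elem_energy T (\<lambda>x. u0 x + cut_part c i x) * 2 + elem_energy T (cut_part c i) * 2" by simp
  qed
  then have Z_le: "Z \<le> 2 * A + 2 * S" by (simp add: A_def S_def)
  have WV: "W \<in> V_h k \<Omega> \<T>" unfolding W_def by (intro V_h_diff VW)
  have "\<exists>x\<in>T. \<forall>y\<in>T. \<bar>W y\<bar> \<le> \<bar>W x\<bar>" if T: "T \<in> ?C" for T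
  proof -
    have TM: "T \<in> \<T>" using T cut_mesh_subset by blast
    have "T \<noteq> {}" using interior_element_nonempty[OF TM] interior_subset by blast
    moreover have "continuous_on T (\<lambda>x. \<bar>W x\<bar>)" using continuous_on_subset[OF V_h_continuous_on[OF WV], of T] by (intro continuous_intros) auto
    ultimately show ?thesis using continuous_attains_sup[OF compact_element[OF TM]] by blast
  qed
  \<comment> \<open>The value bound allows any choice of points; it is applied where the absolute
    value of \<open>W\<close> is largest.\<close>
  then obtain x where x: "\<And>T. T \<in> ?C \<Longrightarrow> x T \<in> T" "\<And>T y. T \<in> ?C \<Longrightarrow> y \<in> T \<Longrightarrow> \<bar>W y\<bar> \<le> \<bar>W (x T)\<bar>" by metis
  have B0: "0 \<le> B" unfolding B by simp
  have cutE: "elem_energy T (cut_part c i) \<le> B * ((W (x T))\<^sup>2 * diameter T ^ (DIM('a) - 2))" if T: "T \<in> ?C" and i: "i \<in> {1, 2}" for T i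
  proof -
    have TM: "T \<in> \<T>" using T cut_mesh_subset by blast
    have "\<bar>cut_part c i z\<bar> \<le> \<bar>W (x T)\<bar>" if z: "z \<in> nodes k \<Omega> \<T>" "z \<in> T" for z
    proof -
      have "z \<notin> D 1 \<or> z \<notin> D 2" using part_D(2) by blast
      moreover have "z \<in> D 1 \<or> z \<in> D 2" using z nodes_off part_D(3) by (auto simp: nodes_def)
      ultimately have "\<bar>cut_part c i z\<bar> \<le> \<bar>W z\<bar>" using i by (auto simp: W_def cut_part_node[OF z(1)])
      also have "\<dots> \<le> \<bar>W (x T)\<bar>" by (rule x(2)[OF T z(2)])
      finally show ?thesis .
    qed
    from energy_le_nodal[OF TM VW this abs_ge_zero] show ?thesis by (simp add: B mult_ac)
  qed
  \<comment> \<open>Uncut elements contribute nothing to \<open>S\<close>, so only those remain on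
    which \<open>W\<close> gives control.\<close>
  have ex_cut: "(\<Sum>T\<in>ex_mesh \<T> (D i). elem_energy T (cut_part c i)) = (\<Sum>T\<in>?C. elem_energy T (cut_part c i))" if i: "i \<in> {1, 2}" for i
  proof (rule sum.mono_neutral_right[OF finex(1)])
    show "?C \<subseteq> ex_mesh \<T> (D i)" using cut_in_ex_mesh i by blast
    show "\<forall>T\<in>ex_mesh \<T> (D i) - ?C. elem_energy T (cut_part c i) = 0"
    proof
      fix T assume T: "T \<in> ex_mesh \<T> (D i) - ?C"
      then have TM: "T \<in> \<T>" using ex_mesh_subset by blast
      have "elem_energy T (cut_part c i) = elem_energy T (\<lambda>x. 0)"
        using T cut_part_uncut[of T i] i by (intro elem_energy_cong[OF TM V_h_0]) auto
      also have "\<dots> = 0"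
      proof -
        have "elem_energy T (\<lambda>x. 0) \<le> (shape_const k TYPE('a) * \<sigma>)\<^sup>2 * unit_ball_vol (real DIM('a)) * (diameter T ^ (DIM('a) - 2) * 0\<^sup>2)"
          by (rule energy_le_nodal[OF TM V_h_0]) auto
        then show ?thesis using elem_energy_nonneg[of T "\<lambda>x. 0"] by simp
      qed
      finally show "elem_energy T (cut_part c i) = 0" .
    qed
  qed
  have sub: "(\<Sum>T\<in>?C. elem_energy T (\<lambda>x. u0 x + cut_part c i x)) \<le> (\<Sum>T\<in>ex_mesh \<T> (D i). elem_energy T (\<lambda>x. u0 x + cut_part c i x))"
    if i: "i \<in> {1, 2}" for i
    using cut_in_ex_mesh i by (intro sum_mono2 finex elem_energy_nonneg) blast
  have "(\<Sum>T\<in>?C. elem_energy T W)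
      \<le> (\<Sum>T\<in>?C. 2 * elem_energy T (\<lambda>x. u0 x + cut_part c 1 x) + 2 * elem_energy T (\<lambda>x. u0 x + cut_part c 2 x))"
  proof (rule sum_mono)
    fix T assume "T \<in> ?C"
    then have "T \<in> \<T>" using cut_mesh_subset by blast
    from elem_energy_diff_le[OF this V_h_add[OF u0 VW[of 1]] V_h_add[OF u0 VW[of 2]]]
    show "elem_energy T W \<le> 2 * elem_energy T (\<lambda>x. u0 x + cut_part c 1 x) + 2 * elem_energy T (\<lambda>x. u0 x + cut_part c 2 x)"
      by (simp add: W_def)
  qed
  also have "\<dots> \<le> 2 * A"
    using sub[of 1] sub[of 2] by (simp add: A_def sum.distrib flip: sum_distrib_left)
  finally have EW: "(\<Sum>T\<in>?C. cut_energy W T) \<le> 2 * A + J"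
    by (simp add: cut_energy_def sum.distrib J_def h_inner_eq)
  \<comment> \<open>The factors are 2 for the two subdomains, \<open>B\<close> from the inverse
    inequality, \<open>K\<close> from the value bound and 2 from
    \<open>2 * A + J \<le> 2 * (A + J)\<close>. As \<open>S\<close> enters the final sum three
    times, 12 results.\<close>
  have "S = (\<Sum>i\<in>{1, 2::nat}. \<Sum>T\<in>?C. elem_energy T (cut_part c i))" unfolding S_def by (intro sum.cong ex_cut) auto
  also have "\<dots> \<le> (\<Sum>i\<in>{1, 2::nat}. \<Sum>T\<in>?C. B * ((W (x T))\<^sup>2 * diameter T ^ (DIM('a) - 2)))"
    by (intro sum_mono cutE)
  also have "\<dots> = 2 * B * (\<Sum>T\<in>?C. (W (x T))\<^sup>2 * diameter T ^ (DIM('a) - 2))" by (simp add: sum_distrib_left mult.assoc)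
  also have "\<dots> \<le> 2 * B * (K * (\<Sum>T\<in>?C. cut_energy W T))"
    using B0 by (intro mult_left_mono vals[OF WV x(1)]) auto
  also have "\<dots> \<le> 2 * B * (K * (2 * A + J))"
    using B0 K EW by (intro mult_left_mono) auto
  also have "\<dots> \<le> 2 * B * (K * (2 * (A + J)))"
    using B0 K J0 by (intro mult_left_mono) auto
  finally have S_le: "S \<le> 4 * B * K * (A + J)" by (simp add: mult_ac)
  have "Z + (S + J) \<le> 2 * (A + J) + 3 * S" using Z_le J0 by simp
  also have "\<dots> \<le> (2 + 12 * B * K) * (A + J)" using S_le by (simp add: algebra_simps)
  finally show "b_norm_sq k \<Omega> D \<T> (P0 u) + b_norm_sq k \<Omega> D \<T> (P1 u) \<le> (2 + 12 * B * K) * b_norm_sq k \<Omega> D \<T> u"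
    unfolding bu b0 b1 .
qed

end

section \<open>Uniform equivalences\<close>

lemma unif_equivI:
  assumes "0 < c\<^sub>1" "0 < c\<^sub>2" "\<And>h u. u \<in> X h \<Longrightarrow> c\<^sub>1 * B h u \<le> A h u" "\<And>h u. u \<in> X h \<Longrightarrow> A h u \<le> c\<^sub>2 * B h u"
  shows "unif_equiv X A B"
  using assms unfolding unif_equiv_def by blast

text \<open>All constants are chosen, from the interface, the domain, \<open>\<sigma>\<close> and
  \<open>k\<close>, before the index \<open>h\<close> is fixed.\<close>

lemma b_norm_unif_equiv:
  fixes \<Omega> :: "'a::euclidean_space set" and \<T> :: "'h \<Rightarrow> 'a set set"
  assumes setting: "\<And>h. cut_mesh_setting \<Omega> (\<T> h) \<sigma> D k" and \<sigma>: "1 \<le> \<sigma>"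
  shows "unif_equiv (\<lambda>h. V_hat k \<Omega> D (\<T> h)) (\<lambda>h u. b_norm_sq k \<Omega> D (\<T> h) u)
       (\<lambda>h u. b_norm_sq k \<Omega> D (\<T> h) (P0 u) + b_norm_sq k \<Omega> D (\<T> h) (P1 u))"
proof -
  \<comment> \<open>An arbitrary mesh of the family gives access to facts about the domain and the
    interface.\<close>
  interpret one: cut_mesh_setting \<Omega> "\<T> undefined" \<sigma> D k by (rule setting)
  let ?d = "DIM('a)"
  obtain \<epsilon> where \<epsilon>: "\<epsilon> > 0" and ball: "\<And>x \<rho>. x \<in> interface D \<Longrightarrow> 0 < \<rho> \<Longrightarrow> \<rho> \<le> \<epsilon> \<Longrightarrow> ball x \<rho> \<subseteq> \<Omega> \<Longrightarrow>
           ennreal (\<epsilon> * \<rho> ^ (?d - 1)) \<le> hausdorff_outer (?d - 1) (interface D \<inter> ball x \<rho>)"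
    using hausdorff_outer_interface_ball[OF one.dim one.smooth one.part one.compact_interface] by blast
  define M where "M = real (Suc ?d) * \<sigma> * size_ratio \<sigma> ?d"
  define \<delta> where "\<delta> = diameter (closure \<Omega>)"
  \<comment> \<open>The first term keeps balls in the star of an element, the second keeps their
    radius below \<open>\<epsilon>\<close>; the added 1 avoids a vanishing denominator.\<close>
  define c where "c = min (1 / M) (\<epsilon> / (\<delta> + 1))"
  define b where "b = \<epsilon> * c ^ (?d - 1) / real (Suc ?d * overlap_bound \<sigma> ?d)"
  define K0 where "K0 = diff_const k \<sigma> TYPE('a) + (3 * diff_const k \<sigma> TYPE('a) + 3 * size_ratio \<sigma> ?d ^ (?d - 2) * diff_const k \<sigma> TYPE('a) + 3 * size_ratio \<sigma> ?d / b)"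
  define K where "K = K0 * (1 + real (Suc ?d * overlap_bound \<sigma> ?d))"
  define B where "B = (shape_const k TYPE('a) * \<sigma>)\<^sup>2 * unit_ball_vol (real ?d)"
  have sr: "1 \<le> size_ratio \<sigma> ?d" using \<sigma> by (simp add: size_ratio_def one_le_power)
  have M: "M > 0" using \<sigma> sr by (simp add: M_def)
  have \<delta>: "\<delta> \<ge> 0" unfolding \<delta>_def using one.bounded_domain by (intro diameter_ge_0 bounded_closure)
  have c: "0 < c" "c * M \<le> 1" "c * \<delta> \<le> \<epsilon>"
  proof -
    show c0: "0 < c" using M \<epsilon> \<delta> by (simp add: c_def)
    have "c \<le> 1 / M" by (simp add: c_def)
    then show "c * M \<le> 1" using M by (simp add: pos_le_divide_eq)
    have "c \<le> \<epsilon> / (\<delta> + 1)" by (simp add: c_def)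
    then have "c * (\<delta> + 1) \<le> \<epsilon>" using \<delta> by (simp add: pos_le_divide_eq)
    then show "c * \<delta> \<le> \<epsilon>" using c0 by (simp add: distrib_left)
  qed
  have b: "0 \<le> b" using \<epsilon> c by (simp add: b_def)
  have K0: "0 \<le> K0" unfolding K0_def using one.diff_const_nonneg sr b by (intro add_nonneg_nonneg mult_nonneg_nonneg divide_nonneg_nonneg) auto
  then have K: "0 \<le> K" unfolding K_def by simp
  have B: "0 \<le> B" by (simp add: B_def)
  define R where "R = 2 + 12 * B * K"
  have R: "R > 0" using B K by (simp add: R_def add_pos_nonneg)
  show ?thesis
  proof (rule unif_equivI[of "1 / R" 2])
    fix h u assume u: "u \<in> V_hat k \<Omega> D (\<T> h)"
    interpret cut_mesh_setting \<Omega> "\<T> h" \<sigma> D k by (rule setting)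
    have vals: "(\<Sum>T\<in>cut_mesh (\<T> h) D. (f (x T))\<^sup>2 * diameter T ^ (?d - 2)) \<le> K * (\<Sum>T\<in>cut_mesh (\<T> h) D. cut_energy f T)"
      if "f \<in> V_h k \<Omega> (\<T> h)" "\<And>T. T \<in> cut_mesh (\<T> h) D \<Longrightarrow> x T \<in> T" for f x
      unfolding K_def
      by (rule values_le_cut_energy[OF \<epsilon> ball c(1) c(2)[unfolded M_def] c(3)[unfolded \<delta>_def] b_def K0_def that])
    note split = b_norm_splitting[OF K vals B_def u]
    show "b_norm_sq k \<Omega> D (\<T> h) u \<le> 2 * (b_norm_sq k \<Omega> D (\<T> h) (P0 u) + b_norm_sq k \<Omega> D (\<T> h) (P1 u))"
      by (rule split(1))
    show "1 / R * (b_norm_sq k \<Omega> D (\<T> h) (P0 u) + b_norm_sq k \<Omega> D (\<T> h) (P1 u)) \<le> b_norm_sq k \<Omega> D (\<T> h) u"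
      using split(2) R unfolding R_def[symmetric] by (simp add: pos_divide_le_eq mult.commute)
  qed (use R in auto)
qed

text \<open>The equivalence of \<open>A\<close> and \<open>B\<close> is used once for
  \<open>u\<close> and once for \<open>p u\<close> and \<open>q u\<close>, which stay in the
  space.\<close>

lemma unif_equiv_transfer:
  assumes ab: "unif_equiv X A B" and splitB: "unif_equiv X B (\<lambda>h u. B h (p u) + B h (q u))"
    and p: "\<And>h u. u \<in> X h \<Longrightarrow> p u \<in> X h" and q: "\<And>h u. u \<in> X h \<Longrightarrow> q u \<in> X h"
  shows "unif_equiv X A (\<lambda>h u. A h (p u) + A h (q u))"
proof -
  obtain c1 c2 where c: "c1 > 0" "c2 > 0" "\<And>h u. u \<in> X h \<Longrightarrow> c1 * B h u \<le> A h u" "\<And>h u. u \<in> X h \<Longrightarrow> A h u \<le> c2 * B h u"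
    using ab unfolding unif_equiv_def by blast
  obtain d1 d2 where d: "d1 > 0" "d2 > 0" "\<And>h u. u \<in> X h \<Longrightarrow> d1 * (B h (p u) + B h (q u)) \<le> B h u"
     "\<And>h u. u \<in> X h \<Longrightarrow> B h u \<le> d2 * (B h (p u) + B h (q u))"
    using splitB unfolding unif_equiv_def by blast
  show ?thesis
  proof (rule unif_equivI[of "c1 * d1 / c2" "c2 * d2 / c1"])
    fix h u assume u: "u \<in> X h"
    let ?A = "A h (p u) + A h (q u)" and ?B = "B h (p u) + B h (q u)"
    have 1: "?A \<le> c2 * ?B" using c(4)[OF p[OF u]] c(4)[OF q[OF u]] by (simp add: distrib_left)
    have 2: "c1 * ?B \<le> ?A" using c(3)[OF p[OF u]] c(3)[OF q[OF u]] by (simp add: distrib_left)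
    have "c1 * d1 / c2 * ?A \<le> c1 * d1 / c2 * (c2 * ?B)" using 1 c d by (intro mult_left_mono) auto
    also have "\<dots> = c1 * (d1 * ?B)" using c by simp
    also have "\<dots> \<le> c1 * B h u" using c d(3)[OF u] by (intro mult_left_mono) auto
    also have "\<dots> \<le> A h u" by (rule c(3)[OF u])
    finally show "c1 * d1 / c2 * ?A \<le> A h u" .
    have "A h u \<le> c2 * B h u" by (rule c(4)[OF u])
    also have "\<dots> \<le> c2 * (d2 * ?B)" using c d(4)[OF u] by (intro mult_left_mono) auto
    also have "\<dots> = c2 * d2 / c1 * (c1 * ?B)" using c by simp
    also have "\<dots> \<le> c2 * d2 / c1 * ?A" using 2 c d by (intro mult_left_mono) auto
    finally show "A h u \<le> c2 * d2 / c1 * ?A" .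
  qed (use c d in auto)
qed

theorem theorem5p2:
  fixes \<Omega> :: "'a::euclidean_space set"
    and D :: "nat \<Rightarrow> 'a set"
    and k :: nat
    and \<T> :: "'h \<Rightarrow> 'a set set"
    and \<alpha> :: "nat \<Rightarrow> real"
    and \<gamma> \<beta> :: real
    and \<kappa> :: "'h \<Rightarrow> nat \<Rightarrow> 'a \<Rightarrow> real"
    and \<alpha>\<^sub>a :: "'h \<Rightarrow> real"
    and \<F> :: "'h \<Rightarrow> nat \<Rightarrow> 'a set set"
  assumes "DIM('a) = 2 \<or> DIM('a) = 3"
    and "k \<ge> 1"
    and "polygonal_domain \<Omega>"
    and "partitioning \<Omega> D"
    and "smooth_interface \<Omega> D"
    and "\<And>h. simplicial_mesh \<Omega> (\<T> h)"
    and "shape_regular \<T>"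
    and "\<And>h. nodes k \<Omega> (\<T> h) \<inter> interface D = {}"
    and "\<alpha> 1 > 0" and "\<alpha> 2 > 0" and "\<gamma> > 0" and "\<beta> > 0"
    and "\<And>h. averaging_weights D (\<kappa> h)"
    and "\<And>h. min (\<alpha> 1) (\<alpha> 2) \<le> \<alpha>\<^sub>a h \<and> \<alpha>\<^sub>a h \<le> max (\<alpha> 1) (\<alpha> 2)"
    and "\<And>h i. i \<in> {1,2} \<Longrightarrow> \<F> h i \<subseteq> cut_faces D (\<T> h) i"
    and norm_equiv:
      "unif_equiv (\<lambda>h. V_hat k \<Omega> D (\<T> h))
         (\<lambda>h u. A_hat k \<Omega> D (\<T> h) \<alpha> \<gamma> \<beta> (\<kappa> h) (\<alpha>\<^sub>a h) (\<F> h) u u)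
         (\<lambda>h u. cut_norm_sq D (\<T> h) (L k \<Omega> D (\<T> h) u))"
  shows
    "unif_equiv (\<lambda>h. V_hat k \<Omega> D (\<T> h))
       (\<lambda>h u. b_norm_sq k \<Omega> D (\<T> h) u)
       (\<lambda>h u. b_norm_sq k \<Omega> D (\<T> h) (P0 u) + b_norm_sq k \<Omega> D (\<T> h) (P1 u)) \<and>
     unif_equiv (\<lambda>h. V_hat k \<Omega> D (\<T> h))
       (\<lambda>h u. a_norm_sq k \<Omega> D (\<T> h) \<alpha> \<gamma> \<beta> (\<kappa> h) (\<alpha>\<^sub>a h) (\<F> h) u)
       (\<lambda>h u. a_norm_sq k \<Omega> D (\<T> h) \<alpha> \<gamma> \<beta> (\<kappa> h) (\<alpha>\<^sub>a h) (\<F> h) (P0 u) +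
              a_norm_sq k \<Omega> D (\<T> h) \<alpha> \<gamma> \<beta> (\<kappa> h) (\<alpha>\<^sub>a h) (\<F> h) (P1 u))"
proof -
  obtain \<sigma>0 where \<sigma>0: "\<And>h T. T \<in> \<T> h \<Longrightarrow> \<exists>x r. 0 < r \<and> cball x r \<subseteq> T \<and> diameter T \<le> \<sigma>0 * r"
    using \<open>shape_regular \<T>\<close> unfolding shape_regular_def by blast
  \<comment> \<open>Shape regularity persists for a larger constant, and at least 1 makes the size
    ratio at least 1.\<close>
  define \<sigma> where "\<sigma> = max \<sigma>0 1"
  have setting: "cut_mesh_setting \<Omega> (\<T> h) \<sigma> D k" for h
  proof unfold_locales
    fix T assume "T \<in> \<T> h"
    then obtain x r where r: "0 < r" "cball x r \<subseteq> T" "diameter T \<le> \<sigma>0 * r" using \<sigma>0 by blast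
    have "\<sigma>0 * r \<le> \<sigma> * r" using r(1) by (intro mult_right_mono) (auto simp: \<sigma>_def)
    then show "\<exists>x r. 0 < r \<and> cball x r \<subseteq> T \<and> diameter T \<le> \<sigma> * r" using r by (meson order_trans)
  qed (use assms in auto)
  have b: "unif_equiv (\<lambda>h. V_hat k \<Omega> D (\<T> h)) (\<lambda>h u. b_norm_sq k \<Omega> D (\<T> h) u)
       (\<lambda>h u. b_norm_sq k \<Omega> D (\<T> h) (P0 u) + b_norm_sq k \<Omega> D (\<T> h) (P1 u))"
    by (rule b_norm_unif_equiv[OF setting]) (simp add: \<sigma>_def)
  \<comment> \<open>The cut norm of \<open>L u\<close> in \<open>norm_equiv\<close> equals the
    b-norm of \<open>u\<close>.\<close>
  have ab: "unif_equiv (\<lambda>h. V_hat k \<Omega> D (\<T> h))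
         (\<lambda>h u. a_norm_sq k \<Omega> D (\<T> h) \<alpha> \<gamma> \<beta> (\<kappa> h) (\<alpha>\<^sub>a h) (\<F> h) u)
         (\<lambda>h u. b_norm_sq k \<Omega> D (\<T> h) u)"
    using norm_equiv cut_mesh_setting.cut_norm_sq_L[OF setting]
    unfolding unif_equiv_def a_norm_sq_def by simp
  show ?thesis
    using b unif_equiv_transfer[OF ab b] cut_mesh_setting.P0_V_hat[OF setting] cut_mesh_setting.P1_V_hat[OF setting]
    by blast
qed

end
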